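(* Let $m\in\mathbb N$, let $\tau,\nu\in S_m$ be permutations of $\{1,\ldots,m\}$, and let $r\in\{\rho,\hat\rho\}$. Given sets $\Psi_1,\ldots,\Psi_m$ as in (i) or (ii) below, denote for $j=1,\ldots,m$ $$\Omega_j=\Psi_{\tau(j)}^*\Psi_{\nu(j)}\cdots\Psi_{\tau(m)}^*\Psi_{\nu(m)}\,\Psi_{\tau(1)}^*\Psi_{\nu(1)}\cdots\Psi_{\tau(j-1)}^*\Psi_{\nu(j-1)}.$$ (i) If $\Psi_1,\ldots,\Psi_m$ are bounded sets of positive kernel operators on $L^2(X,\mu)$, then $$\big\|\Psi_1^{(\frac1m)}\circ\cdots\circ\Psi_m^{(\frac1m)}\big\|\le r\big((\Psi_{\tau(1)}^*\Psi_{\nu(1)})^{(\frac1m)}\circ\cdots\circ(\Psi_{\tau(m)}^*\Psi_{\nu(m)})^{(\frac1m)}\big)^{\frac12}$$ $$\le r\big(\Omega_1^{(\frac1m)}\circ\cdots\circ\Omega_m^{(\frac1m)}\big)^{\frac1{2m}}\le r\big(\Psi_{\tau(1)}^*\Psi_{\nu(1)}\cdots\Psi_{\tau(m)}^*\Psi_{\nu(m)}\big)^{\frac1{2m}}.$$ (ii) If $\Psi_1,\ldots,\Psi_m$ are bounded sets of nonnegative matrices that define operators on $l^2(R)$ and $\alpha\ge\frac1m$, then $$\big\|\Psi_1^{(\alpha)}\circ\cdots\circ\Psi_m^{(\alpha)}\big\|\le r\big((\Psi_{\tau(1)}^*\Psi_{\nu(1)})^{(\alpha)}\circ\cdots\circ(\Psi_{\tau(m)}^*\Psi_{\nu(m)})^{(\alpha)}\big)^{\frac12}$$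 $$\le r\big(\Omega_1^{(\alpha)}\circ\cdots\circ\Omega_m^{(\alpha)}\big)^{\frac1{2m}}\le r\big(\Psi_{\tau(1)}^*\Psi_{\nu(1)}\cdots\Psi_{\tau(m)}^*\Psi_{\nu(m)}\big)^{\frac\alpha2}.$$
   Context: $(X,\mathfrak M,\mu)$ is a nonempty set with a $\sigma$-finite positive measure and $L^2(X,\mu)$ is the complex Hilbert space. A linear operator $A$ on it is positive if it maps a.e. nonnegative functions to a.e. nonnegative functions (then it is bounded). It is a kernel operator if there is a $\mu\times\mu$-measurable $a$ on $X\times X$ such that for all $f\in L^2(X,\mu)$ and almost all $x$, $\int_X|a(x,y)f(y)|\,d\mu(y)<\infty$ and $(Af)(x)=\int_X a(x,y)f(y)\,d\mu(y)$. For positive kernel operators $A_1,\ldots,A_m$ with kernels $a_1,\ldots,a_m$ and positive $\alpha_j$ with $\sum_j\alpha_j=1$, $A_1^{(\alpha_1)}\circ\cdots\circ A_m^{(\alpha_m)}$ is the positive kernel operator with kernel $a_1(x,y)^{\alpha_1}\cdots a_m(x,y)^{\alpha_m}$. $R$ is $\mathbb N$ or $\{1,\ldots,N\}$ for some $N\in\mathbb N$, and $l^2(R)$ is the complex Hilbert space. A matrix $A=[a_{ij}]_{i,j\in R}$ is nonnegative if all $a_{ij}\ge0$; it defines an operator on $l^2(R)$ if $Ax\in l^2(R)$ for all $x\in l^2(R)$, where $(Ax)_i=\sum_j a_{ij}x_j$ (the operator is then positive and bounded). Matrices are identified with the operators they define. For nonnegative matrices $A_j=[a^{(j)}_{ik}]$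 and positive $\alpha_j$, $A_1^{(\alpha_1)}\circ\cdots\circ A_m^{(\alpha_m)}$ is the matrix with entries $\prod_j (a^{(j)}_{ik})^{\alpha_j}$ (if $\sum_j\alpha_j\ge1$ and the $A_j$ define operators on $l^2(R)$, it defines an operator on $l^2(R)$). For bounded (in operator norm) sets of operators: $\Psi_1\cdots\Psi_k=\{A_1\cdots A_k: A_i\in\Psi_i\}$, $\Sigma^k=\{A_1\cdots A_k:A_i\in\Sigma\}$, $\Psi^*=\{A^*:A\in\Psi\}$ ($A^*$ the adjoint), $\|\Psi\|=\sup_{A\in\Psi}\|A\|$, and $\Psi_1^{(\alpha_1)}\circ\cdots\circ\Psi_m^{(\alpha_m)}=\{A_1^{(\alpha_1)}\circ\cdots\circ A_m^{(\alpha_m)}:A_j\in\Psi_j\}$ (elements chosen independently from each factor). With $\rho(A)$ the spectral radius of an operator, for a bounded set $\Sigma$ of bounded operators: $\rho(\Sigma)=\limsup_{k\to\infty}[\sup_{A\in\Sigma^k}\rho(A)]^{1/k}$ and $\hat\rho(\Sigma)=\lim_{k\to\infty}[\sup_{A\in\Sigma^k}\|A\|]^{1/k}$. *)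

theory Defs
  imports "HOL-Analysis.Analysis" "HOL-Combinatorics.Permutations" "HOL-Library.Nonpos_Ints"
begin

text \<open>
  The library has no complex Hilbert space \<open>L\<^sup>2(M)\<close>. As usual in \<^theory>\<open>HOL-Analysis.Analysis\<close>,
  its elements are represented by square-integrable functions, and equality in \<open>L\<^sup>2(M)\<close> is equality
  almost everywhere. An operator is represented by a map on representatives that respects
  a.e. equality; consequently a set of operators may contain several representatives of
  the same operator, which affects none of the suprema below.
\<close>

definition L2 :: "'a measure \<Rightarrow> ('a \<Rightarrow> complex) set" where
  "L2 M = {f \<in> borel_measurable M. integrable M (\<lambda>x. (cmod (f x))\<^sup>2)}"

definition L2_norm :: "'a measure \<Rightarrow> ('a \<Rightarrow> complex) \<Rightarrow> real" where
  "L2_norm M f = sqrt (LINT x|M. (cmod (f x))\<^sup>2)"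

definition L2_inner :: "'a measure \<Rightarrow> ('a \<Rightarrow> complex) \<Rightarrow> ('a \<Rightarrow> complex) \<Rightarrow> complex" where
  "L2_inner M f g = (LINT x|M. f x * cnj (g x))"

text \<open>\<open>l\<^sup>2(R)\<close> is \<open>L\<^sup>2\<close> of the counting measure on \<open>R\<close>; values of sequences outside \<open>R\<close> are irrelevant.\<close>

abbreviation l2 :: "'i set \<Rightarrow> ('i \<Rightarrow> complex) set" where
  "l2 R \<equiv> L2 (count_space R)"

type_synonym 'a oper = "('a \<Rightarrow> complex) \<Rightarrow> ('a \<Rightarrow> complex)"

definition linear_operator :: "'a measure \<Rightarrow> 'a oper \<Rightarrow> bool" where
  "linear_operator M A \<longleftrightarrow>
     (\<forall>f\<in>L2 M. A f \<in> L2 M) \<and>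
     (\<forall>f\<in>L2 M. \<forall>g\<in>L2 M. (AE x in M. f x = g x) \<longrightarrow> (AE x in M. A f x = A g x)) \<and>
     (\<forall>f\<in>L2 M. \<forall>g\<in>L2 M. AE x in M. A (\<lambda>y. f y + g y) x = A f x + A g x) \<and>
     (\<forall>c. \<forall>f\<in>L2 M. AE x in M. A (\<lambda>y. c * f y) x = c * A f x)"

definition bounded_operator :: "'a measure \<Rightarrow> 'a oper \<Rightarrow> bool" where
  "bounded_operator M A \<longleftrightarrow>
     linear_operator M A \<and> (\<exists>B. \<forall>f\<in>L2 M. L2_norm M (A f) \<le> B * L2_norm M f)"

text \<open>As in the library's \<^const>\<open>onorm\<close>, elements of norm zero contribute \<open>0 / 0 = 0\<close>.\<close>

definition op_norm :: "'a measure \<Rightarrow> 'a oper \<Rightarrow> real" where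
  "op_norm M A = (SUP f\<in>L2 M. L2_norm M (A f) / L2_norm M f)"

definition positive_operator :: "'a measure \<Rightarrow> 'a oper \<Rightarrow> bool" where
  "positive_operator M A \<longleftrightarrow> linear_operator M A \<and>
     (\<forall>f\<in>L2 M. (AE x in M. f x \<in> \<real>\<^sub>\<ge>\<^sub>0) \<longrightarrow> (AE x in M. A f x \<in> \<real>\<^sub>\<ge>\<^sub>0))"

text \<open>
  Integrability of \<open>\<lambda>y. k (x, y) * f y\<close> is finiteness of the integral of its absolute value.
\<close>

definition has_kernel :: "'a measure \<Rightarrow> 'a oper \<Rightarrow> ('a \<times> 'a \<Rightarrow> complex) \<Rightarrow> bool" where
  "has_kernel M A k \<longleftrightarrow> linear_operator M A \<and> k \<in> borel_measurable (M \<Otimes>\<^sub>M M) \<and>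
     (\<forall>f\<in>L2 M. AE x in M.
        integrable M (\<lambda>y. k (x, y) * f y) \<and> A f x = (LINT y|M. k (x, y) * f y))"

definition positive_kernel_operator :: "'a measure \<Rightarrow> 'a oper \<Rightarrow> bool" where
  "positive_kernel_operator M A \<longleftrightarrow> positive_operator M A \<and> (\<exists>k. has_kernel M A k)"

definition has_nonneg_kernel :: "'a measure \<Rightarrow> 'a oper \<Rightarrow> ('a \<Rightarrow> 'a \<Rightarrow> real) \<Rightarrow> bool" where
  "has_nonneg_kernel M A a \<longleftrightarrow> (\<forall>x\<in>space M. \<forall>y\<in>space M. 0 \<le> a x y) \<and>
     has_kernel M A (\<lambda>(x, y). complex_of_real (a x y))"

definition has_nonneg_matrix :: "'i set \<Rightarrow> 'i oper \<Rightarrow> ('i \<Rightarrow> 'i \<Rightarrow> real) \<Rightarrow> bool" where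
  "has_nonneg_matrix R A a \<longleftrightarrow> (\<forall>i\<in>R. \<forall>j\<in>R. 0 \<le> a i j) \<and>
     linear_operator (count_space R) A \<and>
     (\<forall>x\<in>l2 R. \<forall>i\<in>R. (\<lambda>j. complex_of_real (a i j) * x j) summable_on R \<and>
        A x i = (\<Sum>\<^sub>\<infinity>j\<in>R. complex_of_real (a i j) * x j))"

definition nonneg_matrix_operator :: "'i set \<Rightarrow> 'i oper \<Rightarrow> bool" where
  "nonneg_matrix_operator R A \<longleftrightarrow> (\<exists>a. has_nonneg_matrix R A a)"

text \<open>
  The set of all \<open>A\<^sub>1\<^bsup>(\<alpha>\<^sub>1)\<^esup> \<circ> \<dots> \<circ> A\<^sub>m\<^bsup>(\<alpha>\<^sub>m)\<^esup>\<close> with \<open>A\<^sub>j \<in> \<Psi>\<^sub>j\<close>. The relation \<open>rep\<close> links an operator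
  with its kernel (\<^const>\<open>has_nonneg_kernel\<close>) or matrix (\<^const>\<open>has_nonneg_matrix\<close>). The resulting operator
  does not depend on the chosen \<open>a j\<close>, since these are unique up to null sets. Note
  \<open>0 powr t = 0\<close>, as needed for positive exponents.
\<close>

definition hadamard_power_set ::
    "('a oper \<Rightarrow> ('a \<Rightarrow> 'a \<Rightarrow> real) \<Rightarrow> bool) \<Rightarrow> nat \<Rightarrow> (nat \<Rightarrow> real) \<Rightarrow> (nat \<Rightarrow> 'a oper set) \<Rightarrow> 'a oper set"
  where
  "hadamard_power_set rep m \<alpha> \<Psi> =
     {C. \<exists>A a. (\<forall>j\<in>{1..m}. A j \<in> \<Psi> j \<and> rep (A j) (a j)) \<and>
               rep C (\<lambda>x y. \<Prod>j\<in>{1..m}. a j x y powr \<alpha> j)}"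

definition kernel_hadamard ::
    "'a measure \<Rightarrow> nat \<Rightarrow> (nat \<Rightarrow> real) \<Rightarrow> (nat \<Rightarrow> 'a oper set) \<Rightarrow> 'a oper set" where
  "kernel_hadamard M = hadamard_power_set (has_nonneg_kernel M)"

definition matrix_hadamard ::
    "'i set \<Rightarrow> nat \<Rightarrow> (nat \<Rightarrow> real) \<Rightarrow> (nat \<Rightarrow> 'i oper set) \<Rightarrow> 'i oper set" where
  "matrix_hadamard R = hadamard_power_set (has_nonneg_matrix R)"

definition op_set_mult :: "'a oper set \<Rightarrow> 'a oper set \<Rightarrow> 'a oper set" where
  "op_set_mult \<Phi> \<Psi> = {A \<circ> B | A B. A \<in> \<Phi> \<and> B \<in> \<Psi>}"

definition op_set_prod :: "'a oper set list \<Rightarrow> 'a oper set" where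
  "op_set_prod \<Psi>s = foldr op_set_mult \<Psi>s {id}"

definition op_set_power :: "'a oper set \<Rightarrow> nat \<Rightarrow> 'a oper set" where
  "op_set_power \<Sigma> k = op_set_prod (replicate k \<Sigma>)"

definition is_adjoint :: "'a measure \<Rightarrow> 'a oper \<Rightarrow> 'a oper \<Rightarrow> bool" where
  "is_adjoint M A B \<longleftrightarrow> bounded_operator M B \<and>
     (\<forall>f\<in>L2 M. \<forall>g\<in>L2 M. L2_inner M (A f) g = L2_inner M f (B g))"

definition adjoint_set :: "'a measure \<Rightarrow> 'a oper set \<Rightarrow> 'a oper set" where
  "adjoint_set M \<Psi> = {B. \<exists>A\<in>\<Psi>. is_adjoint M A B}"

text \<open>
  All suprema over possibly empty sets are taken in \<open>[0, \<infinity>)\<close>, i.e. the supremum of the empty set is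
  \<open>0\<close>; this is the purpose of \<open>insert 0\<close>. The spectrum is empty when \<open>L\<^sup>2(M)\<close> is trivial.
\<close>

definition bounded_op_set :: "'a measure \<Rightarrow> 'a oper set \<Rightarrow> bool" where
  "bounded_op_set M \<Sigma> \<longleftrightarrow> (\<forall>A\<in>\<Sigma>. bounded_operator M A) \<and> bdd_above (op_norm M ` \<Sigma>)"

definition set_norm :: "'a measure \<Rightarrow> 'a oper set \<Rightarrow> real" where
  "set_norm M \<Sigma> = Sup (insert 0 (op_norm M ` \<Sigma>))"

definition op_spectrum :: "'a measure \<Rightarrow> 'a oper \<Rightarrow> complex set" where
  "op_spectrum M A = {z. \<not> (\<exists>S. bounded_operator M S \<and>
     (\<forall>f\<in>L2 M. (AE x in M. S (\<lambda>y. z * f y - A f y) x = f x) \<and>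
               (AE x in M. z * S f x - A (S f) x = f x)))}"

definition op_spectral_radius :: "'a measure \<Rightarrow> 'a oper \<Rightarrow> real" where
  "op_spectral_radius M A = Sup (insert 0 (cmod ` op_spectrum M A))"

definition generalized_spectral_radius :: "'a measure \<Rightarrow> 'a oper set \<Rightarrow> real" where
  "generalized_spectral_radius M \<Sigma> = real_of_ereal (limsup (\<lambda>k.
     ereal (Sup (insert 0 (op_spectral_radius M ` op_set_power \<Sigma> k)) powr (1 / real k))))"

definition joint_spectral_radius :: "'a measure \<Rightarrow> 'a oper set \<Rightarrow> real" where
  "joint_spectral_radius M \<Sigma> = lim (\<lambda>k. set_norm M (op_set_power \<Sigma> k) powr (1 / real k))"

text \<open>The set \<open>\<Psi>\<^bsub>\<tau>(i)\<^esub>\<^sup>* \<Psi>\<^bsub>\<nu>(i)\<^esub>\<close>, and the products \<open>\<Omega>\<^sub>j\<close> of its cyclic shifts starting at \<open>j\<close>.\<close>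

definition star_pair ::
    "'a measure \<Rightarrow> (nat \<Rightarrow> nat) \<Rightarrow> (nat \<Rightarrow> nat) \<Rightarrow> (nat \<Rightarrow> 'a oper set) \<Rightarrow> nat \<Rightarrow> 'a oper set" where
  "star_pair M \<tau> \<nu> \<Psi> i = op_set_mult (adjoint_set M (\<Psi> (\<tau> i))) (\<Psi> (\<nu> i))"

definition Omega_set ::
    "'a measure \<Rightarrow> nat \<Rightarrow> (nat \<Rightarrow> nat) \<Rightarrow> (nat \<Rightarrow> nat) \<Rightarrow> (nat \<Rightarrow> 'a oper set) \<Rightarrow> nat \<Rightarrow> 'a oper set" where
  "Omega_set M m \<tau> \<nu> \<Psi> j = op_set_prod (map (star_pair M \<tau> \<nu> \<Psi>) ([j..<Suc m] @ [1..<j]))"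

end

(*
  Kernelwise, a product of Hadamard weighted means is dominated by the Hadamard mean of the products
  (Hoelder's inequality), and the norm of a Hadamard mean is at most the corresponding product of
  powers of norms (AM-GM with weights e_j / N_j). Since 0 <= A <= B gives |A^n| <= 4 |B^n|, such
  dominations pass to all spectral radii once rho(A) = lim |A^n|^(1/n) is known. For positive A this
  needs no complex analysis: if the limit L were in the resolvent set, the resolvents would stay
  bounded near L, although the square of the resolvent at t dominates (n + 1) A^n / t^(n + 2).
  The first inequality is |C|^2 <= |(C* C)^n|^(1/n) for n = 2^k together with the domination of C* C;
  for the second one, reorder the factors of the i-th of m Hadamard means by the cyclic shift by i;
  the third one uses r(P Q) = r(Q P). Matrices are kernels for counting measure, where Hoelder's
  inequality also holds for exponents of sum greater than one.
*)
theory Submission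
  imports Defs "HOL-Library.Complex_Order"
begin

subsection \<open>Square-integrable functions\<close>

text \<open>Operators act on representatives, so each identity between them holds off a null set
  that depends on the function; only countably many can be combined at one point, and series and
  iterates are therefore handled termwise. A Hadamard mean is nonlinear in its factors and need not
  act on L2 a priori. The AM-GM weights repair this: they put its kernel below a linear combination
  of the factor kernels, which settles existence, boundedness and, with weights adapted to the
  norms, the norm bound. For exponents above 1 / m the normalised entries must be at most 1, and
  this is where counting measure enters. Permutations cost nothing because equal exponents make the
  mean symmetric: the adjoint may be listed along \<tau> and the operator itself along \<nu>, and
  Hoelder in the inner variable pairs them. Adjoints occur in two ways: one of a Hadamard mean has
  to be produced, by transposing the kernel and bounding it by duality, whereas an arbitrary element
  of \<open>adjoint_set\<close> comes without a kernel, so its positivity is read off from inner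
  products.\<close>

lemma L2_measurable [measurable_dest]: "f \<in> L2 M \<Longrightarrow> f \<in> borel_measurable M"
  by (simp add: L2_def)

lemma L2_integrable: "f \<in> L2 M \<Longrightarrow> integrable M (\<lambda>x. (cmod (f x))\<^sup>2)"
  by (simp add: L2_def)

lemma L2_norm_nonneg [simp]: "0 \<le> L2_norm M f"
  by (simp add: L2_norm_def)

lemma L2_norm_square: "(L2_norm M f)\<^sup>2 = (LINT x|M. (cmod (f x))\<^sup>2)"
  by (simp add: L2_norm_def)

lemma L2_bound:
  assumes "f \<in> L2 M" "g \<in> borel_measurable M" "AE x in M. cmod (g x) \<le> cmod (f x)"
  shows "g \<in> L2 M" "L2_norm M g \<le> L2_norm M f"
proof -
  have le: "AE x in M. (cmod (g x))\<^sup>2 \<le> (cmod (f x))\<^sup>2"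
    using assms(3) by eventually_elim (simp add: power_mono)
  have "integrable M (\<lambda>x. (cmod (g x))\<^sup>2)"
    using assms(1,2) le by (intro Bochner_Integration.integrable_bound[OF L2_integrable[OF assms(1)]]) auto
  then show "g \<in> L2 M"
    using assms by (simp add: L2_def)
  show "L2_norm M g \<le> L2_norm M f"
    unfolding L2_norm_def using le assms
    by (intro real_sqrt_le_mono integral_mono_AE') (auto simp: L2_def)
qed

lemma L2_norm_cong_AE:
  assumes "f \<in> L2 M" "g \<in> borel_measurable M" "AE x in M. g x = f x"
  shows "g \<in> L2 M" "L2_norm M g = L2_norm M f"
proof -
  have 1: "AE x in M. cmod (g x) \<le> cmod (f x)" "AE x in M. cmod (f x) \<le> cmod (g x)"
    using assms(3) by (eventually_elim; simp)+
  show 2: "g \<in> L2 M"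
    using L2_bound[OF assms(1,2) 1(1)] by simp
  show "L2_norm M g = L2_norm M f"
    using L2_bound(2)[OF assms(1,2) 1(1)] L2_bound(2)[OF 2 L2_measurable[OF assms(1)] 1(2)] by simp
qed

lemma L2_norm_zero_iff:
  assumes "f \<in> L2 M"
  shows "L2_norm M f = 0 \<longleftrightarrow> (AE x in M. f x = 0)"
  unfolding L2_norm_def using integral_nonneg_eq_0_iff_AE[OF L2_integrable[OF assms]] by simp

lemma L2_zero [simp]: "(\<lambda>x. 0) \<in> L2 M" "L2_norm M (\<lambda>x. 0) = 0"
  by (simp_all add: L2_def L2_norm_def)

lemma L2_mult_integrable:
  assumes "f \<in> L2 M" "g \<in> L2 M"
  shows "integrable M (\<lambda>x. cmod (f x) * cmod (g x))"
proof (rule Bochner_Integration.integrable_bound)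
  show "integrable M (\<lambda>x. (cmod (f x))\<^sup>2 + (cmod (g x))\<^sup>2)"
    using assms by (simp add: L2_integrable)
  show "AE x in M. norm (cmod (f x) * cmod (g x)) \<le> norm ((cmod (f x))\<^sup>2 + (cmod (g x))\<^sup>2)"
  proof (intro AE_I2)
    fix x
    have "2 * cmod (f x) * cmod (g x) \<le> (cmod (f x))\<^sup>2 + (cmod (g x))\<^sup>2"
      by (rule sum_squares_bound)
    moreover have "0 \<le> cmod (f x) * cmod (g x)"
      by simp
    ultimately have "cmod (f x) * cmod (g x) \<le> (cmod (f x))\<^sup>2 + (cmod (g x))\<^sup>2"
      by linarith
    then show "norm (cmod (f x) * cmod (g x)) \<le> norm ((cmod (f x))\<^sup>2 + (cmod (g x))\<^sup>2)"
      by (simp add: norm_mult)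
  qed
qed (use assms in measurable)

lemma L2_Cauchy_Schwarz:
  assumes "f \<in> L2 M" "g \<in> L2 M"
  shows "(LINT x|M. cmod (f x) * cmod (g x)) \<le> L2_norm M f * L2_norm M g"
proof -
  note [measurable] = L2_measurable[OF assms(1)] L2_measurable[OF assms(2)]
  have "(\<integral>\<^sup>+x. ennreal (cmod (f x)) * ennreal (cmod (g x)) \<partial>M)\<^sup>2
      \<le> (\<integral>\<^sup>+x. (ennreal (cmod (f x)))\<^sup>2 \<partial>M) * (\<integral>\<^sup>+x. (ennreal (cmod (g x)))\<^sup>2 \<partial>M)"
    by (rule Cauchy_Schwarz_nn_integral) measurable
  also have "(\<integral>\<^sup>+x. ennreal (cmod (f x)) * ennreal (cmod (g x)) \<partial>M)
      = ennreal (LINT x|M. cmod (f x) * cmod (g x))"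
    using L2_mult_integrable[OF assms] by (simp add: ennreal_mult[symmetric] nn_integral_eq_integral)
  also have "(\<integral>\<^sup>+x. (ennreal (cmod (f x)))\<^sup>2 \<partial>M) = ennreal ((L2_norm M f)\<^sup>2)"
    using L2_integrable[OF assms(1)] by (simp add: L2_norm_square ennreal_power nn_integral_eq_integral)
  also have "(\<integral>\<^sup>+x. (ennreal (cmod (g x)))\<^sup>2 \<partial>M) = ennreal ((L2_norm M g)\<^sup>2)"
    using L2_integrable[OF assms(2)] by (simp add: L2_norm_square ennreal_power nn_integral_eq_integral)
  finally have "ennreal ((LINT x|M. cmod (f x) * cmod (g x))\<^sup>2) \<le> ennreal ((L2_norm M f * L2_norm M g)\<^sup>2)"
    by (simp add: ennreal_power ennreal_mult[symmetric] power_mult_distrib)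
  then have "(LINT x|M. cmod (f x) * cmod (g x))\<^sup>2 \<le> (L2_norm M f * L2_norm M g)\<^sup>2"
    by simp
  then show ?thesis
    by (rule power2_le_imp_le) simp
qed

lemma L2_inner_bound:
  assumes "f \<in> L2 M" "g \<in> L2 M"
  shows "cmod (L2_inner M f g) \<le> L2_norm M f * L2_norm M g"
proof -
  have "cmod (L2_inner M f g) \<le> (LINT x|M. cmod (f x * cnj (g x)))"
    unfolding L2_inner_def by (rule integral_norm_bound)
  also have "\<dots> = (LINT x|M. cmod (f x) * cmod (g x))"
    by (simp add: norm_mult)
  finally show ?thesis
    using L2_Cauchy_Schwarz[OF assms] by simp
qed

lemma L2_inner_self:
  shows "L2_inner M f f = of_real ((L2_norm M f)\<^sup>2)"
  unfolding L2_inner_def L2_norm_square complex_norm_square[symmetric] integral_complex_of_real[symmetric]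
  by simp

lemma L2_add:
  assumes "f \<in> L2 M" "g \<in> L2 M"
  shows "(\<lambda>x. f x + g x) \<in> L2 M" "L2_norm M (\<lambda>x. f x + g x) \<le> L2_norm M f + L2_norm M g"
proof -
  note [measurable] = L2_measurable[OF assms(1)] L2_measurable[OF assms(2)]
  have le: "(cmod (f x + g x))\<^sup>2 \<le> (cmod (f x))\<^sup>2 + 2 * (cmod (f x) * cmod (g x)) + (cmod (g x))\<^sup>2" for x
  proof -
    have "(cmod (f x + g x))\<^sup>2 \<le> (cmod (f x) + cmod (g x))\<^sup>2"
      by (intro power_mono norm_triangle_ineq) simp
    then show ?thesis
      by (simp add: power2_sum algebra_simps)
  qed
  have int: "integrable M (\<lambda>x. (cmod (f x))\<^sup>2 + 2 * (cmod (f x) * cmod (g x)) + (cmod (g x))\<^sup>2)"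
    using L2_integrable[OF assms(1)] L2_integrable[OF assms(2)] L2_mult_integrable[OF assms] by simp
  have "integrable M (\<lambda>x. (cmod (f x + g x))\<^sup>2)"
    by (rule Bochner_Integration.integrable_bound[OF int])
      (use order_trans[OF le abs_ge_self] in auto)
  then show "(\<lambda>x. f x + g x) \<in> L2 M"
    by (simp add: L2_def)
  have "(LINT x|M. (cmod (f x + g x))\<^sup>2)
      \<le> (LINT x|M. (cmod (f x))\<^sup>2 + 2 * (cmod (f x) * cmod (g x)) + (cmod (g x))\<^sup>2)"
    by (rule integral_mono[OF _ int]) (fact | simp add: le)+
  also have "\<dots> = (L2_norm M f)\<^sup>2 + 2 * (LINT x|M. cmod (f x) * cmod (g x)) + (L2_norm M g)\<^sup>2"
    using L2_integrable[OF assms(1)] L2_integrable[OF assms(2)] L2_mult_integrable[OF assms]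
    by (simp add: L2_norm_square)
  also have "\<dots> \<le> (L2_norm M f + L2_norm M g)\<^sup>2"
    using L2_Cauchy_Schwarz[OF assms] by (simp add: power2_sum)
  finally have "(L2_norm M (\<lambda>x. f x + g x))\<^sup>2 \<le> (L2_norm M f + L2_norm M g)\<^sup>2"
    by (simp add: L2_norm_square)
  then show "L2_norm M (\<lambda>x. f x + g x) \<le> L2_norm M f + L2_norm M g"
    by (rule power2_le_imp_le) simp
qed

lemma L2_scale:
  assumes "f \<in> L2 M"
  shows "(\<lambda>x. c * f x) \<in> L2 M" "L2_norm M (\<lambda>x. c * f x) = cmod c * L2_norm M f"
  using assms by (auto simp: L2_def L2_norm_def norm_mult power_mult_distrib real_sqrt_mult)

lemma L2_divide:
  assumes "f \<in> L2 M"
  shows "(\<lambda>x. f x / c) \<in> L2 M" "L2_norm M (\<lambda>x. f x / c) = L2_norm M f / cmod c"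
  using L2_scale[OF assms, of "inverse c"] by (simp_all add: field_simps norm_divide)

lemma L2_diff:
  assumes "f \<in> L2 M" "g \<in> L2 M"
  shows "(\<lambda>x. f x - g x) \<in> L2 M" "L2_norm M (\<lambda>x. f x - g x) \<le> L2_norm M f + L2_norm M g"
  using L2_add[OF assms(1) L2_scale(1)[OF assms(2), of "-1"]] L2_scale(2)[OF assms(2), of "-1"] by simp_all

lemma L2_sum:
  assumes "\<And>j. j \<in> J \<Longrightarrow> f j \<in> L2 M"
  shows "(\<lambda>x. \<Sum>j\<in>J. f j x) \<in> L2 M" "L2_norm M (\<lambda>x. \<Sum>j\<in>J. f j x) \<le> (\<Sum>j\<in>J. L2_norm M (f j))"
proof -
  have "(\<lambda>x. \<Sum>j\<in>J. f j x) \<in> L2 M \<and> L2_norm M (\<lambda>x. \<Sum>j\<in>J. f j x) \<le> (\<Sum>j\<in>J. L2_norm M (f j))"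
    using assms
  proof (induction J rule: infinite_finite_induct)
    case (insert j J)
    have "f j \<in> L2 M" "(\<lambda>x. \<Sum>j\<in>J. f j x) \<in> L2 M"
      using insert by auto
    from L2_add[OF this] insert show ?case
      by auto
  qed auto
  then show "(\<lambda>x. \<Sum>j\<in>J. f j x) \<in> L2 M" "L2_norm M (\<lambda>x. \<Sum>j\<in>J. f j x) \<le> (\<Sum>j\<in>J. L2_norm M (f j))"
    by auto
qed

lemma L2_cmod:
  assumes "f \<in> L2 M"
  shows "(\<lambda>x. complex_of_real (cmod (f x))) \<in> L2 M"
    "L2_norm M (\<lambda>x. complex_of_real (cmod (f x))) = L2_norm M f"
  using assms by (auto simp: L2_def L2_norm_def)

text \<open>Takes the place of completeness of \<open>L\<^sup>2\<close>.\<close>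

lemma L2_summable_AE:
  fixes u :: "nat \<Rightarrow> 'a \<Rightarrow> complex"
  assumes u: "\<And>n. u n \<in> L2 M" and s: "summable (\<lambda>n. L2_norm M (u n))"
  shows "AE x in M. summable (\<lambda>n. cmod (u n x))"
    and "(\<lambda>x. \<Sum>n. u n x) \<in> L2 M"
    and "L2_norm M (\<lambda>x. \<Sum>n. u n x) \<le> (\<Sum>n. L2_norm M (u n))"
proof -
  note [measurable] = L2_measurable[OF u]
  define c where "c = (\<Sum>n. L2_norm M (u n))"
  have c0: "0 \<le> c"
    unfolding c_def using s by (intro suminf_nonneg) auto
  \<comment> \<open>The partial sums of the moduli increase, so monotone convergence bounds the
    integral of the supremum of their squares by c^2; where this supremum is finite, the series
    converges absolutely.\<close>
  define V where "V N x = (\<Sum>n<N. cmod (u n x))" for N x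
  have [measurable]: "V N \<in> borel_measurable M" for N
    unfolding V_def by measurable
  have V0: "0 \<le> V N x" for N x
    unfolding V_def by (simp add: sum_nonneg)
  have VL2: "(\<lambda>x. complex_of_real (V N x)) \<in> L2 M"
    and Vn: "L2_norm M (\<lambda>x. complex_of_real (V N x)) \<le> c" for N
  proof -
    have *: "(\<lambda>x. complex_of_real (cmod (u n x))) \<in> L2 M" for n
      using L2_cmod(1)[OF u] .
    show "(\<lambda>x. complex_of_real (V N x)) \<in> L2 M"
      using L2_sum(1)[of "{..<N}" "\<lambda>n x. complex_of_real (cmod (u n x))", OF *] by (simp add: V_def)
    have "L2_norm M (\<lambda>x. complex_of_real (V N x)) \<le> (\<Sum>n<N. L2_norm M (u n))"
      using L2_sum(2)[of "{..<N}" "\<lambda>n x. complex_of_real (cmod (u n x))", OF *]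
      by (simp add: V_def L2_cmod[OF u])
    also have "\<dots> \<le> c"
      unfolding c_def using s by (intro sum_le_suminf) auto
    finally show "L2_norm M (\<lambda>x. complex_of_real (V N x)) \<le> c" .
  qed
  have nnV: "(\<integral>\<^sup>+x. ennreal ((V N x)\<^sup>2) \<partial>M) \<le> ennreal (c\<^sup>2)" for N
  proof -
    have "(\<integral>\<^sup>+x. ennreal ((V N x)\<^sup>2) \<partial>M) = ennreal ((L2_norm M (\<lambda>x. complex_of_real (V N x)))\<^sup>2)"
      unfolding L2_norm_square using L2_integrable[OF VL2[of N]] by (subst nn_integral_eq_integral) auto
    also have "\<dots> \<le> ennreal (c\<^sup>2)"
      using Vn[of N] by (intro ennreal_leI power_mono) auto
    finally show ?thesis .
  qed
  have incV: "V N x \<le> V N' x" if "N \<le> N'" for N N' x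
    unfolding V_def using that by (intro sum_mono2) auto
  have sup: "(\<integral>\<^sup>+x. (SUP N. ennreal ((V N x)\<^sup>2)) \<partial>M) = (SUP N. \<integral>\<^sup>+x. ennreal ((V N x)\<^sup>2) \<partial>M)"
    by (intro nn_integral_monotone_convergence_SUP)
      (auto simp: incseq_def le_fun_def intro!: ennreal_leI power_mono incV V0)
  also have "\<dots> \<le> ennreal (c\<^sup>2)"
    by (intro SUP_least nnV)
  finally have supc: "(\<integral>\<^sup>+x. (SUP N. ennreal ((V N x)\<^sup>2)) \<partial>M) \<le> ennreal (c\<^sup>2)" .
  then have "(\<integral>\<^sup>+x. (SUP N. ennreal ((V N x)\<^sup>2)) \<partial>M) \<noteq> \<infinity>"
    by (auto simp: top_unique)
  then have fin: "AE x in M. (SUP N. ennreal ((V N x)\<^sup>2)) \<noteq> \<infinity>"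
    by (intro nn_integral_PInf_AE) auto
  have sumx: "summable (\<lambda>n. cmod (u n x))" if "(SUP N. ennreal ((V N x)\<^sup>2)) \<noteq> \<infinity>" for x
  proof -
    define S where "S = (SUP N. ennreal ((V N x)\<^sup>2))"
    have "S \<noteq> top"
      using that by (simp only: S_def infinity_ennreal_def not_False_eq_True)
    then obtain r where r: "0 \<le> r" "S = ennreal r"
      by (cases S) auto
    have "ennreal ((V N x)\<^sup>2) \<le> ennreal r" for N
      unfolding r(2)[symmetric] S_def by (rule SUP_upper) simp
    then have "(V N x)\<^sup>2 \<le> r" for N
      using r(1) by simp
    then have "V N x \<le> sqrt r" for N
      by (rule real_le_rsqrt)
    then have "(\<Sum>n\<le>N. cmod (u n x)) \<le> sqrt r" for N
      unfolding V_def lessThan_Suc_atMost[symmetric] .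
    then show ?thesis
      by (intro bounded_imp_summable[where B = "sqrt r"]) auto
  qed
  show ae: "AE x in M. summable (\<lambda>n. cmod (u n x))"
    using fin by eventually_elim (rule sumx)
  \<comment> \<open>The same supremum majorises the squared modulus of the sum, which gives
    membership in L2 and the norm bound together.\<close>
  have le: "ennreal ((cmod (\<Sum>n. u n x))\<^sup>2) \<le> (SUP N. ennreal ((V N x)\<^sup>2))"
    if sm: "summable (\<lambda>n. cmod (u n x))" for x
  proof -
    have "(\<lambda>N. V N x) \<longlonglongrightarrow> (\<Sum>n. cmod (u n x))"
      unfolding V_def by (rule summable_LIMSEQ[OF sm])
    then have "(\<lambda>N. ennreal ((V N x)\<^sup>2)) \<longlonglongrightarrow> ennreal ((\<Sum>n. cmod (u n x))\<^sup>2)"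
      by (intro tendsto_intros)
    then have "ennreal ((\<Sum>n. cmod (u n x))\<^sup>2) \<le> (SUP N. ennreal ((V N x)\<^sup>2))"
      by (rule LIMSEQ_le_const2) (auto intro!: SUP_upper)
    moreover have "ennreal ((cmod (\<Sum>n. u n x))\<^sup>2) \<le> ennreal ((\<Sum>n. cmod (u n x))\<^sup>2)"
      by (intro ennreal_leI power_mono summable_norm sm) simp
    ultimately show ?thesis
      by (rule order_trans[rotated])
  qed
  have meas: "(\<lambda>x. \<Sum>n. u n x) \<in> borel_measurable M"
    by measurable
  have nn: "(\<integral>\<^sup>+x. ennreal ((cmod (\<Sum>n. u n x))\<^sup>2) \<partial>M) \<le> ennreal (c\<^sup>2)"
  proof -
    have "(\<integral>\<^sup>+x. ennreal ((cmod (\<Sum>n. u n x))\<^sup>2) \<partial>M) \<le> (\<integral>\<^sup>+x. (SUP N. ennreal ((V N x)\<^sup>2)) \<partial>M)"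
      by (intro nn_integral_mono_AE eventually_mono[OF ae] le)
    then show ?thesis
      using supc by simp
  qed
  have int: "integrable M (\<lambda>x. (cmod (\<Sum>n. u n x))\<^sup>2)"
  proof (rule integrableI_bounded)
    show "(\<lambda>x. (cmod (\<Sum>n. u n x))\<^sup>2) \<in> borel_measurable M"
      using meas by measurable
    show "(\<integral>\<^sup>+x. ennreal (norm ((cmod (\<Sum>n. u n x))\<^sup>2)) \<partial>M) < \<infinity>"
      using le_less_trans[OF nn] by simp
  qed
  with meas show "(\<lambda>x. \<Sum>n. u n x) \<in> L2 M"
    by (simp add: L2_def)
  have "ennreal (LINT x|M. (cmod (\<Sum>n. u n x))\<^sup>2) \<le> ennreal (c\<^sup>2)"
    using nn int by (subst (asm) nn_integral_eq_integral) auto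
  then have "(L2_norm M (\<lambda>x. \<Sum>n. u n x))\<^sup>2 \<le> c\<^sup>2"
    by (simp add: L2_norm_square)
  then have "L2_norm M (\<lambda>x. \<Sum>n. u n x) \<le> c"
    using c0 by (rule power2_le_imp_le)
  then show "L2_norm M (\<lambda>x. \<Sum>n. u n x) \<le> (\<Sum>n. L2_norm M (u n))"
    by (simp add: c_def)
qed

subsection \<open>Bounded operators and their spectra\<close>

text \<open>Fekete's lemma in multiplicative form: the limit is the infimum of the roots, hence the
  lower bound, while splitting n into blocks of one good length p gives the growth bound. Logarithms
  are avoided because \<open>s\<close> may vanish.\<close>

lemma submultiplicative_root_limit:
  fixes s :: "nat \<Rightarrow> real"
  assumes nonneg: "\<And>n. 0 \<le> s n" and sub: "\<And>m n. s (m + n) \<le> s m * s n"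
  obtains L where "(\<lambda>n. s n powr (1 / real n)) \<longlonglongrightarrow> L" "0 \<le> L" "\<And>n. 1 \<le> n \<Longrightarrow> L ^ n \<le> s n"
    "\<And>\<mu>. L < \<mu> \<Longrightarrow> \<exists>K. \<forall>n. s n \<le> K * \<mu> ^ n"
proof -
  \<comment> \<open>Index 0 is left out because \<open>1 / real 0 = 0\<close> makes the root there
    meaningless.\<close>
  define X where "X = (\<lambda>n. s n powr (1 / real n)) ` {1..}"
  define L where "L = Inf X"
  have ne: "X \<noteq> {}" and bdd: "bdd_below X"
    unfolding X_def by (auto intro!: bdd_belowI[of _ 0])
  have L0: "0 \<le> L"
    unfolding L_def using ne by (intro cInf_greatest) (auto simp: X_def)
  have lower: "L \<le> s n powr (1 / real n)" if "1 \<le> n" for n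
    unfolding L_def using bdd that by (intro cInf_lower) (auto simp: X_def)
  have powL: "L ^ n \<le> s n" if "1 \<le> n" for n
  proof -
    have "L ^ n \<le> (s n powr (1 / real n)) ^ n"
      by (intro power_mono lower that L0)
    also have "\<dots> = s n"
      using that nonneg[of n] by (cases "s n = 0") (auto simp: powr_realpow[symmetric] powr_powr)
    finally show ?thesis .
  qed
  have growth: "\<exists>K>0. \<forall>n. s n \<le> K * \<mu> ^ n" if "L < \<mu>" for \<mu>
  proof -
    have \<mu>: "L < \<mu>" "0 < \<mu>"
      using that L0 by auto
    obtain p where p: "1 \<le> p" "s p powr (1 / real p) < \<mu>"
      using cInf_lessD[OF ne \<mu>(1)[unfolded L_def]] by (auto simp: X_def)
    have sp: "s p \<le> \<mu> ^ p"
    proof -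
      have "s p = (s p powr (1 / real p)) ^ p"
        using p nonneg[of p] by (cases "s p = 0") (auto simp: powr_realpow[symmetric] powr_powr)
      also have "\<dots> \<le> \<mu> ^ p"
        using p by (intro power_mono) auto
      finally show ?thesis .
    qed
    \<comment> \<open>\<open>K\<close> absorbs the remainder of n modulo p; adding 1 keeps it
      positive, so that its n-th roots tend to 1 even if \<open>s\<close> vanishes on all
      remainders.\<close>
    define K where "K = Max ((\<lambda>r. s r / \<mu> ^ r) ` {..<p}) + 1"
    have Kr: "s r \<le> K * \<mu> ^ r" if "r < p" for r
    proof -
      have "s r / \<mu> ^ r \<le> Max ((\<lambda>r. s r / \<mu> ^ r) ` {..<p})"
        using that by (intro Max_ge) auto
      then have "s r / \<mu> ^ r \<le> K"
        by (simp add: K_def)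
      then show ?thesis
        using \<mu>(2) by (simp add: divide_le_eq)
    qed
    have K0: "0 < K"
    proof -
      have "s 0 / \<mu> ^ 0 \<le> Max ((\<lambda>r. s r / \<mu> ^ r) ` {..<p})"
        using p by (intro Max_ge) (auto intro!: image_eqI[of _ _ 0])
      then show ?thesis
        using nonneg[of 0] by (simp add: K_def)
    qed
    have block: "s (q * p + r) \<le> (\<mu> ^ p) ^ q * s r" for q r
    proof (induction q)
      case (Suc q)
      have "s (Suc q * p + r) \<le> s p * s (q * p + r)"
        using sub[of p "q * p + r"] by (simp add: add_ac)
      also have "\<dots> \<le> \<mu> ^ p * ((\<mu> ^ p) ^ q * s r)"
        using Suc sp \<mu>(2) nonneg by (intro mult_mono) auto
      finally show ?case
        by (simp add: mult_ac)
    qed simp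
    have sn: "s n \<le> K * \<mu> ^ n" for n
    proof -
      have "s n = s (n div p * p + n mod p)"
        by simp
      also have "\<dots> \<le> (\<mu> ^ p) ^ (n div p) * s (n mod p)"
        by (rule block)
      also have "\<dots> \<le> (\<mu> ^ p) ^ (n div p) * (K * \<mu> ^ (n mod p))"
        using p \<mu>(2) by (intro mult_left_mono Kr) auto
      also have "\<dots> = K * \<mu> ^ (p * (n div p) + n mod p)"
        by (simp only: power_add power_mult mult_ac)
      finally show ?thesis
        by (simp only: mult_div_mod_eq)
    qed
    with K0 show ?thesis
      by blast
  qed
  have upper: "\<forall>\<^sub>F n in sequentially. s n powr (1 / real n) < a" if "L < a" for a
  proof -
    \<comment> \<open>A rate strictly between the limit and \<open>a\<close> leaves room for the
      n-th roots of \<open>K\<close>.\<close>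
    define \<mu> where "\<mu> = (L + a) / 2"
    have \<mu>: "L < \<mu>" "\<mu> < a" "0 < \<mu>"
      using that L0 by (auto simp: \<mu>_def)
    obtain K where K0: "0 < K" and sn: "\<And>n. s n \<le> K * \<mu> ^ n"
      using growth[OF \<mu>(1)] by blast
    have "(\<lambda>n. K powr (1 / real n) * \<mu>) \<longlonglongrightarrow> K powr 0 * \<mu>"
      using K0 by (intro tendsto_intros lim_1_over_n) auto
    then have "\<forall>\<^sub>F n in sequentially. K powr (1 / real n) * \<mu> < a"
      using K0 \<mu>(2) by (intro order_tendstoD(2)[where y = "K powr 0 * \<mu>"]) auto
    then show ?thesis
      using eventually_ge_at_top[of 1]
    proof eventually_elim
      case (elim n)
      have "s n powr (1 / real n) \<le> (K * \<mu> ^ n) powr (1 / real n)"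
        using sn nonneg by (intro powr_mono2) auto
      also have "\<dots> = K powr (1 / real n) * \<mu>"
        using K0 \<mu>(3) elim by (simp add: powr_mult powr_realpow[symmetric] powr_powr)
      finally show ?case
        using elim by simp
    qed
  qed
  have "(\<lambda>n. s n powr (1 / real n)) \<longlonglongrightarrow> L"
  proof (rule order_tendstoI)
    fix a assume "a < L"
    show "\<forall>\<^sub>F n in sequentially. a < s n powr (1 / real n)"
      using eventually_ge_at_top[of 1] by eventually_elim (use lower \<open>a < L\<close> in force)
  qed (rule upper)
  then show ?thesis
    using L0 powL growth by (intro that) blast+
qed

section \<open>Linear and bounded operators modulo null sets\<close>

context
  fixes M :: "'a measure" and A :: "'a oper"
  assumes lin: "linear_operator M A"
begin

lemma linear_operator_L2: "f \<in> L2 M \<Longrightarrow> A f \<in> L2 M"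
  using lin by (simp add: linear_operator_def)

lemma linear_operator_cong:
  "f \<in> L2 M \<Longrightarrow> g \<in> L2 M \<Longrightarrow> AE x in M. f x = g x \<Longrightarrow> AE x in M. A f x = A g x"
  using lin unfolding linear_operator_def by blast

lemma linear_operator_add:
  "f \<in> L2 M \<Longrightarrow> g \<in> L2 M \<Longrightarrow> AE x in M. A (\<lambda>y. f y + g y) x = A f x + A g x"
  using lin unfolding linear_operator_def by blast

lemma linear_operator_scale:
  "f \<in> L2 M \<Longrightarrow> AE x in M. A (\<lambda>y. c * f y) x = c * A f x"
  using lin unfolding linear_operator_def by blast

lemma linear_operator_diff:
  assumes "f \<in> L2 M" "g \<in> L2 M"
  shows "AE x in M. A (\<lambda>y. f y - g y) x = A f x - A g x"
  using linear_operator_add[OF assms(1) L2_scale(1)[OF assms(2), of "-1"]]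
    linear_operator_scale[OF assms(2), of "-1"]
  by eventually_elim simp

lemma linear_operator_divide:
  assumes "f \<in> L2 M"
  shows "AE x in M. A (\<lambda>y. f y / c) x = A f x / c"
  using linear_operator_scale[OF assms, of "inverse c"] by (simp add: field_simps)

lemma linear_operator_zero: "AE x in M. A (\<lambda>y. 0) x = 0"
  using linear_operator_scale[of "\<lambda>y. 0" 0] by simp

lemma linear_operator_sum:
  assumes "finite J" "\<And>j. j \<in> J \<Longrightarrow> f j \<in> L2 M"
  shows "AE x in M. A (\<lambda>y. \<Sum>j\<in>J. f j y) x = (\<Sum>j\<in>J. A (f j) x)"
  using assms
proof (induction J rule: finite_induct)
  case empty
  then show ?case
    using linear_operator_zero by simp
next
  case (insert j J)
  have "AE x in M. A (\<lambda>y. f j y + (\<Sum>j\<in>J. f j y)) x = A (f j) x + A (\<lambda>y. \<Sum>j\<in>J. f j y) x"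
    using insert by (intro linear_operator_add L2_sum) auto
  moreover have "AE x in M. A (\<lambda>y. \<Sum>j\<in>J. f j y) x = (\<Sum>j\<in>J. A (f j) x)"
    using insert by auto
  ultimately show ?case
    using insert(1,2) by (auto elim!: eventually_elim2)
qed

end

lemma bounded_operatorD: "bounded_operator M A \<Longrightarrow> linear_operator M A"
  by (simp add: bounded_operator_def)

lemma bounded_operator_bdd_above:
  assumes "bounded_operator M A"
  shows "bdd_above ((\<lambda>f. L2_norm M (A f) / L2_norm M f) ` L2 M)"
proof -
  obtain B where B: "\<And>f. f \<in> L2 M \<Longrightarrow> L2_norm M (A f) \<le> B * L2_norm M f"
    using assms by (auto simp: bounded_operator_def)
  have "L2_norm M (A f) / L2_norm M f \<le> \<bar>B\<bar>" if "f \<in> L2 M" for f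
  proof (cases "L2_norm M f = 0")
    case False
    have "L2_norm M (A f) \<le> \<bar>B\<bar> * L2_norm M f"
      using B[OF that] by (rule order_trans) (intro mult_right_mono, auto)
    moreover have "0 < L2_norm M f"
      using False by (simp add: order_less_le)
    ultimately show ?thesis
      by (simp add: divide_le_eq)
  qed simp
  then show ?thesis
    by (intro bdd_aboveI[of _ "\<bar>B\<bar>"]) auto
qed

lemma op_norm_bound:
  assumes "bounded_operator M A" "f \<in> L2 M"
  shows "L2_norm M (A f) \<le> op_norm M A * L2_norm M f"
proof (cases "L2_norm M f = 0")
  \<comment> \<open>At norm zero the quotient is 0 / 0 = 0, so the supremum says nothing and the
    bound has to come from boundedness itself.\<close>
  case True
  then show ?thesis
    using assms by (auto simp: bounded_operator_def)
next
  case False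
  then have "0 < L2_norm M f"
    by (simp add: order_less_le)
  moreover have "L2_norm M (A f) / L2_norm M f \<le> op_norm M A"
    unfolding op_norm_def by (intro cSUP_upper assms bounded_operator_bdd_above)
  ultimately show ?thesis
    by (simp add: divide_le_eq)
qed

lemma op_norm_nonneg:
  assumes "bounded_operator M A"
  shows "0 \<le> op_norm M A"
  unfolding op_norm_def
  by (rule cSUP_upper2[OF bounded_operator_bdd_above[OF assms], of "\<lambda>_. 0"]) simp_all

lemma op_norm_least:
  assumes "0 \<le> B" "\<And>f. f \<in> L2 M \<Longrightarrow> L2_norm M (A f) \<le> B * L2_norm M f"
  shows "op_norm M A \<le> B"
  unfolding op_norm_def
proof (rule cSUP_least)
  show "L2 M \<noteq> {}"
    using L2_zero(1) by blast
  fix f assume "f \<in> L2 M"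
  then show "L2_norm M (A f) / L2_norm M f \<le> B"
    using assms by (cases "L2_norm M f = 0") (auto simp: divide_le_eq order_less_le)
qed

lemma linear_operator_id [simp]: "linear_operator M id"
  by (auto simp: linear_operator_def)

lemma bounded_operator_id [simp]: "bounded_operator M id"
  unfolding bounded_operator_def by (auto intro: exI[of _ 1])

lemma linear_operator_comp:
  assumes A: "linear_operator M A" and B: "linear_operator M B"
  shows "linear_operator M (A \<circ> B)"
  unfolding linear_operator_def o_def
proof (intro conjI ballI allI impI)
  note L = linear_operator_L2[OF B]
  fix f assume f: "f \<in> L2 M"
  show "A (B f) \<in> L2 M"
    using linear_operator_L2[OF A] L f by simp
  show "AE x in M. A (B (\<lambda>y. c * f y)) x = c * A (B f) x" for c
    using linear_operator_cong[OF A L[OF L2_scale(1)[OF f]] L2_scale(1)[OF L[OF f]]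
        linear_operator_scale[OF B f], of c] linear_operator_scale[OF A L[OF f], of c]
    by eventually_elim simp
  fix g assume g: "g \<in> L2 M"
  show "AE x in M. A (B f) x = A (B g) x" if "AE x in M. f x = g x"
    using linear_operator_cong[OF A] linear_operator_cong[OF B f g that] L f g by blast
  show "AE x in M. A (B (\<lambda>y. f y + g y)) x = A (B f) x + A (B g) x"
    using linear_operator_cong[OF A L[OF L2_add(1)[OF f g]] L2_add(1)[OF L[OF f] L[OF g]]
        linear_operator_add[OF B f g]] linear_operator_add[OF A L[OF f] L[OF g]]
    by eventually_elim simp
qed

lemma bounded_operatorI:
  assumes "linear_operator M A" "\<And>f. f \<in> L2 M \<Longrightarrow> L2_norm M (A f) \<le> B * L2_norm M f"
  shows "bounded_operator M A"
  using assms by (auto simp: bounded_operator_def)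

lemma bounded_operator_comp:
  assumes A: "bounded_operator M A" and B: "bounded_operator M B"
  shows "bounded_operator M (A \<circ> B)" "op_norm M (A \<circ> B) \<le> op_norm M A * op_norm M B"
proof -
  have *: "L2_norm M ((A \<circ> B) f) \<le> (op_norm M A * op_norm M B) * L2_norm M f" if "f \<in> L2 M" for f
  proof -
    have "L2_norm M (A (B f)) \<le> op_norm M A * L2_norm M (B f)"
      using that by (intro op_norm_bound A linear_operator_L2[OF bounded_operatorD[OF B]])
    also have "\<dots> \<le> op_norm M A * (op_norm M B * L2_norm M f)"
      using that by (intro mult_left_mono op_norm_bound B op_norm_nonneg A)
    finally show ?thesis
      by simp
  qed
  show "bounded_operator M (A \<circ> B)"
    using linear_operator_comp[OF bounded_operatorD[OF A] bounded_operatorD[OF B]] *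
    by (rule bounded_operatorI)
  show "op_norm M (A \<circ> B) \<le> op_norm M A * op_norm M B"
    using * by (intro op_norm_least mult_nonneg_nonneg op_norm_nonneg A B)
qed

lemma bounded_operator_funpow:
  "bounded_operator M A \<Longrightarrow> bounded_operator M (A ^^ n)"
  by (induction n) (auto intro: bounded_operator_comp)

lemma op_norm_funpow_add:
  assumes "bounded_operator M A"
  shows "op_norm M (A ^^ (m + n)) \<le> op_norm M (A ^^ m) * op_norm M (A ^^ n)"
  unfolding funpow_add by (intro bounded_operator_comp bounded_operator_funpow assms)

text \<open>Norm continuity in a form usable in termwise arguments: the difference of the two sides
  is controlled by the tails of a convergent series of norms.\<close>

lemma bounded_operator_suminf:
  fixes u :: "nat \<Rightarrow> 'a \<Rightarrow> complex"
  assumes A: "bounded_operator M A"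
    and u: "\<And>n. u n \<in> L2 M" and s: "summable (\<lambda>n. L2_norm M (u n))"
  shows "AE x in M. A (\<lambda>x. \<Sum>n. u n x) x = (\<Sum>n. A (u n) x)"
proof -
  note lin = bounded_operatorD[OF A]
  have Au: "A (u n) \<in> L2 M" for n
    by (rule linear_operator_L2[OF lin u])
  have sA: "summable (\<lambda>n. L2_norm M (A (u n)))"
    using op_norm_bound[OF A u] by (intro summable_comparison_test'[OF summable_mult[OF s]]) auto
  define U where "U = (\<lambda>x. \<Sum>n. u n x)"
  define T where "T N = (\<lambda>x. \<Sum>n. u (n + N) x)" for N
  define V where "V = (\<lambda>x. \<Sum>n. A (u n) x)"
  define W where "W N = (\<lambda>x. \<Sum>n. A (u (n + N)) x)" for N
  define t where "t N = (\<Sum>n. L2_norm M (u (n + N)))" for N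
  have sN: "summable (\<lambda>n. L2_norm M (u (n + N)))" "summable (\<lambda>n. L2_norm M (A (u (n + N))))" for N
    using s sA by (auto intro: summable_ignore_initial_segment)
  have UL: "U \<in> L2 M" "V \<in> L2 M" "T N \<in> L2 M" "W N \<in> L2 M" for N
    unfolding U_def T_def V_def W_def using u Au s sA sN by (intro L2_summable_AE; simp)+
  have nT: "L2_norm M (T N) \<le> t N" for N
    unfolding t_def T_def using u sN by (intro L2_summable_AE) auto
  have nW: "L2_norm M (W N) \<le> op_norm M A * t N" for N
  proof -
    have "L2_norm M (W N) \<le> (\<Sum>n. L2_norm M (A (u (n + N))))"
      unfolding W_def using Au sN by (intro L2_summable_AE) auto
    also have "\<dots> \<le> (\<Sum>n. op_norm M A * L2_norm M (u (n + N)))"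
      using sN summable_mult[OF sN(1)] op_norm_bound[OF A u] by (intro suminf_le) auto
    also have "\<dots> = op_norm M A * t N"
      unfolding t_def using sN by (simp add: suminf_mult)
    finally show ?thesis .
  qed
  have bound: "L2_norm M (\<lambda>x. A U x - V x) \<le> 2 * op_norm M A * t N" for N
  proof -
    define P where "P = (\<lambda>x. \<Sum>n<N. u n x)"
    have P: "P \<in> L2 M"
      unfolding P_def using u by (intro L2_sum)
    have "AE x in M. U x = P x + T N x"
      using L2_summable_AE(1)[OF u s]
    proof eventually_elim
      case (elim x)
      then show ?case
        unfolding U_def P_def T_def
        using suminf_split_initial_segment[OF summable_norm_cancel[OF elim], of N] by simp
    qed
    then have 1: "AE x in M. A U x = A (\<lambda>x. P x + T N x) x"
      using UL P by (intro linear_operator_cong[OF lin] L2_add)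
    have 2: "AE x in M. A (\<lambda>x. P x + T N x) x = A P x + A (T N) x"
      using UL P by (intro linear_operator_add[OF lin])
    have 3: "AE x in M. A P x = (\<Sum>n<N. A (u n) x)"
      unfolding P_def using u by (intro linear_operator_sum[OF lin]) auto
    have 4: "AE x in M. V x = (\<Sum>n<N. A (u n) x) + W N x"
      using L2_summable_AE(1)[OF Au sA]
    proof eventually_elim
      case (elim x)
      then show ?case
        unfolding V_def W_def
        using suminf_split_initial_segment[OF summable_norm_cancel[OF elim], of N] by simp
    qed
    \<comment> \<open>The first N terms cancel by finite additivity, so only the tails
      remain.\<close>
    have "AE x in M. A U x - V x = A (T N) x - W N x"
      using 1 2 3 4 by eventually_elim simp
    then have "L2_norm M (\<lambda>x. A U x - V x) = L2_norm M (\<lambda>x. A (T N) x - W N x)"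
      by (intro L2_norm_cong_AE(2)[OF L2_diff(1) L2_measurable[OF L2_diff(1)]] linear_operator_L2[OF lin] UL)
    also have "\<dots> \<le> L2_norm M (A (T N)) + L2_norm M (W N)"
      using UL linear_operator_L2[OF lin] by (intro L2_diff) auto
    also have "\<dots> \<le> op_norm M A * t N + op_norm M A * t N"
      using op_norm_bound[OF A UL(3)[of N]] mult_left_mono[OF nT[of N] op_norm_nonneg[OF A]] nW[of N]
      by linarith
    finally show ?thesis
      by (simp add: mult_ac)
  qed
  have "t \<longlonglongrightarrow> 0"
    unfolding t_def by (rule suminf_exist_split2[OF s])
  then have "(\<lambda>N. 2 * op_norm M A * t N) \<longlonglongrightarrow> 2 * op_norm M A * 0"
    by (intro tendsto_intros)
  then have "L2_norm M (\<lambda>x. A U x - V x) \<le> 2 * op_norm M A * 0"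
    by (rule LIMSEQ_le_const) (use bound in auto)
  then have "L2_norm M (\<lambda>x. A U x - V x) = 0"
    by (simp add: antisym)
  moreover have "(\<lambda>x. A U x - V x) \<in> L2 M"
    using UL linear_operator_L2[OF lin] by (intro L2_diff) auto
  ultimately have "AE x in M. A U x - V x = 0"
    by (simp add: L2_norm_zero_iff)
  then show ?thesis
    unfolding U_def V_def by eventually_elim simp
qed

text \<open>Beyond the growth rate the Neumann series inverts z - A. It is summed pointwise, so its
  linearity and its compatibility with null sets are collected from the countably many
  terms.\<close>

lemma op_spectrum_bound:
  assumes A: "bounded_operator M A" and \<mu>: "0 \<le> \<mu>" and growth: "\<And>n. op_norm M (A ^^ n) \<le> K * \<mu> ^ n"
    and z: "z \<in> op_spectrum M A"
  shows "cmod z \<le> \<mu>"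
proof (rule ccontr)
  assume "\<not> cmod z \<le> \<mu>"
  then have zm: "\<mu> < cmod z" "z \<noteq> 0"
    using \<mu> by auto
  note lin = bounded_operatorD[OF A]
  define q where "q = \<mu> / cmod z"
  have q: "0 \<le> q" "q < 1"
    using zm \<mu> by (auto simp: q_def divide_less_eq)
  define u where "u f n x = (A ^^ n) f x / z ^ Suc n" for f n x
  define S where "S f x = (\<Sum>n. u f n x)" for f x
  note Bn = bounded_operator_funpow[OF A]
  note Ln = bounded_operatorD[OF Bn]
  have uL: "u f n \<in> L2 M" if "f \<in> L2 M" for f n
    unfolding u_def[abs_def] by (intro L2_divide linear_operator_L2[OF Ln] that)
  have un: "L2_norm M (u f n) \<le> (K / cmod z * L2_norm M f) * q ^ n" if "f \<in> L2 M" for f n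
  proof -
    have "L2_norm M (u f n) = L2_norm M ((A ^^ n) f) / cmod z ^ Suc n"
      unfolding u_def[abs_def] using that
      by (subst L2_divide) (auto simp: norm_power norm_mult intro!: linear_operator_L2[OF Ln])
    also have "\<dots> \<le> ((K * \<mu> ^ n) * L2_norm M f) / cmod z ^ Suc n"
      using order_trans[OF op_norm_bound[OF Bn that, of n] mult_right_mono[OF growth[of n] L2_norm_nonneg]]
      by (intro divide_right_mono) auto
    finally show ?thesis
      by (simp add: q_def power_divide mult_ac)
  qed
  have geo: "summable (\<lambda>n. (K / cmod z * L2_norm M f) * q ^ n)" for f
    using q by (intro summable_mult summable_geometric) auto
  have us: "summable (\<lambda>n. L2_norm M (u f n))" if "f \<in> L2 M" for f
    using un[OF that] by (intro summable_comparison_test'[OF geo[of f]]) auto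
  have SL: "S f \<in> L2 M" if "f \<in> L2 M" for f
    unfolding S_def[abs_def] using uL us that by (intro L2_summable_AE) auto
  have usx: "AE x in M. summable (\<lambda>n. u f n x)" if "f \<in> L2 M" for f
    using L2_summable_AE(1)[OF uL us, OF that that] by eventually_elim (rule summable_norm_cancel)
  have Sn: "L2_norm M (S f) \<le> (K / cmod z * (\<Sum>n. q ^ n)) * L2_norm M f" if "f \<in> L2 M" for f
  proof -
    have "L2_norm M (S f) \<le> (\<Sum>n. L2_norm M (u f n))"
      unfolding S_def[abs_def] using uL us that by (intro L2_summable_AE) auto
    also have "\<dots> \<le> (\<Sum>n. (K / cmod z * L2_norm M f) * q ^ n)"
      using un us geo that by (intro suminf_le) auto
    also have "\<dots> = (K / cmod z * L2_norm M f) * (\<Sum>n. q ^ n)"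
      using q by (intro suminf_mult summable_geometric) auto
    finally show ?thesis
      by (simp add: mult_ac)
  qed
  have linS: "linear_operator M S"
    unfolding linear_operator_def
  proof (intro conjI ballI allI impI SL)
    fix f assume f: "f \<in> L2 M"
    fix c
    have "AE x in M. \<forall>n. (A ^^ n) (\<lambda>y. c * f y) x = c * (A ^^ n) f x"
      using linear_operator_scale[OF Ln f] by (simp add: AE_all_countable)
    then show "AE x in M. S (\<lambda>y. c * f y) x = c * S f x"
      using usx[OF f]
    proof eventually_elim
      case (elim x)
      have "u (\<lambda>y. c * f y) n x = c * u f n x" for n
        unfolding u_def by (simp only: spec[OF elim(1)] times_divide_eq_right)
      then show ?case
        unfolding S_def using elim(2) by (simp add: suminf_mult)
    qed
  next
    fix f g assume f: "f \<in> L2 M" and g: "g \<in> L2 M"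
    show "AE x in M. S f x = S g x" if "AE x in M. f x = g x"
    proof -
      have "AE x in M. \<forall>n. (A ^^ n) f x = (A ^^ n) g x"
        using linear_operator_cong[OF Ln f g that] by (simp add: AE_all_countable)
      then show ?thesis
        by eventually_elim (simp add: S_def u_def)
    qed
    have "AE x in M. \<forall>n. (A ^^ n) (\<lambda>y. f y + g y) x = (A ^^ n) f x + (A ^^ n) g x"
      using linear_operator_add[OF Ln f g] by (simp add: AE_all_countable)
    with usx[OF f] usx[OF g] show "AE x in M. S (\<lambda>y. f y + g y) x = S f x + S g x"
    proof eventually_elim
      case (elim x)
      then show ?case
        unfolding S_def by (subst suminf_add) (auto simp: u_def add_divide_distrib)
    qed
  qed
  have bS: "bounded_operator M S"
    using linS Sn by (rule bounded_operatorI)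
  \<comment> \<open>Applying \<open>S\<close> to \<open>A f\<close> shifts the series by one index,
    which drops the term f / z.\<close>
  have SA: "AE x in M. S (A f) x = z * S f x - f x" if f: "f \<in> L2 M" for f
    using usx[OF f]
  proof eventually_elim
    case (elim x)
    have "(\<Sum>n. u f (Suc n) x) = S f x - u f 0 x"
      unfolding S_def using elim by (rule suminf_split_head)
    moreover have "u (A f) n x = z * u f (Suc n) x" for n
      using zm by (simp add: u_def funpow_swap1)
    moreover have "summable (\<lambda>n. u f (Suc n) x)"
      by (rule iffD2[OF summable_Suc_iff[of "\<lambda>n. u f n x"] elim])
    ultimately have "S (A f) x = z * (S f x - u f 0 x)"
      by (simp only: S_def suminf_mult)
    then show ?case
      using zm by (simp add: u_def algebra_simps)
  qed
  have AS: "AE x in M. A (S f) x = S (A f) x" if f: "f \<in> L2 M" for f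
  proof -
    have "AE x in M. A (S f) x = (\<Sum>n. A (u f n) x)"
      unfolding S_def[abs_def] using bounded_operator_suminf[OF A uL us, OF f f] .
    moreover have "AE x in M. \<forall>n. A (u f n) x = u (A f) n x"
      unfolding AE_all_countable
    proof
      fix n
      have "AE x in M. A (u f n) x = A ((A ^^ n) f) x / z ^ Suc n"
        unfolding u_def[abs_def] by (intro linear_operator_divide[OF lin] linear_operator_L2[OF Ln] f)
      then show "AE x in M. A (u f n) x = u (A f) n x"
        by eventually_elim (simp add: u_def funpow_swap1)
    qed
    ultimately show ?thesis
      by eventually_elim (simp add: S_def)
  qed
  have "AE x in M. S (\<lambda>y. z * f y - A f y) x = f x" "AE x in M. z * S f x - A (S f) x = f x"
    if f: "f \<in> L2 M" for f
  proof -
    have Af: "A f \<in> L2 M"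
      by (rule linear_operator_L2[OF lin f])
    show "AE x in M. S (\<lambda>y. z * f y - A f y) x = f x"
      using linear_operator_diff[OF linS L2_scale(1)[OF f] Af, of z] linear_operator_scale[OF linS f, of z] SA[OF f]
      by eventually_elim simp
    show "AE x in M. z * S f x - A (S f) x = f x"
      using AS[OF f] SA[OF f] by eventually_elim simp
  qed
  with bS z show False
    unfolding op_spectrum_def by blast
qed

subsection \<open>Positive operators and domination\<close>

text \<open>The order on complex numbers means equal imaginary parts and ordered real parts, so
  positivity and domination of complex functions become pointwise inequalities.\<close>

lemma nonneg_Reals_complex_iff: "z \<in> \<real>\<^sub>\<ge>\<^sub>0 \<longleftrightarrow> 0 \<le> (z :: complex)"
  by (auto simp: complex_nonneg_Reals_iff less_eq_complex_def)

lemma complex_nonneg_norm_mono: "0 \<le> x \<Longrightarrow> x \<le> y \<Longrightarrow> cmod x \<le> cmod (y :: complex)"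
  by (auto simp: less_eq_complex_def cmod_eq_Re)

lemma complex_divide_of_real_mono:
  "x \<le> y \<Longrightarrow> 0 \<le> r \<Longrightarrow> x / complex_of_real r \<le> y / complex_of_real r"
  by (auto simp: less_eq_complex_def divide_right_mono)

lemma complex_divide_power_nonneg:
  assumes "0 \<le> x" "0 \<le> r"
  shows "0 \<le> x / complex_of_real r ^ k"
  using complex_divide_of_real_mono[OF assms(1), of "r ^ k"] assms(2) by simp

lemma positive_operator_linear: "positive_operator M A \<Longrightarrow> linear_operator M A"
  by (simp add: positive_operator_def)

lemma positive_operator_nonneg:
  "positive_operator M A \<Longrightarrow> f \<in> L2 M \<Longrightarrow> AE x in M. 0 \<le> f x \<Longrightarrow> AE x in M. 0 \<le> A f x"
  by (auto simp: positive_operator_def nonneg_Reals_complex_iff)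

lemma positive_operator_mono:
  assumes "positive_operator M A" "f \<in> L2 M" "g \<in> L2 M" "AE x in M. f x \<le> g x"
  shows "AE x in M. A f x \<le> A g x"
proof -
  have "AE x in M. 0 \<le> A (\<lambda>x. g x - f x) x"
    by (rule positive_operator_nonneg[OF assms(1) L2_diff(1)[OF assms(3,2)]]) (use assms(4) in auto)
  then show ?thesis
    using linear_operator_diff[OF positive_operator_linear[OF assms(1)] assms(3,2)]
    by eventually_elim simp
qed

lemma positive_operator_id: "positive_operator M id"
  by (simp add: positive_operator_def)

lemma positive_operator_comp:
  assumes "positive_operator M A" "positive_operator M B"
  shows "positive_operator M (A \<circ> B)"
  using assms linear_operator_comp[of M A B] linear_operator_L2[of M B]
  by (auto simp: positive_operator_def)

lemma positive_operator_funpow: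
  "positive_operator M A \<Longrightarrow> positive_operator M (A ^^ n)"
  by (induction n) (auto intro: positive_operator_comp positive_operator_id)

text \<open>The constant 4, one for each of the positive and negative parts of \<open>Re f\<close> and \<open>Im f\<close>, is not
  sharp but disappears on taking \<open>n\<close>-th roots.\<close>

lemma positive_operator_norm_le:
  assumes A: "positive_operator M A" and f: "f \<in> L2 M"
  shows "AE x in M. cmod (A f x) \<le> 4 * cmod (A (\<lambda>x. complex_of_real (cmod (f x))) x)"
proof -
  note lin = positive_operator_linear[OF A]
  note [measurable] = L2_measurable[OF f]
  define F where "F = (\<lambda>x. complex_of_real (cmod (f x)))"
  \<comment> \<open>For k = 0, ..., 3 the positive and negative parts of \<open>Re f\<close> and
    \<open>Im f\<close>; each lies between 0 and the modulus \<open>F\<close>, so monotonicity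
    bounds its image by \<open>A F\<close>.\<close>
  define p where "p k = (\<lambda>x. complex_of_real (max 0
    (if k = 0 then Re (f x) else if k = 1 then - Re (f x) else if k = 2 then Im (f x) else - Im (f x))))"
    for k :: nat
  have F: "F \<in> L2 M"
    unfolding F_def by (rule L2_cmod[OF f])
  have p0: "0 \<le> p k x" "p k x \<le> F x" for k x
    using abs_Re_le_cmod[of "f x"] abs_Im_le_cmod[of "f x"]
    by (auto simp: p_def F_def less_eq_complex_def)
  have pL: "p k \<in> L2 M" for k
  proof (rule L2_bound(1)[OF f])
    show "p k \<in> borel_measurable M"
      unfolding p_def by measurable
    show "AE x in M. cmod (p k x) \<le> cmod (f x)"
      using complex_nonneg_norm_mono[OF p0] by (simp add: F_def)
  qed
  have Ap: "AE x in M. cmod (A (p k) x) \<le> cmod (A F x)" for k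
  proof -
    have "AE x in M. 0 \<le> A (p k) x" "AE x in M. A (p k) x \<le> A F x"
      using p0 by (auto intro!: positive_operator_nonneg[OF A] positive_operator_mono[OF A] pL F)
    then show ?thesis
      by eventually_elim (rule complex_nonneg_norm_mono)
  qed
  have dec: "f = (\<lambda>x. (p 0 x - p 1 x) + \<i> * (p 2 x - p 3 x))"
    by (rule ext) (simp add: p_def complex_eq_iff max_def)
  have "AE x in M. A f x = A (\<lambda>x. p 0 x - p 1 x) x + A (\<lambda>x. \<i> * (p 2 x - p 3 x)) x"
    using linear_operator_add[OF lin L2_diff(1)[OF pL[of 0] pL[of 1]] L2_scale(1)[OF L2_diff(1)[OF pL[of 2] pL[of 3]], of "\<i>"]]
    unfolding dec[symmetric] .
  moreover have "AE x in M. A (\<lambda>x. p 0 x - p 1 x) x = A (p 0) x - A (p 1) x"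
    by (intro linear_operator_diff[OF lin] pL)
  moreover have "AE x in M. A (\<lambda>x. \<i> * (p 2 x - p 3 x)) x = \<i> * A (\<lambda>x. p 2 x - p 3 x) x"
    by (intro linear_operator_scale[OF lin] L2_diff(1) pL)
  moreover have "AE x in M. A (\<lambda>x. p 2 x - p 3 x) x = A (p 2) x - A (p 3) x"
    by (intro linear_operator_diff[OF lin] pL)
  ultimately show ?thesis
    using Ap[of 0] Ap[of 1] Ap[of 2] Ap[of 3]
  proof eventually_elim
    case (elim x)
    have "cmod (A f x) \<le> cmod (A (p 0) x - A (p 1) x) + cmod (\<i> * (A (p 2) x - A (p 3) x))"
      unfolding elim(1-4) by (rule norm_triangle_ineq)
    also have "\<dots> \<le> (cmod (A (p 0) x) + cmod (A (p 1) x)) + (cmod (A (p 2) x) + cmod (A (p 3) x))"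
      using norm_triangle_ineq4 by (auto simp: norm_mult intro!: add_mono)
    finally show ?case
      using elim(5-8) by (simp add: F_def)
  qed
qed

lemma op_norm_positive_least:
  assumes A: "positive_operator M A" and B: "0 \<le> B"
    and le: "\<And>f. f \<in> L2 M \<Longrightarrow> AE x in M. 0 \<le> f x \<Longrightarrow> L2_norm M (A f) \<le> B * L2_norm M f"
  shows "op_norm M A \<le> 4 * B"
proof (rule op_norm_least)
  fix f assume f: "f \<in> L2 M"
  let ?F = "\<lambda>x. complex_of_real (cmod (f x))"
  note L = linear_operator_L2[OF positive_operator_linear[OF A]]
  have "L2_norm M (A f) \<le> L2_norm M (\<lambda>x. 4 * A ?F x)"
    using positive_operator_norm_le[OF A f]
    by (intro L2_bound(2) L2_scale(1) L2_measurable L L2_cmod(1) f) (simp add: norm_mult)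
  also have "\<dots> = 4 * L2_norm M (A ?F)"
    by (subst L2_scale(2)) (simp_all add: L L2_cmod f)
  also have "\<dots> \<le> 4 * (B * L2_norm M ?F)"
    using f by (intro mult_left_mono le L2_cmod(1)) (auto simp: less_eq_complex_def)
  finally show "L2_norm M (A f) \<le> 4 * B * L2_norm M f"
    by (simp add: L2_cmod f)
qed (use B in simp)

text \<open>Encoded through values at nonnegative functions rather than through kernels, so that it
  also compares products and powers for which no kernel is recorded.\<close>

definition dominated :: "'a measure \<Rightarrow> 'a oper \<Rightarrow> 'a oper \<Rightarrow> bool" where
  "dominated M A B \<longleftrightarrow> (\<forall>f\<in>L2 M. (AE x in M. 0 \<le> f x) \<longrightarrow> (AE x in M. A f x \<le> B f x))"

lemma dominatedD:
  "dominated M A B \<Longrightarrow> f \<in> L2 M \<Longrightarrow> AE x in M. 0 \<le> f x \<Longrightarrow> AE x in M. A f x \<le> B f x"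
  by (simp add: dominated_def)

lemma dominated_refl [simp]: "dominated M A A"
  by (simp add: dominated_def)

lemma dominated_trans:
  assumes "dominated M A B" "dominated M B C"
  shows "dominated M A C"
  unfolding dominated_def
proof (intro ballI impI)
  fix f assume "f \<in> L2 M" "AE x in M. 0 \<le> f x"
  from dominatedD[OF assms(1) this] dominatedD[OF assms(2) this] show "AE x in M. A f x \<le> C f x"
    by eventually_elim simp
qed

text \<open>Passes through \<open>A \<circ> B'\<close>: monotonicity of \<open>A\<close> replaces
  \<open>B\<close> by \<open>B'\<close>, and positivity of \<open>B'\<close> makes its value an
  admissible argument for comparing \<open>A\<close> with \<open>A'\<close>.\<close>

lemma dominated_comp:
  assumes "positive_operator M A" "positive_operator M B" "positive_operator M B'"
    and "dominated M A A'" "dominated M B B'"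
  shows "dominated M (A \<circ> B) (A' \<circ> B')"
  unfolding dominated_def o_def
proof (intro ballI impI)
  fix f assume f: "f \<in> L2 M" "AE x in M. 0 \<le> f x"
  note L = linear_operator_L2[OF positive_operator_linear]
  have "AE x in M. A (B f) x \<le> A (B' f) x"
    by (rule positive_operator_mono[OF assms(1) L[OF assms(2) f(1)] L[OF assms(3) f(1)] dominatedD[OF assms(5) f]])
  moreover have "AE x in M. A (B' f) x \<le> A' (B' f) x"
    by (rule dominatedD[OF assms(4) L[OF assms(3) f(1)] positive_operator_nonneg[OF assms(3) f]])
  ultimately show "AE x in M. A (B f) x \<le> A' (B' f) x"
    by eventually_elim simp
qed

lemma dominated_funpow:
  assumes "positive_operator M A" "positive_operator M B" "dominated M A B"
  shows "dominated M (A ^^ n) (B ^^ n)"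
  using assms by (induction n) (auto intro: dominated_comp positive_operator_funpow)

lemma dominated_op_norm:
  assumes A: "positive_operator M A" and B: "bounded_operator M B" and d: "dominated M A B"
  shows "op_norm M A \<le> 4 * op_norm M B"
proof (rule op_norm_positive_least[OF A op_norm_nonneg[OF B]])
  fix f assume f: "f \<in> L2 M" "AE x in M. 0 \<le> f x"
  note L = linear_operator_L2[OF positive_operator_linear[OF A]] linear_operator_L2[OF bounded_operatorD[OF B]]
  have "AE x in M. cmod (A f x) \<le> cmod (B f x)"
    using dominatedD[OF d f] positive_operator_nonneg[OF A f]
    by eventually_elim (rule complex_nonneg_norm_mono)
  then have "L2_norm M (A f) \<le> L2_norm M (B f)"
    using f by (intro L2_bound(2) L2_measurable L)
  also have "\<dots> \<le> op_norm M B * L2_norm M f"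
    by (intro op_norm_bound B f)
  finally show "L2_norm M (A f) \<le> op_norm M B * L2_norm M f" .
qed

text \<open>Truncated Neumann series \<open>T N\<close> stand for the resolvents, so that no convergence is needed.\<close>

lemma positive_operator_limit_in_spectrum:
  assumes A: "bounded_operator M A" "positive_operator M A" and L: "0 < L"
    and growth: "\<And>\<mu>. L < \<mu> \<Longrightarrow> \<exists>K. \<forall>n. op_norm M (A ^^ n) \<le> K * \<mu> ^ n"
    and lower: "\<And>n. 1 \<le> n \<Longrightarrow> L ^ n \<le> op_norm M (A ^^ n)"
  shows "complex_of_real L \<in> op_spectrum M A"
proof (rule ccontr)
  assume "complex_of_real L \<notin> op_spectrum M A"
  then obtain S where S: "bounded_operator M S"
    "\<And>f. f \<in> L2 M \<Longrightarrow> AE x in M. S (\<lambda>y. of_real L * f y - A f y) x = f x"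
    unfolding op_spectrum_def by blast
  define s where "s = op_norm M S"
  have s0: "0 \<le> s"
    unfolding s_def by (rule op_norm_nonneg[OF S(1)])
  note lin = bounded_operatorD[OF A(1)]
  note Bn = bounded_operator_funpow[OF A(1)]
  note Pn = positive_operator_funpow[OF A(2)]
  note Ln = bounded_operatorD[OF Bn]
  note LLn = linear_operator_L2[OF Ln]
  \<comment> \<open>The bound extracted from the square of the resolvent: 16 s^2 is the square of
    the norm bound 4 s for \<open>T N\<close>, and the further factor 4 comes from testing on
    nonnegative functions only.\<close>
  have key: "(real n + 1) * op_norm M (A ^^ n) \<le> 64 * s\<^sup>2 * l ^ (n + 2)"
    if l: "L < l" "(l - L) * s \<le> 1 / 2" for l n
  proof -
    have l0: "0 < l"
      using l L by simp
    have nl: "cmod (of_real l) = l"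
      using l0 by simp
    define T where "T N f = (\<lambda>x. \<Sum>k<N. (A ^^ k) f x / of_real l ^ Suc k)" for N f
    have TL: "T N f \<in> L2 M" if "f \<in> L2 M" for N f
      unfolding T_def using that by (intro L2_sum(1) L2_divide(1) LLn)
    \<comment> \<open>Beyond \<open>N0\<close> the remainder A^N f / l^N of the truncated series has
      norm at most that of \<open>f\<close>; a rate strictly between L and l beats the constant
      \<open>K\<close>.\<close>
    obtain N0 where N0: "\<And>N. N0 \<le> N \<Longrightarrow> op_norm M (A ^^ N) \<le> l ^ N"
    proof -
      define \<mu> where "\<mu> = (L + l) / 2"
      have \<mu>: "L < \<mu>" "\<mu> < l" "0 < \<mu>"
        using l L by (auto simp: \<mu>_def)
      obtain K where K: "\<And>n. op_norm M (A ^^ n) \<le> K * \<mu> ^ n"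
        using growth[OF \<mu>(1)] by blast
      have "(\<lambda>n. K * (\<mu> / l) ^ n) \<longlonglongrightarrow> K * 0"
        using \<mu> l0 by (intro tendsto_intros LIMSEQ_power_zero) auto
      then have "\<forall>\<^sub>F n in sequentially. K * (\<mu> / l) ^ n < 1"
        by (intro order_tendstoD(2)) auto
      then obtain N0 where "\<And>n. N0 \<le> n \<Longrightarrow> K * (\<mu> / l) ^ n < 1"
        by (auto simp: eventually_sequentially)
      then have "op_norm M (A ^^ N) \<le> l ^ N" if "N0 \<le> N" for N
        using K[of N] l0 that by (force simp: power_divide divide_less_eq)
      then show ?thesis
        by (rule that)
    qed
    have Tn: "L2_norm M (T N f) \<le> 4 * s * L2_norm M f" if N: "N0 \<le> N" and f: "f \<in> L2 M" for N f
    proof -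
      define x where "x = T N f"
      have xL: "x \<in> L2 M"
        unfolding x_def by (rule TL[OF f])
      \<comment> \<open>Telescoping gives (l - A) x = g, hence (L - A) x = g - (l - L) x, to which
        the inverse \<open>S\<close> at L can be applied.\<close>
      define g where "g = (\<lambda>y. f y - (A ^^ N) f y / of_real l ^ N)"
      have gL: "g \<in> L2 M"
        unfolding g_def by (intro L2_diff(1) L2_divide(1) LLn f)
      have "AE y in M. A x y = (\<Sum>k<N. A (\<lambda>y. (A ^^ k) f y / of_real l ^ Suc k) y)"
        unfolding x_def T_def by (intro linear_operator_sum[OF lin] L2_divide(1) LLn f) auto
      moreover have "AE y in M. \<forall>k. A (\<lambda>y. (A ^^ k) f y / of_real l ^ Suc k) y = (A ^^ Suc k) f y / of_real l ^ Suc k"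
        unfolding AE_all_countable
        using linear_operator_divide[OF lin LLn[OF f]] by simp
      ultimately have "AE y in M. of_real L * x y - A x y = g y - of_real (l - L) * x y"
      proof eventually_elim
        case (elim y)
        have "of_real l * x y = (\<Sum>k<N. (A ^^ k) f y / of_real l ^ k)"
          unfolding x_def T_def sum_distrib_left using l0 by (intro sum.cong) auto
        moreover have "A x y = (\<Sum>k<N. (A ^^ Suc k) f y / of_real l ^ Suc k)"
          using elim by simp
        moreover have "(\<Sum>k<N. (A ^^ k) f y / of_real l ^ k) - (\<Sum>k<N. (A ^^ Suc k) f y / of_real l ^ Suc k) = g y"
          unfolding sum_subtractf[symmetric] g_def
          by (subst sum_lessThan_telescope') simp
        ultimately show ?case
          by (simp add: algebra_simps)
      qed
      then have "L2_norm M (\<lambda>y. of_real L * x y - A x y) = L2_norm M (\<lambda>y. g y - of_real (l - L) * x y)"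
        by (intro L2_norm_cong_AE(2)[OF L2_diff(1) L2_measurable[OF L2_diff(1)]] linear_operator_L2[OF lin] gL xL L2_scale(1))
      also have "\<dots> \<le> L2_norm M g + (l - L) * L2_norm M x"
        using L2_diff(2)[OF gL L2_scale(1)[OF xL, of "of_real (l - L)"]] l
        by (simp only: L2_scale(2)[OF xL] norm_of_real abs_of_pos diff_gt_0_iff_gt)
      also have "L2_norm M g \<le> L2_norm M f + L2_norm M (\<lambda>y. (A ^^ N) f y / of_real l ^ N)"
        unfolding g_def by (intro L2_diff(2) L2_divide(1) LLn f)
      also have "L2_norm M (\<lambda>y. (A ^^ N) f y / of_real l ^ N) = L2_norm M ((A ^^ N) f) / l ^ N"
        by (subst L2_divide(2)[OF LLn[OF f]]) (use l0 in \<open>simp add: norm_power\<close>)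
      also have "\<dots> \<le> L2_norm M f"
      proof -
        have "L2_norm M ((A ^^ N) f) \<le> l ^ N * L2_norm M f"
          using op_norm_bound[OF Bn f, of N] mult_right_mono[OF N0[OF N] L2_norm_nonneg[of M f]] by simp
        then show ?thesis
          using l0 by (simp add: divide_le_eq mult_ac)
      qed
      finally have 1: "L2_norm M (\<lambda>y. of_real L * x y - A x y) \<le> 2 * L2_norm M f + (l - L) * L2_norm M x"
        by simp
      have dL: "(\<lambda>y. of_real L * x y - A x y) \<in> L2 M"
        by (intro L2_diff(1) L2_scale(1) linear_operator_L2[OF lin] xL)
      \<comment> \<open>\<open>S\<close> recovers x from (L - A) x. Since (l - L) s <= 1/2, the term
        with the norm of x on the right is at most half of the left side and is absorbed, so 2 s
        becomes 4 s.\<close>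
      have "L2_norm M x = L2_norm M (S (\<lambda>y. of_real L * x y - A x y))"
        using S(2)[OF xL] by (intro L2_norm_cong_AE(2)[symmetric] xL L2_measurable linear_operator_L2[OF bounded_operatorD[OF S(1)]] dL)
      also have "\<dots> \<le> s * L2_norm M (\<lambda>y. of_real L * x y - A x y)"
        unfolding s_def by (intro op_norm_bound S dL)
      also have "\<dots> \<le> s * (2 * L2_norm M f + (l - L) * L2_norm M x)"
        by (intro mult_left_mono 1 s0)
      also have "\<dots> = 2 * s * L2_norm M f + ((l - L) * s) * L2_norm M x"
        by (simp add: algebra_simps)
      also have "\<dots> \<le> 2 * s * L2_norm M f + (1 / 2) * L2_norm M x"
        by (intro add_left_mono mult_right_mono l) simp
      finally show ?thesis
        by (simp add: x_def)
    qed
    have "op_norm M (A ^^ n) \<le> 4 * (16 * s\<^sup>2 * l ^ (n + 2) / (real n + 1))"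
    proof (rule op_norm_positive_least[OF Pn])
      fix f assume f: "f \<in> L2 M" "AE x in M. 0 \<le> f x"
      \<comment> \<open>Long enough for the bound on \<open>T N\<close> to hold and for all
        exponents 0, ..., n to occur in it.\<close>
      define N where "N = Suc (max n N0)"
      have N: "n < N" "N0 \<le> N"
        by (auto simp: N_def)
      define x where "x = T N f"
      have xL: "x \<in> L2 M"
        unfolding x_def by (rule TL[OF f(1)])
      have nn: "AE y in M. \<forall>k. 0 \<le> (A ^^ k) f y"
        unfolding AE_all_countable by (intro allI positive_operator_nonneg[OF Pn f])
      have nnx: "AE y in M. 0 \<le> x y"
        using nn unfolding x_def T_def
        by eventually_elim (intro sum_nonneg complex_divide_power_nonneg; use l0 in simp)
      have nnAx: "AE y in M. \<forall>k. 0 \<le> (A ^^ k) x y"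
        unfolding AE_all_countable by (intro allI positive_operator_nonneg[OF Pn xL nnx])
      \<comment> \<open>Each splitting of A^n as A^i after A^(n - i) contributes one copy of A^n f /
        l^(n + 2) to \<open>T N (T N f)\<close>; there are n + 1 of them, and the remaining terms
        are nonnegative.\<close>
      have trm: "AE y in M. (A ^^ n) f y / of_real l ^ (n + 2) \<le> (A ^^ i) x y / of_real l ^ Suc i"
        if i: "i \<le> n" for i
      proof -
        have "AE y in M. (A ^^ (n - i)) f y / of_real l ^ Suc (n - i) \<le> x y"
          using nn unfolding x_def T_def
        proof eventually_elim
          case (elim y)
          have "0 \<le> (A ^^ k) f y / of_real l ^ Suc k" for k
            using elim l0 by (intro complex_divide_power_nonneg) auto
          then show ?case
            using N by (intro member_le_sum) auto
        qed
        then have "AE y in M. (A ^^ i) (\<lambda>y. (A ^^ (n - i)) f y / of_real l ^ Suc (n - i)) y \<le> (A ^^ i) x y"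
          by (intro positive_operator_mono[OF Pn L2_divide(1)[OF LLn[OF f(1)]] xL])
        moreover have "AE y in M. (A ^^ i) (\<lambda>y. (A ^^ (n - i)) f y / of_real l ^ Suc (n - i)) y
            = (A ^^ i) ((A ^^ (n - i)) f) y / of_real l ^ Suc (n - i)"
          by (intro linear_operator_divide[OF Ln] LLn f)
        ultimately show ?thesis
        proof eventually_elim
          case (elim y)
          have "(A ^^ i) ((A ^^ (n - i)) f) = (A ^^ n) f"
            using i by (simp add: funpow_add[symmetric, THEN fun_cong, unfolded o_def])
          with elim have "(A ^^ n) f y / of_real (l ^ Suc (n - i)) \<le> (A ^^ i) x y"
            by simp
          then have "(A ^^ n) f y / of_real (l ^ Suc (n - i)) / of_real (l ^ Suc i) \<le> (A ^^ i) x y / of_real (l ^ Suc i)"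
            using l0 by (intro complex_divide_of_real_mono) auto
          moreover have "(complex_of_real l) ^ (n + 2) = of_real (l ^ Suc (n - i)) * of_real (l ^ Suc i)"
            using i unfolding of_real_mult[symmetric] power_add[symmetric] by simp
          ultimately show ?case
            by (simp only: divide_divide_eq_left of_real_power)
        qed
      qed
      have terms: "AE y in M. \<forall>i\<le>n. (A ^^ n) f y / of_real l ^ (n + 2) \<le> (A ^^ i) x y / of_real l ^ Suc i"
        unfolding AE_all_countable using trm by (auto intro!: AE_I2 simp: AE_all_countable)
      have "AE y in M. of_nat (Suc n) * ((A ^^ n) f y / of_real l ^ (n + 2)) \<le> T N x y"
        using terms nnAx
      proof eventually_elim
        case (elim y)
        have "of_nat (Suc n) * ((A ^^ n) f y / of_real l ^ (n + 2)) = (\<Sum>i\<le>n. (A ^^ n) f y / of_real l ^ (n + 2))"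
          by simp
        also have "\<dots> \<le> (\<Sum>i\<le>n. (A ^^ i) x y / of_real l ^ Suc i)"
          using elim by (intro sum_mono) auto
        also have "\<dots> \<le> (\<Sum>i<N. (A ^^ i) x y / of_real l ^ Suc i)"
          using elim l0 N by (intro sum_mono2 complex_divide_power_nonneg) auto
        finally show ?case
          by (simp add: T_def)
      qed
      then have "AE y in M. cmod (of_nat (Suc n) * ((A ^^ n) f y / of_real l ^ (n + 2))) \<le> cmod (T N x y)"
        using nn
      proof eventually_elim
        case (elim y)
        have "0 \<le> of_nat (Suc n) * ((A ^^ n) f y / of_real l ^ (n + 2))"
          using elim l0 by (intro mult_nonneg_nonneg complex_divide_power_nonneg) (auto simp: less_eq_complex_def)
        then show ?case
          using elim by (intro complex_nonneg_norm_mono)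
      qed
      then have "L2_norm M (\<lambda>y. of_nat (Suc n) * ((A ^^ n) f y / of_real l ^ (n + 2))) \<le> L2_norm M (T N x)"
        by (intro L2_bound(2)[OF TL[OF xL]] L2_measurable L2_scale(1) L2_divide(1) LLn f)
      also have "\<dots> \<le> 4 * s * L2_norm M x"
        by (rule Tn[OF N(2) xL])
      also have "\<dots> \<le> 4 * s * (4 * s * L2_norm M f)"
        unfolding x_def using s0 by (intro mult_left_mono Tn[OF N(2) f(1)]) auto
      also have "L2_norm M (\<lambda>y. of_nat (Suc n) * ((A ^^ n) f y / of_real l ^ (n + 2)))
          = (real n + 1) * (L2_norm M ((A ^^ n) f) / l ^ (n + 2))"
        unfolding L2_scale(2)[OF L2_divide(1)[OF LLn[OF f(1)]]] L2_divide(2)[OF LLn[OF f(1)]] norm_of_nat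
        using l0 by (simp add: norm_power norm_mult del: power_Suc)
      finally have "(real n + 1) * (L2_norm M ((A ^^ n) f) / l ^ (n + 2)) \<le> 16 * s\<^sup>2 * L2_norm M f"
        by (simp add: power2_eq_square)
      then have "(real n + 1) * L2_norm M ((A ^^ n) f) \<le> 16 * s\<^sup>2 * l ^ (n + 2) * L2_norm M f"
        using l0 by (simp add: divide_le_eq mult_ac)
      then show "L2_norm M ((A ^^ n) f) \<le> 16 * s\<^sup>2 * l ^ (n + 2) / (real n + 1) * L2_norm M f"
        by (simp add: le_divide_eq mult_ac)
    qed (use l0 in simp)
    then show ?thesis
      by (simp add: le_divide_eq mult_ac)
  qed
  \<comment> \<open>As l decreases to L, the lower bound L^n on the norm turns \<open>key\<close>
    into a bound on n + 1 that does not depend on n.\<close>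
  have key': "real n + 1 \<le> 64 * s\<^sup>2 * L\<^sup>2" if n: "1 \<le> n" for n
  proof -
    \<comment> \<open>The + 1 permits s = 0; every l within \<open>d\<close> of L satisfies (l - L)
      s <= 1/2.\<close>
    define d where "d = 1 / (2 * (s + 1))"
    have d: "0 < d" "d * s \<le> 1 / 2"
      using s0 by (auto simp: d_def divide_le_eq)
    define l where "l k = L + d / real (Suc k)" for k
    have lk: "L < l k" "(l k - L) * s \<le> 1 / 2" for k
    proof -
      have "d / real (Suc k) \<le> d"
        using d by (simp add: divide_le_eq mult_ge1_I)
      then have "d / real (Suc k) * s \<le> d * s"
        using s0 by (intro mult_right_mono) auto
      then show "L < l k" "(l k - L) * s \<le> 1 / 2"
        using d by (auto simp: l_def)
    qed
    have "l \<longlonglongrightarrow> L + 0"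
      unfolding l_def using LIMSEQ_Suc[OF lim_const_over_n[of d]] by (intro tendsto_intros) simp
    then have lim: "(\<lambda>k. 64 * s\<^sup>2 * l k ^ (n + 2)) \<longlonglongrightarrow> 64 * s\<^sup>2 * L ^ (n + 2)"
      by (intro tendsto_intros) simp
    have "(real n + 1) * L ^ n \<le> 64 * s\<^sup>2 * l k ^ (n + 2)" for k
      using mult_left_mono[OF lower[OF n], of "real n + 1"] key[OF lk(1) lk(2), of n k] by linarith
    then have "(real n + 1) * L ^ n \<le> 64 * s\<^sup>2 * L ^ (n + 2)"
      using lim by (intro LIMSEQ_le_const) auto
    also have "\<dots> = (64 * s\<^sup>2 * L\<^sup>2) * L ^ n"
      by (simp add: power_add power2_eq_square)
    finally show ?thesis
      using L by simp
  qed
  obtain n where "64 * s\<^sup>2 * L\<^sup>2 < real n"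
    using reals_Archimedean2 by blast
  then show False
    using key'[of "Suc n"] by simp
qed

text \<open>Gelfand's formula: the Neumann series bounds the spectrum by the limit L, and positivity
  puts L itself into the spectrum when L > 0. For L = 0 the value comes from the
  \<open>insert 0\<close> in the definition, which also covers an empty spectrum.\<close>

lemma op_spectral_radius_limit:
  assumes A: "bounded_operator M A" "positive_operator M A"
  shows "(\<lambda>n. op_norm M (A ^^ n) powr (1 / real n)) \<longlonglongrightarrow> op_spectral_radius M A"
    and "0 \<le> op_spectral_radius M A"
    and "1 \<le> n \<Longrightarrow> op_spectral_radius M A ^ n \<le> op_norm M (A ^^ n)"
proof -
  note Bn = bounded_operator_funpow[OF A(1)]
  obtain L where L: "(\<lambda>n. op_norm M (A ^^ n) powr (1 / real n)) \<longlonglongrightarrow> L" "0 \<le> L"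
    "\<And>n. 1 \<le> n \<Longrightarrow> L ^ n \<le> op_norm M (A ^^ n)"
    "\<And>\<mu>. L < \<mu> \<Longrightarrow> \<exists>K. \<forall>n. op_norm M (A ^^ n) \<le> K * \<mu> ^ n"
    using submultiplicative_root_limit[of "\<lambda>n. op_norm M (A ^^ n)", OF op_norm_nonneg[OF Bn] op_norm_funpow_add[OF A(1)]]
    by blast
  have upper: "cmod z \<le> L" if "z \<in> op_spectrum M A" for z
  proof (rule field_le_epsilon)
    fix e :: real assume "0 < e"
    then obtain K where "\<And>n. op_norm M (A ^^ n) \<le> K * (L + e) ^ n"
      using L(4)[of "L + e"] by auto
    then show "cmod z \<le> L + e"
      using \<open>0 < e\<close> L(2) that by (intro op_spectrum_bound[OF A(1)]) auto
  qed
  have "op_spectral_radius M A = L"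
  proof (rule antisym)
    show "op_spectral_radius M A \<le> L"
      unfolding op_spectral_radius_def using upper L(2) by (intro cSup_least) auto
    show "L \<le> op_spectral_radius M A"
    proof (cases "L = 0")
      case True
      then show ?thesis
        unfolding op_spectral_radius_def using upper by (intro cSup_upper bdd_aboveI[of _ L]) auto
    next
      case False
      then have "complex_of_real L \<in> op_spectrum M A"
        using L by (intro positive_operator_limit_in_spectrum A) auto
      then have "L \<in> cmod ` op_spectrum M A"
        using L(2) by (intro image_eqI[of _ _ "complex_of_real L"]) auto
      then show ?thesis
        unfolding op_spectral_radius_def using upper L(2) by (intro cSup_upper bdd_aboveI[of _ L]) auto
    qed
  qed
  then show "(\<lambda>n. op_norm M (A ^^ n) powr (1 / real n)) \<longlonglongrightarrow> op_spectral_radius M A"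
    and "0 \<le> op_spectral_radius M A"
    and "1 \<le> n \<Longrightarrow> op_spectral_radius M A ^ n \<le> op_norm M (A ^^ n)"
    using L by auto
qed

subsection \<open>Sets of positive operators\<close>

text \<open>Meant for comparing powers of A B with powers of B A, where one power is lost; the shift
  is harmless because n / (n + 1) tends to 1.\<close>

lemma root_limit_shift_le:
  fixes s t :: "nat \<Rightarrow> real"
  assumes s: "(\<lambda>n. s n powr (1 / real n)) \<longlonglongrightarrow> a" and t: "(\<lambda>n. t n powr (1 / real n)) \<longlonglongrightarrow> b"
    and nonneg: "\<And>n. 0 \<le> s n" "\<And>n. 0 \<le> t n" and le: "\<And>n. 1 \<le> n \<Longrightarrow> s (Suc n) \<le> C * t n"
  shows "a \<le> b"
proof -
  \<comment> \<open>Raised to at least 1 so that its roots tend to 1.\<close>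
  define D where "D = max 1 C"
  have D: "0 < D" "C \<le> D"
    by (auto simp: D_def)
  have e: "(\<lambda>n. real n / real (Suc n)) \<longlonglongrightarrow> 1" "(\<lambda>n. 1 / real (Suc n)) \<longlonglongrightarrow> 0"
    using LIMSEQ_n_over_Suc_n LIMSEQ_Suc[OF lim_1_over_n] by auto
  have "(\<lambda>n. D powr (1 / real (Suc n)) * (t n powr (1 / real n)) powr (real n / real (Suc n)))
      \<longlonglongrightarrow> D powr 0 * b powr 1"
    using D by (intro tendsto_mult tendsto_powr' e t tendsto_const) auto
  moreover have "0 \<le> b"
    using t by (rule LIMSEQ_le_const) auto
  ultimately have lim: "(\<lambda>n. D powr (1 / real (Suc n)) * (t n powr (1 / real n)) powr (real n / real (Suc n))) \<longlonglongrightarrow> b"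
    using D by simp
  show ?thesis
  proof (rule LIMSEQ_le[OF LIMSEQ_Suc[OF s] lim], intro exI[of _ 1] allI impI)
    fix n :: nat assume n: "1 \<le> n"
    have "s (Suc n) \<le> D * t n"
      using le[OF n] mult_right_mono[OF D(2) nonneg(2)[of n]] by linarith
    then have "s (Suc n) powr (1 / real (Suc n)) \<le> (D * t n) powr (1 / real (Suc n))"
      using nonneg by (intro powr_mono2) auto
    also have "\<dots> = D powr (1 / real (Suc n)) * (t n powr (1 / real n)) powr (real n / real (Suc n))"
      using D n nonneg(2)[of n] by (simp add: powr_mult powr_powr del: of_nat_Suc)
    finally show "s (Suc n) powr (1 / real (Suc n)) \<le> D powr (1 / real (Suc n)) * (t n powr (1 / real n)) powr (real n / real (Suc n))" .
  qed
qed

section \<open>Spectral radii of single positive operators\<close>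

lemma op_spectral_radius_le_norm:
  assumes "bounded_operator M A" "positive_operator M A"
  shows "op_spectral_radius M A \<le> op_norm M A"
  using op_spectral_radius_limit(3)[OF assms, of 1] by simp

lemma op_spectral_radius_funpow:
  assumes A: "bounded_operator M A" "positive_operator M A" and m: "1 \<le> m"
  shows "op_spectral_radius M (A ^^ m) = op_spectral_radius M A ^ m"
proof -
  note Am = bounded_operator_funpow[OF A(1), of m] positive_operator_funpow[OF A(2), of m]
  have "strict_mono (\<lambda>n. n * m)"
    using m by (auto simp: strict_mono_def)
  from LIMSEQ_subseq_LIMSEQ[OF op_spectral_radius_limit(1)[OF A] this]
  have "(\<lambda>n. (op_norm M (A ^^ (n * m)) powr (1 / real (n * m))) powr real m) \<longlonglongrightarrow> op_spectral_radius M A powr real m"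
    using m by (intro tendsto_powr') (auto simp: o_def)
  moreover have "(op_norm M (A ^^ (n * m)) powr (1 / real (n * m))) powr real m = op_norm M ((A ^^ m) ^^ n) powr (1 / real n)" for n
    using m by (simp add: powr_powr funpow_mult mult.commute)
  ultimately have "op_spectral_radius M (A ^^ m) = op_spectral_radius M A powr real m"
    using op_spectral_radius_limit(1)[OF Am] LIMSEQ_unique by auto
  then show ?thesis
    using m op_spectral_radius_limit(2)[OF A] by (simp add: powr_realpow')
qed

lemma op_spectral_radius_mono:
  assumes A: "bounded_operator M A" "positive_operator M A"
    and B: "bounded_operator M B" "positive_operator M B" and d: "dominated M A B"
  shows "op_spectral_radius M A \<le> op_spectral_radius M B"
proof -
  have "(\<lambda>n. 4 powr (1 / real n) * op_norm M (B ^^ n) powr (1 / real n)) \<longlonglongrightarrow> 4 powr 0 * op_spectral_radius M B"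
    by (intro tendsto_intros lim_1_over_n op_spectral_radius_limit[OF B]) auto
  then have lim: "(\<lambda>n. (4 * op_norm M (B ^^ n)) powr (1 / real n)) \<longlonglongrightarrow> op_spectral_radius M B"
    using op_norm_nonneg[OF bounded_operator_funpow[OF B(1)]] by (simp add: powr_mult)
  show ?thesis
    by (rule LIMSEQ_le[OF op_spectral_radius_limit(1)[OF A] lim], intro exI[of _ 0] allI impI powr_mono2)
      (auto intro!: dominated_op_norm positive_operator_funpow bounded_operator_funpow dominated_funpow
        op_norm_nonneg A B d)
qed

text \<open>Since (A B)^(n + 1) = A (B A)^n B, its norm is at most a constant times that of (B
  A)^n.\<close>

lemma op_spectral_radius_comm_le:
  assumes A: "bounded_operator M A" "positive_operator M A"
    and B: "bounded_operator M B" "positive_operator M B"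
  shows "op_spectral_radius M (A \<circ> B) \<le> op_spectral_radius M (B \<circ> A)"
proof (rule root_limit_shift_le)
  note AB = bounded_operator_comp(1)[OF A(1) B(1)] positive_operator_comp[OF A(2) B(2)]
  note BA = bounded_operator_comp(1)[OF B(1) A(1)] positive_operator_comp[OF B(2) A(2)]
  show "(\<lambda>n. op_norm M ((A \<circ> B) ^^ n) powr (1 / real n)) \<longlonglongrightarrow> op_spectral_radius M (A \<circ> B)"
    by (rule op_spectral_radius_limit[OF AB])
  show "(\<lambda>n. op_norm M ((B \<circ> A) ^^ n) powr (1 / real n)) \<longlonglongrightarrow> op_spectral_radius M (B \<circ> A)"
    by (rule op_spectral_radius_limit[OF BA])
  show "0 \<le> op_norm M ((A \<circ> B) ^^ n)" "0 \<le> op_norm M ((B \<circ> A) ^^ n)" for n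
    by (intro op_norm_nonneg bounded_operator_funpow AB BA)+
  fix n
  note BAn = bounded_operator_funpow[OF BA(1), of n]
  have "(A \<circ> B) ^^ Suc n = A \<circ> ((B \<circ> A) ^^ n \<circ> B)"
  proof (induction n)
    case (Suc n)
    have "(A \<circ> B) ^^ Suc (Suc n) = (A \<circ> B) \<circ> (A \<circ> ((B \<circ> A) ^^ n \<circ> B))"
      unfolding Suc.IH[symmetric] by (rule funpow.simps(2))
    then show ?case
      by (simp only: funpow.simps(2) comp_assoc)
  qed simp
  then have "op_norm M ((A \<circ> B) ^^ Suc n) \<le> op_norm M A * op_norm M ((B \<circ> A) ^^ n \<circ> B)"
    using bounded_operator_comp(2)[OF A(1) bounded_operator_comp(1)[OF BAn B(1)]] by simp
  also have "\<dots> \<le> op_norm M A * (op_norm M ((B \<circ> A) ^^ n) * op_norm M B)"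
    by (intro mult_left_mono bounded_operator_comp(2) BAn B op_norm_nonneg A)
  finally show "op_norm M ((A \<circ> B) ^^ Suc n) \<le> (op_norm M A * op_norm M B) * op_norm M ((B \<circ> A) ^^ n)"
    by (simp add: mult_ac)
qed

lemma op_spectral_radius_comm:
  assumes "bounded_operator M A" "positive_operator M A" "bounded_operator M B" "positive_operator M B"
  shows "op_spectral_radius M (A \<circ> B) = op_spectral_radius M (B \<circ> A)"
  using op_spectral_radius_comm_le[OF assms] op_spectral_radius_comm_le[OF assms(3,4,1,2)] by simp

section \<open>Products, powers and norms of sets of operators\<close>

lemma op_set_mult_iff: "C \<in> op_set_mult \<Phi> \<Psi> \<longleftrightarrow> (\<exists>A\<in>\<Phi>. \<exists>B\<in>\<Psi>. C = A \<circ> B)"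
  by (auto simp: op_set_mult_def)

lemma op_set_multI: "A \<in> \<Phi> \<Longrightarrow> B \<in> \<Psi> \<Longrightarrow> A \<circ> B \<in> op_set_mult \<Phi> \<Psi>"
  by (auto simp: op_set_mult_def)

lemma op_set_mult_assoc: "op_set_mult (op_set_mult \<Phi> \<Psi>) \<Theta> = op_set_mult \<Phi> (op_set_mult \<Psi> \<Theta>)"
proof (rule set_eqI)
  fix C
  have "C \<in> op_set_mult (op_set_mult \<Phi> \<Psi>) \<Theta> \<longleftrightarrow> (\<exists>A\<in>\<Phi>. \<exists>B\<in>\<Psi>. \<exists>D\<in>\<Theta>. C = (A \<circ> B) \<circ> D)"
    unfolding op_set_mult_def by blast
  also have "\<dots> \<longleftrightarrow> C \<in> op_set_mult \<Phi> (op_set_mult \<Psi> \<Theta>)"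
    unfolding op_set_mult_def comp_assoc by blast
  finally show "C \<in> op_set_mult (op_set_mult \<Phi> \<Psi>) \<Theta> \<longleftrightarrow> C \<in> op_set_mult \<Phi> (op_set_mult \<Psi> \<Theta>)" .
qed

lemma op_set_mult_id [simp]: "op_set_mult \<Phi> {id} = \<Phi>" "op_set_mult {id} \<Phi> = \<Phi>"
  by (auto simp: op_set_mult_def)

lemma op_set_prod_Nil [simp]: "op_set_prod [] = {id}"
  and op_set_prod_Cons [simp]: "op_set_prod (\<Phi> # \<Psi>s) = op_set_mult \<Phi> (op_set_prod \<Psi>s)"
  by (simp_all add: op_set_prod_def)

lemma op_set_prod_append: "op_set_prod (\<Phi>s @ \<Psi>s) = op_set_mult (op_set_prod \<Phi>s) (op_set_prod \<Psi>s)"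
  by (induction \<Phi>s) (simp_all add: op_set_mult_assoc)

lemma op_set_power_0 [simp]: "op_set_power \<Sigma> 0 = {id}"
  and op_set_power_Suc [simp]: "op_set_power \<Sigma> (Suc k) = op_set_mult \<Sigma> (op_set_power \<Sigma> k)"
  by (simp_all add: op_set_power_def)

lemma op_set_power_add: "op_set_power \<Sigma> (k + l) = op_set_mult (op_set_power \<Sigma> k) (op_set_power \<Sigma> l)"
  unfolding op_set_power_def replicate_add op_set_prod_append ..

lemma op_set_power_mult: "op_set_power \<Sigma> (k * l) = op_set_power (op_set_power \<Sigma> k) l"
  by (induction l) (simp_all add: op_set_power_add)

lemma op_set_power_Suc_comm:
  "op_set_power (op_set_mult \<Phi> \<Psi>) (Suc k) = op_set_mult \<Phi> (op_set_mult (op_set_power (op_set_mult \<Psi> \<Phi>) k) \<Psi>)"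
  by (induction k) (simp_all add: op_set_mult_assoc)

lemma op_set_power_Suc2: "op_set_power \<Sigma> (Suc k) = op_set_mult (op_set_power \<Sigma> k) \<Sigma>"
  using op_set_power_add[of \<Sigma> k 1] by simp

lemma funpow_in_op_set_power: "A \<in> \<Sigma> \<Longrightarrow> A ^^ k \<in> op_set_power \<Sigma> k"
  by (induction k) (auto simp: op_set_mult_iff)

lemma set_norm_nonneg: "bounded_op_set M \<Sigma> \<Longrightarrow> 0 \<le> set_norm M \<Sigma>"
  unfolding set_norm_def bounded_op_set_def by (intro cSup_upper) auto

lemma op_norm_le_set_norm: "bounded_op_set M \<Sigma> \<Longrightarrow> A \<in> \<Sigma> \<Longrightarrow> op_norm M A \<le> set_norm M \<Sigma>"
  unfolding set_norm_def bounded_op_set_def by (intro cSup_upper) auto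

lemma set_norm_least: "0 \<le> B \<Longrightarrow> (\<And>A. A \<in> \<Sigma> \<Longrightarrow> op_norm M A \<le> B) \<Longrightarrow> set_norm M \<Sigma> \<le> B"
  unfolding set_norm_def by (intro cSup_least) auto

lemma bounded_op_setI:
  "(\<And>A. A \<in> \<Sigma> \<Longrightarrow> bounded_operator M A) \<Longrightarrow> (\<And>A. A \<in> \<Sigma> \<Longrightarrow> op_norm M A \<le> B) \<Longrightarrow> bounded_op_set M \<Sigma>"
  unfolding bounded_op_set_def by (auto intro!: bdd_aboveI)

lemma bounded_op_setD: "bounded_op_set M \<Sigma> \<Longrightarrow> A \<in> \<Sigma> \<Longrightarrow> bounded_operator M A"
  by (simp add: bounded_op_set_def)

lemma bounded_op_set_mult:
  assumes \<Phi>: "bounded_op_set M \<Phi>" and \<Psi>: "bounded_op_set M \<Psi>"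
  shows "bounded_op_set M (op_set_mult \<Phi> \<Psi>)"
    and "set_norm M (op_set_mult \<Phi> \<Psi>) \<le> set_norm M \<Phi> * set_norm M \<Psi>"
proof -
  have le: "op_norm M C \<le> set_norm M \<Phi> * set_norm M \<Psi>" if "C \<in> op_set_mult \<Phi> \<Psi>" for C
  proof -
    obtain A B where C: "A \<in> \<Phi>" "B \<in> \<Psi>" "C = A \<circ> B"
      using \<open>C \<in> op_set_mult \<Phi> \<Psi>\<close> by (auto simp: op_set_mult_iff)
    have "op_norm M C \<le> op_norm M A * op_norm M B"
      unfolding C by (intro bounded_operator_comp bounded_op_setD[OF \<Phi>] bounded_op_setD[OF \<Psi>] C)
    also have "\<dots> \<le> set_norm M \<Phi> * set_norm M \<Psi>"
      using C \<Phi> \<Psi> by (intro mult_mono op_norm_le_set_norm set_norm_nonneg op_norm_nonneg) (auto dest: bounded_op_setD)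
    finally show ?thesis .
  qed
  then show "set_norm M (op_set_mult \<Phi> \<Psi>) \<le> set_norm M \<Phi> * set_norm M \<Psi>"
    by (intro set_norm_least mult_nonneg_nonneg set_norm_nonneg \<Phi> \<Psi>)
  show "bounded_op_set M (op_set_mult \<Phi> \<Psi>)"
    using \<Phi> \<Psi> by (intro bounded_op_setI[OF _ le]) (auto simp: op_set_mult_iff intro!: bounded_operator_comp dest: bounded_op_setD)
qed

text \<open>The property shared by the sets of kernel operators, of matrices and of their adjoints;
  it passes to products and powers without tracking kernels.\<close>

definition positive_op_set :: "'a measure \<Rightarrow> 'a oper set \<Rightarrow> bool" where
  "positive_op_set M \<Sigma> \<longleftrightarrow> bounded_op_set M \<Sigma> \<and> (\<forall>A\<in>\<Sigma>. positive_operator M A)"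

lemma positive_op_setD:
  assumes "positive_op_set M \<Sigma>"
  shows "bounded_op_set M \<Sigma>" "A \<in> \<Sigma> \<Longrightarrow> bounded_operator M A" "A \<in> \<Sigma> \<Longrightarrow> positive_operator M A"
  using assms by (auto simp: positive_op_set_def bounded_op_set_def)

lemma positive_op_set_mult:
  "positive_op_set M \<Phi> \<Longrightarrow> positive_op_set M \<Psi> \<Longrightarrow> positive_op_set M (op_set_mult \<Phi> \<Psi>)"
  unfolding positive_op_set_def
  by (auto intro: bounded_op_set_mult simp: op_set_mult_iff intro!: positive_operator_comp)

lemma positive_op_set_id: "positive_op_set M {id}"
  by (auto simp: positive_op_set_def bounded_op_set_def positive_operator_id)

lemma positive_op_set_prod:
  "(\<And>\<Psi>. \<Psi> \<in> set \<Psi>s \<Longrightarrow> positive_op_set M \<Psi>) \<Longrightarrow> positive_op_set M (op_set_prod \<Psi>s)"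
  by (induction \<Psi>s) (auto intro: positive_op_set_mult positive_op_set_id)

lemma positive_op_set_power: "positive_op_set M \<Sigma> \<Longrightarrow> positive_op_set M (op_set_power \<Sigma> k)"
  unfolding op_set_power_def by (intro positive_op_set_prod) auto

section \<open>Joint and generalized spectral radius\<close>

lemma joint_spectral_radius_limit:
  assumes "positive_op_set M \<Sigma>"
  shows "(\<lambda>k. set_norm M (op_set_power \<Sigma> k) powr (1 / real k)) \<longlonglongrightarrow> joint_spectral_radius M \<Sigma>"
    and "0 \<le> joint_spectral_radius M \<Sigma>"
proof -
  note b = positive_op_setD(1)[OF positive_op_set_power[OF assms]]
  \<comment> \<open>Submultiplicativity of the set norm makes the \<open>lim\<close> of the
    definition an actual limit.\<close>
  obtain L where L: "(\<lambda>k. set_norm M (op_set_power \<Sigma> k) powr (1 / real k)) \<longlonglongrightarrow> L" "0 \<le> L"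
  proof (rule submultiplicative_root_limit)
    show "0 \<le> set_norm M (op_set_power \<Sigma> k)" for k
      by (rule set_norm_nonneg[OF b])
    show "set_norm M (op_set_power \<Sigma> (k + l)) \<le> set_norm M (op_set_power \<Sigma> k) * set_norm M (op_set_power \<Sigma> l)" for k l
      unfolding op_set_power_add by (intro bounded_op_set_mult b)
  qed blast
  then show "(\<lambda>k. set_norm M (op_set_power \<Sigma> k) powr (1 / real k)) \<longlonglongrightarrow> joint_spectral_radius M \<Sigma>"
    and "0 \<le> joint_spectral_radius M \<Sigma>"
    by (simp_all add: joint_spectral_radius_def limI)
qed

text \<open>The inner supremum in \<open>generalized_spectral_radius\<close>, named so that it can
  be compared power by power.\<close>

definition set_spectral_radius :: "'a measure \<Rightarrow> 'a oper set \<Rightarrow> real" where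
  "set_spectral_radius M \<Sigma> = Sup (insert 0 (op_spectral_radius M ` \<Sigma>))"

lemma set_spectral_radius:
  assumes "positive_op_set M \<Sigma>"
  shows op_spectral_radius_le_set: "A \<in> \<Sigma> \<Longrightarrow> op_spectral_radius M A \<le> set_spectral_radius M \<Sigma>"
    and set_spectral_radius_nonneg: "0 \<le> set_spectral_radius M \<Sigma>"
    and set_spectral_radius_le_set_norm: "set_spectral_radius M \<Sigma> \<le> set_norm M \<Sigma>"
proof -
  note D = positive_op_setD[OF assms]
  have le: "op_spectral_radius M A \<le> set_norm M \<Sigma>" if "A \<in> \<Sigma>" for A
    using op_spectral_radius_le_norm[of M A] op_norm_le_set_norm[of M \<Sigma> A] D that by auto
  then have bdd: "bdd_above (insert 0 (op_spectral_radius M ` \<Sigma>))"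
    using set_norm_nonneg[OF D(1)] by (intro bdd_aboveI[of _ "set_norm M \<Sigma>"]) auto
  show "A \<in> \<Sigma> \<Longrightarrow> op_spectral_radius M A \<le> set_spectral_radius M \<Sigma>" "0 \<le> set_spectral_radius M \<Sigma>"
    unfolding set_spectral_radius_def by (auto intro!: cSup_upper bdd)
  show "set_spectral_radius M \<Sigma> \<le> set_norm M \<Sigma>"
    unfolding set_spectral_radius_def using le set_norm_nonneg[OF D(1)] by (intro cSup_least) auto
qed

lemma set_spectral_radius_least:
  "0 \<le> B \<Longrightarrow> (\<And>A. A \<in> \<Sigma> \<Longrightarrow> op_spectral_radius M A \<le> B) \<Longrightarrow> set_spectral_radius M \<Sigma> \<le> B"
  unfolding set_spectral_radius_def by (intro cSup_least) auto

text \<open>\<open>real_of_ereal\<close> would send an infinite limsup to 0. Spectral radii are at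
  most norms, so the limsup is bounded by the joint spectral radius and hence finite.\<close>

lemma generalized_spectral_radius_limsup:
  assumes \<Sigma>: "positive_op_set M \<Sigma>"
  shows "ereal (generalized_spectral_radius M \<Sigma>)
      = limsup (\<lambda>k. ereal (set_spectral_radius M (op_set_power \<Sigma> k) powr (1 / real k)))"
    and "0 \<le> generalized_spectral_radius M \<Sigma>"
proof -
  define x where "x k = set_spectral_radius M (op_set_power \<Sigma> k) powr (1 / real k)" for k
  note Pk = positive_op_set_power[OF \<Sigma>]
  note lim = joint_spectral_radius_limit[OF \<Sigma>]
  have "limsup (\<lambda>k. ereal (x k)) \<le> limsup (\<lambda>k. ereal (set_norm M (op_set_power \<Sigma> k) powr (1 / real k)))"
    unfolding x_def using set_spectral_radius[OF Pk] by (intro Limsup_mono always_eventually) (auto intro!: powr_mono2)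
  also have "\<dots> = ereal (joint_spectral_radius M \<Sigma>)"
    using lim(1) by (intro lim_imp_Limsup) auto
  finally have "limsup (\<lambda>k. ereal (x k)) \<le> ereal (joint_spectral_radius M \<Sigma>)" .
  moreover have "0 \<le> limsup (\<lambda>k. ereal (x k))"
    by (intro le_Limsup) (auto simp: x_def)
  moreover have "generalized_spectral_radius M \<Sigma> = real_of_ereal (limsup (\<lambda>k. ereal (x k)))"
    by (simp add: generalized_spectral_radius_def x_def set_spectral_radius_def)
  ultimately show "ereal (generalized_spectral_radius M \<Sigma>) = limsup (\<lambda>k. ereal (set_spectral_radius M (op_set_power \<Sigma> k) powr (1 / real k)))"
    and "0 \<le> generalized_spectral_radius M \<Sigma>"
    unfolding x_def by (auto simp: real_of_ereal_pos intro!: ereal_real')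
qed

text \<open>A limsup gives eventual bounds only by numbers strictly above it, so the comparison is
  made with such a \<mu> first.\<close>

lemma generalized_spectral_radius_le_powr:
  assumes \<Sigma>: "positive_op_set M \<Sigma>" and \<Theta>: "positive_op_set M \<Theta>" and e: "0 < e"
    and le: "\<And>k. 1 \<le> k \<Longrightarrow> set_spectral_radius M (op_set_power \<Sigma> k) \<le> set_spectral_radius M (op_set_power \<Theta> k) powr e"
  shows "generalized_spectral_radius M \<Sigma> \<le> generalized_spectral_radius M \<Theta> powr e"
proof -
  let ?g = "generalized_spectral_radius M"
  define x where "x \<Sigma> k = set_spectral_radius M (op_set_power \<Sigma> k) powr (1 / real k)" for \<Sigma> k
  have xle: "x \<Sigma> k \<le> x \<Theta> k powr e" if "1 \<le> k" for k
  proof -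
    have "x \<Sigma> k \<le> (set_spectral_radius M (op_set_power \<Theta> k) powr e) powr (1 / real k)"
      unfolding x_def using le[OF that] set_spectral_radius_nonneg[OF positive_op_set_power[OF \<Sigma>]]
      by (intro powr_mono2) auto
    then show ?thesis
      by (simp add: x_def powr_powr mult.commute)
  qed
  have bound: "?g \<Sigma> \<le> \<mu> powr e" if \<mu>: "?g \<Theta> < \<mu>" for \<mu>
  proof -
    have "limsup (\<lambda>k. ereal (x \<Theta> k)) < ereal \<mu>"
      using \<mu> unfolding x_def generalized_spectral_radius_limsup(1)[OF \<Theta>, symmetric] by simp
    then have "\<forall>\<^sub>F k in sequentially. ereal (x \<Theta> k) < ereal \<mu>"
      by (rule Limsup_lessD)
    then have "\<forall>\<^sub>F k in sequentially. ereal (x \<Sigma> k) \<le> ereal (\<mu> powr e)"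
      using eventually_ge_at_top[of 1]
    proof eventually_elim
      case (elim k)
      have "x \<Sigma> k \<le> x \<Theta> k powr e"
        using elim by (intro xle) auto
      also have "\<dots> \<le> \<mu> powr e"
        using elim e by (intro powr_mono2) (auto simp: x_def)
      finally show ?case
        by simp
    qed
    then have "limsup (\<lambda>k. ereal (x \<Sigma> k)) \<le> ereal (\<mu> powr e)"
      by (rule Limsup_bounded)
    then show ?thesis
      unfolding x_def generalized_spectral_radius_limsup(1)[OF \<Sigma>, symmetric] by simp
  qed
  \<comment> \<open>Let the strict bounds decrease to the radius; \<open>e > 0\<close> makes the
    power continuous even when the radius is 0.\<close>
  have "(\<lambda>n. (?g \<Theta> + 1 / real (Suc n)) powr e) \<longlonglongrightarrow> (?g \<Theta> + 0) powr e"
    using e generalized_spectral_radius_limsup(2)[OF \<Theta>]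
    by (intro tendsto_powr' tendsto_add tendsto_const LIMSEQ_Suc[OF lim_1_over_n]) auto
  then have "?g \<Sigma> \<le> (?g \<Theta> + 0) powr e"
    by (rule LIMSEQ_le_const) (auto intro!: bound)
  then show ?thesis
    by simp
qed

text \<open>D^k belongs to the k-th power of the set, and its spectral radius is the k-th power of
  that of D; so every k-th root in either definition is at least the spectral radius of D.\<close>

lemma op_spectral_radius_le_spectral_radius:
  assumes \<Sigma>: "positive_op_set M \<Sigma>" and D: "D \<in> \<Sigma>"
    and r: "r \<in> {generalized_spectral_radius M, joint_spectral_radius M}"
  shows "op_spectral_radius M D \<le> r \<Sigma>"
proof -
  note Pk = positive_op_set_power[OF \<Sigma>]
  note bD = positive_op_setD(2,3)[OF \<Sigma> D]
  have root: "op_spectral_radius M D \<le> y powr (1 / real k)"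
    if "op_spectral_radius M D ^ k \<le> y" "1 \<le> k" for y k
  proof -
    have "op_spectral_radius M D = (op_spectral_radius M D ^ k) powr (1 / real k)"
      using that op_spectral_radius_limit(2)[OF bD] by (simp add: powr_realpow'[symmetric] powr_powr)
    also have "\<dots> \<le> y powr (1 / real k)"
      using that op_spectral_radius_limit(2)[OF bD] by (intro powr_mono2) auto
    finally show ?thesis .
  qed
  have 1: "op_spectral_radius M D \<le> set_spectral_radius M (op_set_power \<Sigma> k) powr (1 / real k)" if k: "1 \<le> k" for k
    using op_spectral_radius_le_set[OF Pk funpow_in_op_set_power[OF D], of k] op_spectral_radius_funpow[OF bD k] k
    by (intro root) auto
  have 2: "op_spectral_radius M D \<le> set_norm M (op_set_power \<Sigma> k) powr (1 / real k)" if k: "1 \<le> k" for k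
    using order_trans[OF 1[OF k] powr_mono2[OF _ set_spectral_radius_nonneg[OF Pk] set_spectral_radius_le_set_norm[OF Pk]]]
    by simp
  have "op_spectral_radius M D \<le> joint_spectral_radius M \<Sigma>"
    using joint_spectral_radius_limit(1)[OF \<Sigma>] by (rule LIMSEQ_le_const) (use 2 in blast)
  moreover have "ereal (op_spectral_radius M D) \<le> ereal (generalized_spectral_radius M \<Sigma>)"
    unfolding generalized_spectral_radius_limsup(1)[OF \<Sigma>]
    by (intro le_Limsup) (auto simp: eventually_sequentially intro!: exI[of _ 1] 1)
  ultimately show ?thesis
    using r by auto
qed

lemma dominated_op_set_power:
  assumes \<Sigma>: "positive_op_set M \<Sigma>" and \<Theta>: "positive_op_set M \<Theta>"
    and dom: "\<And>A. A \<in> \<Sigma> \<Longrightarrow> \<exists>B\<in>\<Theta>. dominated M A B"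
    and A: "A \<in> op_set_power \<Sigma> k"
  shows "\<exists>B\<in>op_set_power \<Theta> k. dominated M A B"
  using A
proof (induction k arbitrary: A)
  case (Suc k)
  then obtain A1 A2 where A: "A1 \<in> \<Sigma>" "A2 \<in> op_set_power \<Sigma> k" "A = A1 \<circ> A2"
    by (auto simp: op_set_mult_iff)
  obtain B1 B2 where B: "B1 \<in> \<Theta>" "B2 \<in> op_set_power \<Theta> k" "dominated M A1 B1" "dominated M A2 B2"
    using dom[OF A(1)] Suc.IH[OF A(2)] by blast
  have "dominated M A (B1 \<circ> B2)"
    unfolding A(3) using A B positive_op_setD(3) positive_op_set_power[OF \<Sigma>] positive_op_set_power[OF \<Theta>] \<Sigma>
    by (intro dominated_comp) blast+
  then show ?case
    using op_set_multI[OF B(1,2)] by auto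
qed simp

text \<open>Replaces r(\<Sigma>)^m = r(\<Sigma>^m) <= r(\<Theta>). Dominating products exist for
  lengths m * k: the generalized radius reaches these by raising single elements to the m-th power,
  the joint radius by passing to a subsequence.\<close>

lemma spectral_radius_le_root:
  assumes \<Sigma>: "positive_op_set M \<Sigma>" and \<Theta>: "positive_op_set M \<Theta>" and m: "1 \<le> m"
    and dom: "\<And>A. A \<in> op_set_power \<Sigma> m \<Longrightarrow> \<exists>B\<in>\<Theta>. dominated M A B"
    and r: "r \<in> {generalized_spectral_radius M, joint_spectral_radius M}"
  shows "r \<Sigma> \<le> r \<Theta> powr (1 / real m)"
proof -
  note Pk = positive_op_set_power[OF \<Sigma>] positive_op_set_power[OF \<Theta>]
  have dom': "\<exists>B\<in>op_set_power \<Theta> k. dominated M A B" if "A \<in> op_set_power \<Sigma> (m * k)" for A k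
    using dominated_op_set_power[OF Pk(1) \<Theta> dom] that unfolding op_set_power_mult by blast
  have "generalized_spectral_radius M \<Sigma> \<le> generalized_spectral_radius M \<Theta> powr (1 / real m)"
  proof (rule generalized_spectral_radius_le_powr[OF \<Sigma> \<Theta>])
    fix k :: nat assume k: "1 \<le> k"
    show "set_spectral_radius M (op_set_power \<Sigma> k) \<le> set_spectral_radius M (op_set_power \<Theta> k) powr (1 / real m)"
    proof (rule set_spectral_radius_least)
      fix A assume A: "A \<in> op_set_power \<Sigma> k"
      note bA = positive_op_setD(2,3)[OF Pk(1) A]
      have "A ^^ m \<in> op_set_power \<Sigma> (m * k)"
        using funpow_in_op_set_power[OF A, of m] by (simp add: op_set_power_mult[symmetric] mult.commute)
      then obtain B where B: "B \<in> op_set_power \<Theta> k" "dominated M (A ^^ m) B"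
        using dom' by blast
      have "op_spectral_radius M A ^ m = op_spectral_radius M (A ^^ m)"
        by (rule op_spectral_radius_funpow[OF bA m, symmetric])
      also have "\<dots> \<le> op_spectral_radius M B"
        by (intro op_spectral_radius_mono bounded_operator_funpow positive_operator_funpow bA B
            positive_op_setD(2,3)[OF Pk(2) B(1)])
      also have "\<dots> \<le> set_spectral_radius M (op_set_power \<Theta> k)"
        by (rule op_spectral_radius_le_set[OF Pk(2) B(1)])
      finally have "(op_spectral_radius M A ^ m) powr (1 / real m) \<le> set_spectral_radius M (op_set_power \<Theta> k) powr (1 / real m)"
        using op_spectral_radius_limit(2)[OF bA] by (intro powr_mono2) auto
      then show "op_spectral_radius M A \<le> set_spectral_radius M (op_set_power \<Theta> k) powr (1 / real m)"
        using m op_spectral_radius_limit(2)[OF bA] by (simp add: powr_realpow'[symmetric] powr_powr)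
    qed simp
  qed (use m in simp)
  moreover have "joint_spectral_radius M \<Sigma> \<le> joint_spectral_radius M \<Theta> powr (1 / real m)"
  proof -
    note nn = set_norm_nonneg[OF positive_op_setD(1)[OF Pk(1)]] set_norm_nonneg[OF positive_op_setD(1)[OF Pk(2)]]
    have le: "set_norm M (op_set_power \<Sigma> (m * k)) \<le> 4 * set_norm M (op_set_power \<Theta> k)" for k
    proof (rule set_norm_least)
      fix A assume A: "A \<in> op_set_power \<Sigma> (m * k)"
      then obtain B where B: "B \<in> op_set_power \<Theta> k" "dominated M A B"
        using dom' by blast
      have "op_norm M A \<le> 4 * op_norm M B"
        by (intro dominated_op_norm positive_op_setD(3)[OF Pk(1) A] positive_op_setD(2)[OF Pk(2) B(1)] B)
      also have "\<dots> \<le> 4 * set_norm M (op_set_power \<Theta> k)"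
        by (intro mult_left_mono op_norm_le_set_norm positive_op_setD(1)[OF Pk(2)] B) auto
      finally show "op_norm M A \<le> 4 * set_norm M (op_set_power \<Theta> k)" .
    qed (use nn in auto)
    have "strict_mono (\<lambda>k. m * k)"
      using m by (auto simp: strict_mono_def)
    from LIMSEQ_subseq_LIMSEQ[OF joint_spectral_radius_limit(1)[OF \<Sigma>] this]
    have 1: "(\<lambda>k. set_norm M (op_set_power \<Sigma> (m * k)) powr (1 / real (m * k))) \<longlonglongrightarrow> joint_spectral_radius M \<Sigma>"
      by (simp add: o_def)
    have "(\<lambda>k. (4 powr (1 / real k) * set_norm M (op_set_power \<Theta> k) powr (1 / real k)) powr (1 / real m))
        \<longlonglongrightarrow> (4 powr 0 * joint_spectral_radius M \<Theta>) powr (1 / real m)"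
      using m by (intro tendsto_powr' tendsto_mult tendsto_const joint_spectral_radius_limit \<Theta> lim_1_over_n) auto
    then have 2: "(\<lambda>k. (4 powr (1 / real k) * set_norm M (op_set_power \<Theta> k) powr (1 / real k)) powr (1 / real m))
        \<longlonglongrightarrow> joint_spectral_radius M \<Theta> powr (1 / real m)"
      by simp
    show ?thesis
    proof (rule LIMSEQ_le[OF 1 2], intro exI[of _ 0] allI impI)
      fix k :: nat
      have "set_norm M (op_set_power \<Sigma> (m * k)) powr (1 / real (m * k)) \<le> (4 * set_norm M (op_set_power \<Theta> k)) powr (1 / real (m * k))"
        using le nn by (intro powr_mono2) auto
      also have "\<dots> = (4 powr (1 / real k) * set_norm M (op_set_power \<Theta> k) powr (1 / real k)) powr (1 / real m)"
        using nn by (simp add: powr_mult powr_powr mult.commute)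
      finally show "set_norm M (op_set_power \<Sigma> (m * k)) powr (1 / real (m * k))
          \<le> (4 powr (1 / real k) * set_norm M (op_set_power \<Theta> k) powr (1 / real k)) powr (1 / real m)" .
    qed
  qed
  ultimately show ?thesis
    using r by auto
qed

section \<open>Invariance of the radii under exchange of two factors\<close>

lemma set_spectral_radius_power_comm_le:
  assumes \<Phi>: "positive_op_set M \<Phi>" and \<Psi>: "positive_op_set M \<Psi>" and k: "1 \<le> k"
  shows "set_spectral_radius M (op_set_power (op_set_mult \<Phi> \<Psi>) k) \<le> set_spectral_radius M (op_set_power (op_set_mult \<Psi> \<Phi>) k)"
proof -
  obtain l where l: "k = Suc l"
    using k by (cases k) auto
  note P = positive_op_set_power[OF positive_op_set_mult[OF \<Psi> \<Phi>]]
  show ?thesis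
  proof (rule set_spectral_radius_least[OF set_spectral_radius_nonneg[OF P]])
    fix C assume "C \<in> op_set_power (op_set_mult \<Phi> \<Psi>) k"
    then obtain A Y B where C: "A \<in> \<Phi>" "Y \<in> op_set_power (op_set_mult \<Psi> \<Phi>) l" "B \<in> \<Psi>" "C = A \<circ> (Y \<circ> B)"
      unfolding l op_set_power_Suc_comm by (auto simp: op_set_mult_iff)
    note bY = positive_op_setD(2,3)[OF P C(2)] and bA = positive_op_setD(2,3)[OF \<Phi> C(1)] and bB = positive_op_setD(2,3)[OF \<Psi> C(3)]
    \<comment> \<open>Moving the first factor to the end keeps the spectral radius and lands in the
      same power of the swapped product.\<close>
    have "op_spectral_radius M C = op_spectral_radius M ((Y \<circ> B) \<circ> A)"
      unfolding C(4) by (intro op_spectral_radius_comm bounded_operator_comp positive_operator_comp bA bB bY)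
    also have "\<dots> \<le> set_spectral_radius M (op_set_power (op_set_mult \<Psi> \<Phi>) k)"
      unfolding l op_set_power_Suc2 comp_assoc
      by (intro op_spectral_radius_le_set[OF P[of "Suc l", unfolded op_set_power_Suc2]] op_set_multI C)
    finally show "op_spectral_radius M C \<le> set_spectral_radius M (op_set_power (op_set_mult \<Psi> \<Phi>) k)" .
  qed
qed

lemma set_spectral_radius_power_comm:
  assumes "positive_op_set M \<Phi>" "positive_op_set M \<Psi>" "1 \<le> k"
  shows "set_spectral_radius M (op_set_power (op_set_mult \<Phi> \<Psi>) k) = set_spectral_radius M (op_set_power (op_set_mult \<Psi> \<Phi>) k)"
  using set_spectral_radius_power_comm_le[OF assms] set_spectral_radius_power_comm_le[OF assms(2,1,3)] by simp

text \<open>Norms, unlike spectral radii, may change when a factor moves to the end; they are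
  compared with the next lower power up to a constant, and the limits still agree.\<close>

lemma joint_spectral_radius_comm_le:
  assumes \<Phi>: "positive_op_set M \<Phi>" and \<Psi>: "positive_op_set M \<Psi>"
  shows "joint_spectral_radius M (op_set_mult \<Phi> \<Psi>) \<le> joint_spectral_radius M (op_set_mult \<Psi> \<Phi>)"
proof (rule root_limit_shift_le[OF joint_spectral_radius_limit(1) joint_spectral_radius_limit(1)])
  note P = positive_op_set_mult[OF \<Phi> \<Psi>] positive_op_set_mult[OF \<Psi> \<Phi>]
  show "positive_op_set M (op_set_mult \<Phi> \<Psi>)" "positive_op_set M (op_set_mult \<Psi> \<Phi>)"
    by (rule P)+
  show "0 \<le> set_norm M (op_set_power (op_set_mult \<Phi> \<Psi>) n)" "0 \<le> set_norm M (op_set_power (op_set_mult \<Psi> \<Phi>) n)" for n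
    by (intro set_norm_nonneg positive_op_setD(1) positive_op_set_power P)+
  fix n
  note b = positive_op_setD(1)[OF \<Phi>] positive_op_setD(1)[OF \<Psi>] positive_op_setD(1)[OF positive_op_set_power[OF P(2)], of n]
  have "set_norm M (op_set_power (op_set_mult \<Phi> \<Psi>) (Suc n))
      \<le> set_norm M \<Phi> * set_norm M (op_set_mult (op_set_power (op_set_mult \<Psi> \<Phi>) n) \<Psi>)"
    unfolding op_set_power_Suc_comm by (intro bounded_op_set_mult b)
  also have "\<dots> \<le> set_norm M \<Phi> * (set_norm M (op_set_power (op_set_mult \<Psi> \<Phi>) n) * set_norm M \<Psi>)"
    by (intro mult_left_mono bounded_op_set_mult(2) b set_norm_nonneg)
  finally show "set_norm M (op_set_power (op_set_mult \<Phi> \<Psi>) (Suc n))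
      \<le> (set_norm M \<Phi> * set_norm M \<Psi>) * set_norm M (op_set_power (op_set_mult \<Psi> \<Phi>) n)"
    by (simp add: mult_ac)
qed

lemma joint_spectral_radius_comm:
  assumes "positive_op_set M \<Phi>" "positive_op_set M \<Psi>"
  shows "joint_spectral_radius M (op_set_mult \<Phi> \<Psi>) = joint_spectral_radius M (op_set_mult \<Psi> \<Phi>)"
  using joint_spectral_radius_comm_le[OF assms] joint_spectral_radius_comm_le[OF assms(2,1)] by simp

subsection \<open>Nonnegative kernels\<close>

lemma complex_integral_nonneg:
  fixes u :: "'a \<Rightarrow> complex"
  assumes "AE x in M. 0 \<le> u x"
  shows "0 \<le> (LINT x|M. u x)"
proof (cases "integrable M u")
  case True
  have "AE x in M. 0 \<le> Re (u x)" "AE x in M. Im (u x) = 0"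
    using assms by (eventually_elim; simp add: less_eq_complex_def)+
  then have "0 \<le> (LINT x|M. Re (u x))" "(LINT x|M. Im (u x)) = 0"
    by (auto intro!: integral_nonneg_AE integral_eq_zero_AE)
  then show ?thesis
    using True by (simp add: less_eq_complex_def)
qed (simp add: not_integrable_integral_eq)

lemma complex_integral_mono:
  fixes u v :: "'a \<Rightarrow> complex"
  assumes "integrable M u" "integrable M v" "AE x in M. u x \<le> v x"
  shows "(LINT x|M. u x) \<le> (LINT x|M. v x)"
  using complex_integral_nonneg[where M = M and u = "\<lambda>x. v x - u x"] assms by simp

text \<open>AM-GM when \<alpha> is the reciprocal of the number of factors. A larger exponent
  decreases powers of numbers in [0, 1], whence the bound by 1 in that alternative.\<close>

lemma prod_powr_le_mean:
  fixes v :: "'i \<Rightarrow> real"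
  assumes J: "finite J" "J \<noteq> {}" and v: "\<And>j. j \<in> J \<Longrightarrow> 0 \<le> v j"
    and \<alpha>: "\<alpha> = 1 / card J \<or> 1 / card J \<le> \<alpha> \<and> (\<forall>j\<in>J. v j \<le> 1)"
  shows "(\<Prod>j\<in>J. v j powr \<alpha>) \<le> (\<Sum>j\<in>J. v j / card J)"
proof -
  have le: "v j powr \<alpha> \<le> v j powr (1 / card J)" if "j \<in> J" for j
    using \<alpha> v[OF that] that powr_mono'[of "1 / card J" \<alpha> "v j"] by (cases "v j = 0") auto
  have "(\<Prod>j\<in>J. v j powr \<alpha>) \<le> (\<Prod>j\<in>J. v j powr (1 / card J))"
    using le by (intro prod_mono) auto
  also have "\<dots> = (\<Prod>j\<in>J. v j) powr (1 / card J)"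
    using v by (simp add: prod_powr_distrib)
  also have "\<dots> \<le> (\<Sum>j\<in>J. v j / card J)"
    by (rule arith_geom_mean[OF J v])
  finally show ?thesis .
qed

lemma integral_count_space_ge_point:
  assumes u: "integrable (count_space R) u" "\<And>x. x \<in> R \<Longrightarrow> 0 \<le> u x" and x: "x \<in> R"
  shows "u x \<le> (LINT x|count_space R. u x :: real)"
proof -
  have "ennreal (u x) \<le> (\<integral>\<^sup>+x. ennreal (u x) \<partial>count_space R)"
    using x by (rule nn_integral_ge_point)
  also have "\<dots> = ennreal (LINT x|count_space R. u x)"
    using u by (intro nn_integral_eq_integral) (auto simp: AE_count_space)
  finally show ?thesis
    using u by (simp add: integral_nonneg_AE AE_count_space)
qed

text \<open>The two alternatives are the exponents of parts (i) and (ii). An exponent above \<open>1 / m\<close> needs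
  counting measure.\<close>

definition hadamard_exponent :: "'a measure \<Rightarrow> nat \<Rightarrow> real \<Rightarrow> bool" where
  "hadamard_exponent M m \<alpha> \<longleftrightarrow> 1 \<le> m \<and> (\<alpha> = 1 / real m \<or> 1 / real m \<le> \<alpha> \<and> (\<exists>R. M = count_space R))"

lemma hadamard_exponent_pos: "hadamard_exponent M m \<alpha> \<Longrightarrow> 0 < \<alpha>"
  unfolding hadamard_exponent_def using less_le_trans[of 0 "1 / real m" \<alpha>] by auto

text \<open>Dividing each function by its integral and applying \<open>prod_powr_le_mean\<close>
  pointwise leaves a right-hand side that integrates to m terms 1 / m.\<close>

lemma Hoelder_integral_prod_powr:
  fixes u :: "nat \<Rightarrow> 'a \<Rightarrow> real"
  assumes \<alpha>: "hadamard_exponent M m \<alpha>"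
    and u: "\<And>j. j \<in> {1..m} \<Longrightarrow> integrable M (u j)" "\<And>j x. j \<in> {1..m} \<Longrightarrow> x \<in> space M \<Longrightarrow> 0 \<le> u j x"
  shows "(LINT x|M. (\<Prod>j\<in>{1..m}. u j x powr \<alpha>)) \<le> (\<Prod>j\<in>{1..m}. (LINT x|M. u j x) powr \<alpha>)"
proof -
  define I where "I j = (LINT x|M. u j x)" for j
  have I0: "0 \<le> I j" if "j \<in> {1..m}" for j
    unfolding I_def using u(2)[OF that] by (intro integral_nonneg_AE) auto
  have a0: "0 < \<alpha>"
    by (rule hadamard_exponent_pos[OF \<alpha>])
  show ?thesis
  proof (cases "\<exists>j\<in>{1..m}. I j = 0")
    \<comment> \<open>A vanishing integral rules out normalisation, but then the whole product
      vanishes almost everywhere.\<close>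
    case True
    then obtain j where j: "j \<in> {1..m}" "I j = 0"
      by blast
    have "AE x in M. u j x = 0"
      using integral_nonneg_eq_0_iff_AE[of M "u j"] u j by (auto simp: I_def)
    then have "AE x in M. (\<Prod>j\<in>{1..m}. u j x powr \<alpha>) = 0"
      by eventually_elim (use j in \<open>auto intro!: prod_zero\<close>)
    then have "(LINT x|M. (\<Prod>j\<in>{1..m}. u j x powr \<alpha>)) = 0"
      by (rule integral_eq_zero_AE)
    then show ?thesis
      by (simp add: prod_nonneg)
  next
    case False
    then have Ip: "0 < I j" if "j \<in> {1..m}" for j
      using I0[OF that] that by force
    define P where "P = (\<Prod>j\<in>{1..m}. I j powr \<alpha>)"
    have P0: "0 \<le> P"
      unfolding P_def by (intro prod_nonneg) auto
    have m: "real m > 0" "{1..m} \<noteq> {}" "card {1..m} = m"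
      using \<alpha> by (auto simp: hadamard_exponent_def)
    have pt: "(\<Prod>j\<in>{1..m}. u j x powr \<alpha>) \<le> P * (\<Sum>j\<in>{1..m}. u j x / I j / m)" if x: "x \<in> space M" for x
    proof -
      have "(\<Prod>j\<in>{1..m}. (u j x / I j) powr \<alpha>) \<le> (\<Sum>j\<in>{1..m}. u j x / I j / card {1..m})"
      proof (rule prod_powr_le_mean)
        show "0 \<le> u j x / I j" if "j \<in> {1..m}" for j
          using u(2)[OF that x] Ip[OF that] by simp
        show "\<alpha> = 1 / card {1..m} \<or> 1 / card {1..m} \<le> \<alpha> \<and> (\<forall>j\<in>{1..m}. u j x / I j \<le> 1)"
        proof (cases "\<alpha> = 1 / m")
          case False
          then obtain R where R: "M = count_space R" "1 / m \<le> \<alpha>"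
            using \<alpha> by (auto simp: hadamard_exponent_def)
          \<comment> \<open>Points have mass 1, so a nonnegative function stays below its integral
            and the normalised values are at most 1.\<close>
          have "u j x \<le> I j" if "j \<in> {1..m}" for j
            unfolding I_def R(1) using u[OF that] x unfolding R(1)
            by (intro integral_count_space_ge_point) auto
          then show ?thesis
            using R m Ip by (auto simp: divide_le_eq)
        qed simp
      qed (use m in auto)
      moreover have "(\<Prod>j\<in>{1..m}. (u j x / I j) powr \<alpha>) = (\<Prod>j\<in>{1..m}. u j x powr \<alpha>) / P"
        unfolding P_def prod_dividef[symmetric] using u(2)[OF _ x] I0 by (intro prod.cong) (auto simp: powr_divide)
      moreover have "0 < P"
        unfolding P_def using Ip by (intro prod_pos) (metis powr_gt_zero less_irrefl)
      ultimately show ?thesis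
        by (simp add: divide_le_eq mult.commute)
    qed
    have "(LINT x|M. (\<Prod>j\<in>{1..m}. u j x powr \<alpha>)) \<le> (LINT x|M. P * (\<Sum>j\<in>{1..m}. u j x / I j / m))"
      using u pt by (intro integral_mono') (auto intro!: mult_nonneg_nonneg P0 sum_nonneg I0 divide_nonneg_nonneg prod_nonneg)
    also have "\<dots> = P * (LINT x|M. (\<Sum>j\<in>{1..m}. u j x / I j / m))"
      by (rule integral_mult_right_zero)
    also have "(LINT x|M. (\<Sum>j\<in>{1..m}. u j x / I j / m)) = (\<Sum>j\<in>{1..m}. LINT x|M. u j x / I j / m)"
      using u by (intro Bochner_Integration.integral_sum integrable_divide) auto
    also have "\<dots> = (\<Sum>j\<in>{1..m}. 1 / m)"
    proof (intro sum.cong refl)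
      fix j assume j: "j \<in> {1..m}"
      show "(LINT x|M. u j x / I j / m) = 1 / m"
        using Ip[OF j] by (simp flip: I_def)
    qed
    also have "P * \<dots> = P"
      using m by simp
    finally show ?thesis
      by (simp add: P_def I_def)
  qed
qed

section \<open>Kernel operators and kernels below linear combinations of kernels\<close>

definition kernel_oper :: "'a measure \<Rightarrow> ('a \<Rightarrow> 'a \<Rightarrow> real) \<Rightarrow> 'a oper" where
  "kernel_oper M c f x = (LINT y|M. complex_of_real (c x y) * f y)"

lemma has_nonneg_kernelD:
  assumes "has_nonneg_kernel M A a"
  shows "linear_operator M A"
    and "x \<in> space M \<Longrightarrow> y \<in> space M \<Longrightarrow> 0 \<le> a x y"
    and "case_prod a \<in> borel_measurable (M \<Otimes>\<^sub>M M)"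
    and "f \<in> L2 M \<Longrightarrow> AE x in M. integrable M (\<lambda>y. complex_of_real (a x y) * f y)"
    and "f \<in> L2 M \<Longrightarrow> AE x in M. A f x = (LINT y|M. complex_of_real (a x y) * f y)"
proof -
  note * = assms[unfolded has_nonneg_kernel_def has_kernel_def]
  show "linear_operator M A" "x \<in> space M \<Longrightarrow> y \<in> space M \<Longrightarrow> 0 \<le> a x y"
    using * by auto
  have "(\<lambda>p. Re (case p of (x, y) \<Rightarrow> complex_of_real (a x y))) \<in> borel_measurable (M \<Otimes>\<^sub>M M)"
    using * borel_measurable_complex_iff by blast
  then show "case_prod a \<in> borel_measurable (M \<Otimes>\<^sub>M M)"
    by (simp add: case_prod_unfold)
  show "AE x in M. integrable M (\<lambda>y. complex_of_real (a x y) * f y)"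
    "AE x in M. A f x = (LINT y|M. complex_of_real (a x y) * f y)" if "f \<in> L2 M"
    using * that by auto
qed

lemma has_nonneg_kernel_positive:
  assumes "has_nonneg_kernel M A a"
  shows "positive_operator M A"
  unfolding positive_operator_def nonneg_Reals_complex_iff
proof (intro conjI ballI impI)
  note D = has_nonneg_kernelD[OF assms]
  show "linear_operator M A"
    by (rule D)
  fix f assume f: "f \<in> L2 M" "AE x in M. 0 \<le> f x"
  show "AE x in M. 0 \<le> A f x"
    using D(5)[OF f(1)] AE_space
  proof eventually_elim
    case (elim x)
    have "AE y in M. 0 \<le> complex_of_real (a x y) * f y"
      using f(2) AE_space by eventually_elim (use D(2)[of x] elim in \<open>auto simp: less_eq_complex_def\<close>)
    then show ?case
      unfolding elim by (rule complex_integral_nonneg)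
  qed
qed

context sigma_finite_measure
begin

lemma kernel_oper_has_nonneg_kernel:
  assumes c: "case_prod c \<in> borel_measurable (M \<Otimes>\<^sub>M M)" "\<And>x y. x \<in> space M \<Longrightarrow> y \<in> space M \<Longrightarrow> 0 \<le> c x y"
    and int: "\<And>f. f \<in> L2 M \<Longrightarrow> AE x in M. integrable M (\<lambda>y. complex_of_real (c x y) * f y)"
    and L2: "\<And>f. f \<in> L2 M \<Longrightarrow> kernel_oper M c f \<in> L2 M"
  shows "has_nonneg_kernel M (kernel_oper M c) c"
proof -
  have "linear_operator M (kernel_oper M c)"
    unfolding linear_operator_def
  proof (intro conjI ballI allI impI L2)
    fix f assume f: "f \<in> L2 M"
    show "AE x in M. kernel_oper M c (\<lambda>y. b * f y) x = b * kernel_oper M c f x" for b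
      using int[OF f] by eventually_elim (simp add: kernel_oper_def mult.left_commute[of _ b])
    fix g assume g: "g \<in> L2 M"
    show "AE x in M. kernel_oper M c f x = kernel_oper M c g x" if "AE x in M. f x = g x"
      using AE_space
    proof eventually_elim
      case (elim x)
      note [measurable] = c(1) L2_measurable[OF f] L2_measurable[OF g]
      show ?case
        unfolding kernel_oper_def using that elim by (intro integral_cong_AE) auto
    qed
    show "AE x in M. kernel_oper M c (\<lambda>y. f y + g y) x = kernel_oper M c f x + kernel_oper M c g x"
      using int[OF f] int[OF g] by eventually_elim (simp add: kernel_oper_def ring_distribs)
  qed
  moreover have "(\<lambda>(x, y). complex_of_real (c x y)) \<in> borel_measurable (M \<Otimes>\<^sub>M M)"
    using measurable_compose[OF c(1) borel_measurable_of_real[where 'a = complex]] by (simp add: case_prod_unfold)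
  ultimately show ?thesis
    using c int unfolding has_nonneg_kernel_def has_kernel_def by (auto simp: kernel_oper_def)
qed

text \<open>Once the modulus is inside the integral, \<open>c\<close> may be replaced by the larger
  combination, whose integrals against the modulus of \<open>f\<close> are the known values of the
  \<open>E j\<close>.\<close>

lemma kernel_dominated_bound:
  assumes J: "finite J" and E: "\<And>j. j \<in> J \<Longrightarrow> has_nonneg_kernel M (E j) (e j)"
    and w: "\<And>j. j \<in> J \<Longrightarrow> 0 \<le> w j"
    and c: "case_prod c \<in> borel_measurable (M \<Otimes>\<^sub>M M)" "\<And>x y. x \<in> space M \<Longrightarrow> y \<in> space M \<Longrightarrow> 0 \<le> c x y"
      "\<And>x y. x \<in> space M \<Longrightarrow> y \<in> space M \<Longrightarrow> c x y \<le> (\<Sum>j\<in>J. w j * e j x y)"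
    and f: "f \<in> L2 M"
  shows "AE x in M. integrable M (\<lambda>y. complex_of_real (c x y) * f y)"
    and "AE x in M. cmod (kernel_oper M c f x)
      \<le> cmod (\<Sum>j\<in>J. complex_of_real (w j) * E j (\<lambda>y. complex_of_real (cmod (f y))) x)"
proof -
  let ?F = "\<lambda>y. complex_of_real (cmod (f y))"
  note D = has_nonneg_kernelD[OF E]
  note [measurable] = c(1) L2_measurable[OF f]
  have F: "?F \<in> L2 M"
    by (rule L2_cmod[OF f])
  have ae: "AE x in M. \<forall>j\<in>J. integrable M (\<lambda>y. complex_of_real (e j x y) * ?F y)
      \<and> E j ?F x = (LINT y|M. complex_of_real (e j x y) * ?F y)"
    using J D(4)[OF _ F] D(5)[OF _ F] by (auto intro!: AE_finite_allI)
  have key: "integrable M (\<lambda>y. complex_of_real (c x y) * f y) \<and> cmod (kernel_oper M c f x)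
      \<le> cmod (\<Sum>j\<in>J. complex_of_real (w j) * E j ?F x)"
    if x: "x \<in> space M" and *: "\<forall>j\<in>J. integrable M (\<lambda>y. complex_of_real (e j x y) * ?F y)
      \<and> E j ?F x = (LINT y|M. complex_of_real (e j x y) * ?F y)" for x
  proof -
    have ej: "integrable M (\<lambda>y. e j x y * cmod (f y))"
      "E j ?F x = complex_of_real (LINT y|M. e j x y * cmod (f y))" if "j \<in> J" for j
      using bspec[OF * that] unfolding of_real_mult[symmetric]
      by (auto simp only: complex_of_real_integrable_eq integral_complex_of_real)
    have bnd: "integrable M (\<lambda>y. \<Sum>j\<in>J. w j * (e j x y * cmod (f y)))"
      using ej by (intro Bochner_Integration.integrable_sum integrable_mult_right) auto
    have le: "cmod (complex_of_real (c x y) * f y) \<le> (\<Sum>j\<in>J. w j * (e j x y * cmod (f y)))" if "y \<in> space M" for y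
      using mult_right_mono[OF c(3)[OF x that], of "cmod (f y)"] c(2)[OF x that]
      by (simp add: norm_mult sum_distrib_right mult.assoc)
    have int: "integrable M (\<lambda>y. complex_of_real (c x y) * f y)"
      using x le by (intro Bochner_Integration.integrable_bound[OF bnd]) (auto intro!: AE_I2 order_trans[OF le])
    have "cmod (kernel_oper M c f x) \<le> (LINT y|M. cmod (complex_of_real (c x y) * f y))"
      unfolding kernel_oper_def by (rule integral_norm_bound)
    also have "\<dots> \<le> (LINT y|M. (\<Sum>j\<in>J. w j * (e j x y * cmod (f y))))"
      using int bnd le by (intro integral_mono) auto
    also have "\<dots> = (\<Sum>j\<in>J. w j * (LINT y|M. e j x y * cmod (f y)))"
      using ej by (subst Bochner_Integration.integral_sum) auto
    also have "\<dots> \<le> \<bar>(\<Sum>j\<in>J. w j * (LINT y|M. e j x y * cmod (f y)))\<bar>"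
      by simp
    also have "\<dots> = cmod (\<Sum>j\<in>J. complex_of_real (w j) * E j ?F x)"
      unfolding norm_of_real[symmetric, where ?'a = complex] using ej by simp
    finally show ?thesis
      using int by simp
  qed
  show "AE x in M. integrable M (\<lambda>y. complex_of_real (c x y) * f y)"
    "AE x in M. cmod (kernel_oper M c f x) \<le> cmod (\<Sum>j\<in>J. complex_of_real (w j) * E j ?F x)"
    using ae AE_space by (eventually_elim; use key in blast)+
qed

lemma kernel_oper_measurable:
  assumes [measurable]: "case_prod c \<in> borel_measurable (M \<Otimes>\<^sub>M M)" "f \<in> borel_measurable M"
  shows "kernel_oper M c f \<in> borel_measurable M"
  unfolding kernel_oper_def[abs_def] by measurable

text \<open>The way in which a kernel that is nonlinear in the \<open>e j\<close>, such as a
  Hadamard mean, yields an operator at all. The norm bound is stated for every \<open>C\<close> with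
  this kernel, since sets of operators may contain any representative.\<close>

lemma kernel_dominated:
  assumes J: "finite J" and E: "\<And>j. j \<in> J \<Longrightarrow> has_nonneg_kernel M (E j) (e j)"
    and w: "\<And>j. j \<in> J \<Longrightarrow> 0 \<le> w j"
    and c: "case_prod c \<in> borel_measurable (M \<Otimes>\<^sub>M M)" "\<And>x y. x \<in> space M \<Longrightarrow> y \<in> space M \<Longrightarrow> 0 \<le> c x y"
      "\<And>x y. x \<in> space M \<Longrightarrow> y \<in> space M \<Longrightarrow> c x y \<le> (\<Sum>j\<in>J. w j * e j x y)"
  shows "has_nonneg_kernel M (kernel_oper M c) c"
    and "has_nonneg_kernel M C c \<Longrightarrow> (\<And>j. j \<in> J \<Longrightarrow> bounded_operator M (E j)) \<Longrightarrow>
      bounded_operator M C \<and> op_norm M C \<le> (\<Sum>j\<in>J. w j * op_norm M (E j))"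
proof -
  let ?F = "\<lambda>f x. complex_of_real (cmod (f x))"
  let ?S = "\<lambda>f x. \<Sum>j\<in>J. complex_of_real (w j) * E j (?F f) x"
  note b = kernel_dominated_bound[OF J E w c]
  have SL: "?S f \<in> L2 M" if "f \<in> L2 M" for f
    by (intro L2_sum(1) L2_scale(1) linear_operator_L2[OF has_nonneg_kernelD(1)[OF E]] L2_cmod(1) that)
  have KL: "kernel_oper M c f \<in> L2 M" "L2_norm M (kernel_oper M c f) \<le> L2_norm M (?S f)" if "f \<in> L2 M" for f
    using that by (auto intro!: L2_bound[OF SL kernel_oper_measurable[OF c(1) L2_measurable] b(2)])
  show "has_nonneg_kernel M (kernel_oper M c) c"
    by (rule kernel_oper_has_nonneg_kernel[OF c(1,2) b(1) KL(1)])
  assume C: "has_nonneg_kernel M C c" and bE: "\<And>j. j \<in> J \<Longrightarrow> bounded_operator M (E j)"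
  have *: "L2_norm M (C f) \<le> (\<Sum>j\<in>J. w j * op_norm M (E j)) * L2_norm M f" if f: "f \<in> L2 M" for f
  proof -
    have "AE x in M. C f x = kernel_oper M c f x"
      using has_nonneg_kernelD(5)[OF C f] by (simp add: kernel_oper_def)
    then have "L2_norm M (C f) = L2_norm M (kernel_oper M c f)"
      using L2_norm_cong_AE(2)[OF KL(1)] f L2_measurable[OF linear_operator_L2[OF has_nonneg_kernelD(1)[OF C] f]] by blast
    also have "\<dots> \<le> L2_norm M (?S f)"
      by (rule KL(2)[OF f])
    also have "\<dots> \<le> (\<Sum>j\<in>J. L2_norm M (\<lambda>x. complex_of_real (w j) * E j (?F f) x))"
      by (intro L2_sum(2) L2_scale(1) linear_operator_L2[OF has_nonneg_kernelD(1)[OF E]] L2_cmod(1) f)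
    also have "\<dots> \<le> (\<Sum>j\<in>J. w j * (op_norm M (E j) * L2_norm M f))"
    proof (rule sum_mono)
      fix j assume j: "j \<in> J"
      have "L2_norm M (\<lambda>x. complex_of_real (w j) * E j (?F f) x) = w j * L2_norm M (E j (?F f))"
        using w[OF j] by (subst L2_scale(2)) (auto intro!: linear_operator_L2[OF has_nonneg_kernelD(1)[OF E[OF j]]] L2_cmod(1) f)
      also have "\<dots> \<le> w j * (op_norm M (E j) * L2_norm M (?F f))"
        by (intro mult_left_mono op_norm_bound bE j w L2_cmod(1) f)
      finally show "L2_norm M (\<lambda>x. complex_of_real (w j) * E j (?F f) x) \<le> w j * (op_norm M (E j) * L2_norm M f)"
        by (simp add: L2_cmod(2)[OF f])
    qed
    finally show ?thesis
      by (simp add: sum_distrib_right mult.assoc)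
  qed
  show "bounded_operator M C \<and> op_norm M C \<le> (\<Sum>j\<in>J. w j * op_norm M (E j))"
    using * bE w by (auto intro!: bounded_operatorI[OF has_nonneg_kernelD(1)[OF C]] op_norm_least sum_nonneg op_norm_nonneg mult_nonneg_nonneg)
qed

end

subsection \<open>Products, Hadamard means and adjoints of kernel operators\<close>

lemma borel_measurable_cnj [measurable (raw)]:
  "f \<in> borel_measurable M \<Longrightarrow> (\<lambda>x. cnj (f x)) \<in> borel_measurable M"
  by (rule measurable_compose[OF _ borel_measurable_continuous_onI]) (auto intro: continuous_intros)

lemma complex_of_real_mono: "a \<le> b \<Longrightarrow> complex_of_real a \<le> complex_of_real b"
  by (simp add: less_eq_complex_def)

context sigma_finite_measure
begin

text \<open>Fubini for almost every fixed x. The integral defining \<open>c x y\<close> may diverge,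
  with default value 0, at points y that \<open>f\<close> does not see; the third conjunct records
  where it converges, as Hoelder's inequality requires.\<close>

lemma kernel_comp_aux:
  assumes A: "has_nonneg_kernel M A a" and B: "has_nonneg_kernel M B b" and f: "f \<in> L2 M"
  defines "c \<equiv> \<lambda>x y. LINT z|M. a x z * b z y"
  shows "AE x in M. integrable M (\<lambda>y. complex_of_real (c x y) * f y) \<and>
      A (B f) x = (LINT y|M. complex_of_real (c x y) * f y) \<and>
      (AE y in M. f y \<noteq> 0 \<longrightarrow> integrable M (\<lambda>z. a x z * b z y))"
proof -
  interpret pair: pair_sigma_finite M M ..
  note DA = has_nonneg_kernelD[OF A] and DB = has_nonneg_kernelD[OF B]
  note [measurable] = DA(3) DB(3) L2_measurable[OF f]
  let ?F = "\<lambda>y. complex_of_real (cmod (f y))"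
  have F: "?F \<in> L2 M"
    by (rule L2_cmod[OF f])
  note BL = linear_operator_L2[OF DB(1)]
  have Bf: "AE z in M. integrable M (\<lambda>y. complex_of_real (b z y) * f y) \<and> B f z = (LINT y|M. complex_of_real (b z y) * f y)
      \<and> B ?F z = (LINT y|M. complex_of_real (b z y) * ?F y)"
    using DB(4)[OF f] DB(5)[OF f] DB(5)[OF F] by eventually_elim simp
  show ?thesis
    using DA(4)[OF BL[OF F]] DA(5)[OF BL[OF f]] AE_space
  proof eventually_elim
    case (elim x)
    define J where "J z y = complex_of_real (a x z) * (complex_of_real (b z y) * f y)" for z y
    have [measurable]: "a x \<in> borel_measurable M"
      using elim(3) by measurable
    have Jm: "case_prod J \<in> borel_measurable (M \<Otimes>\<^sub>M M)"
      unfolding J_def by measurable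
    have Jint: "integrable (M \<Otimes>\<^sub>M M) (case_prod J)"
    proof (rule pair.Fubini_integrable[OF Jm])
      \<comment> \<open>Integrating out y leaves the kernel of \<open>A\<close> times
        \<open>B\<close> applied to the modulus of \<open>f\<close>, which is integrable in z
        because \<open>A\<close> acts on \<open>B ?F\<close>.\<close>
      have "AE z in M. (LINT y|M. cmod (case_prod J (z, y))) = cmod (complex_of_real (a x z) * B ?F z)"
        using Bf AE_space
      proof eventually_elim
        case (elim z)
        have "B ?F z = complex_of_real (LINT y|M. b z y * cmod (f y))"
          using elim(1) by (simp flip: of_real_mult)
        moreover have "(LINT y|M. cmod (complex_of_real (b z y) * f y)) = (LINT y|M. b z y * cmod (f y))"
          using DB(2) elim(2) by (intro Bochner_Integration.integral_cong) (auto simp: norm_mult)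
        moreover have "0 \<le> (LINT y|M. cmod (complex_of_real (b z y) * f y))"
          by (intro integral_nonneg_AE) auto
        ultimately have "(LINT y|M. cmod (complex_of_real (b z y) * f y)) = cmod (B ?F z)"
          by simp
        then show ?case
          unfolding J_def case_prod_conv norm_mult[of "complex_of_real (a x z)"] by simp
      qed
      moreover have "integrable M (\<lambda>z. cmod (complex_of_real (a x z) * B ?F z))"
        using elim(1) by (rule integrable_norm)
      moreover have "(\<lambda>z. LINT y|M. cmod (case_prod J (z, y))) \<in> borel_measurable M"
        using Jm by measurable
      ultimately show "integrable M (\<lambda>z. LINT y|M. cmod (case_prod J (z, y)))"
        by (subst integrable_cong_AE) (auto intro: borel_measurable_integrable)
      show "AE z in M. integrable M (\<lambda>y. case_prod J (z, y))"
        using Bf by eventually_elim (simp add: J_def)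
    qed
    have Jz: "(LINT z|M. J z y) = complex_of_real (c x y) * f y" for y
    proof -
      have "(LINT z|M. J z y) = (LINT z|M. complex_of_real (a x z * b z y) * f y)"
        by (simp add: J_def mult.assoc)
      also have "\<dots> = (LINT z|M. complex_of_real (a x z * b z y)) * f y"
        by (rule integral_mult_left_zero)
      finally show ?thesis
        by (simp only: c_def integral_complex_of_real)
    qed
    have "A (B f) x = (LINT z|M. complex_of_real (a x z) * B f z)"
      by (rule elim(2))
    also have "\<dots> = (LINT z|M. LINT y|M. J z y)"
    proof (rule integral_cong_AE)
      show "(\<lambda>z. complex_of_real (a x z) * B f z) \<in> borel_measurable M"
        using L2_measurable[OF BL[OF f]] by measurable
      show "(\<lambda>z. LINT y|M. J z y) \<in> borel_measurable M"
        using Jm by measurable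
      show "AE z in M. complex_of_real (a x z) * B f z = (LINT y|M. J z y)"
        using Bf by eventually_elim (simp add: J_def)
    qed
    also have "\<dots> = (LINT y|M. LINT z|M. J z y)"
      by (rule pair.Fubini_integral[OF Jint, symmetric])
    finally have 1: "A (B f) x = (LINT y|M. complex_of_real (c x y) * f y)"
      unfolding Jz .
    have 2: "integrable M (\<lambda>y. complex_of_real (c x y) * f y)"
      using pair.integrable_snd[OF Jint] unfolding Jz .
    have 3: "AE y in M. f y \<noteq> 0 \<longrightarrow> integrable M (\<lambda>z. a x z * b z y)"
      using pair.AE_integrable_snd[OF Jint]
    proof eventually_elim
      case (elim y)
      have "integrable M (\<lambda>z. complex_of_real (a x z * b z y) * f y)"
        using elim by (simp add: J_def mult.assoc)
      then have "integrable M (\<lambda>z. complex_of_real (a x z * b z y) * f y * inverse (f y))"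
        by (rule integrable_mult_left)
      then show ?case
        by (cases "f y = 0") (simp_all only: mult.assoc right_inverse mult_1_right complex_of_real_integrable_eq not_True_eq_False not_False_eq_True simp_thms)
    qed
    from 1 2 3 show ?case
      by blast
  qed
qed

lemma has_nonneg_kernel_comp:
  assumes A: "has_nonneg_kernel M A a" and B: "has_nonneg_kernel M B b"
  shows "has_nonneg_kernel M (A \<circ> B) (\<lambda>x y. LINT z|M. a x z * b z y)"
  unfolding has_nonneg_kernel_def has_kernel_def
proof (intro conjI ballI)
  note DA = has_nonneg_kernelD[OF A] and DB = has_nonneg_kernelD[OF B]
  note [measurable] = DA(3) DB(3)
  show "linear_operator M (A \<circ> B)"
    by (rule linear_operator_comp[OF DA(1) DB(1)])
  show "(\<lambda>(x, y). complex_of_real (LINT z|M. a x z * b z y)) \<in> borel_measurable (M \<Otimes>\<^sub>M M)"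
    by measurable
  show "0 \<le> (LINT z|M. a x z * b z y)" if "x \<in> space M" "y \<in> space M" for x y
    using DA(2) DB(2) that by (intro integral_nonneg_AE) auto
  show "AE x in M. integrable M (\<lambda>y. (case (x, y) of (x, y) \<Rightarrow> complex_of_real (LINT z|M. a x z * b z y)) * f y) \<and>
      (A \<circ> B) f x = (LINT y|M. (case (x, y) of (x, y) \<Rightarrow> complex_of_real (LINT z|M. a x z * b z y)) * f y)"
    if "f \<in> L2 M" for f
    using kernel_comp_aux[OF A B that] by eventually_elim simp
qed

lemma hadamard_kernel_measurable:
  fixes \<alpha> :: real
  assumes "\<And>j. j \<in> J \<Longrightarrow> case_prod (e j) \<in> borel_measurable (M \<Otimes>\<^sub>M M)"
  shows "(\<lambda>(x, y). \<Prod>j\<in>J. e j x y powr \<alpha>) \<in> borel_measurable (M \<Otimes>\<^sub>M M)"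
proof -
  have "(\<lambda>p. (case_prod (e j) p) powr \<alpha>) \<in> borel_measurable (M \<Otimes>\<^sub>M M)" if "j \<in> J" for j
  proof (rule measurable_compose[OF assms[OF that]])
    show "(\<lambda>t. t powr \<alpha>) \<in> borel_measurable borel"
      unfolding powr_def by measurable
  qed
  then have "(\<lambda>p. \<Prod>j\<in>J. (case_prod (e j) p) powr \<alpha>) \<in> borel_measurable (M \<Otimes>\<^sub>M M)"
    by (rule borel_measurable_prod)
  then show ?thesis
    by (simp add: case_prod_unfold)
qed

text \<open>The entry is coordinate x of the image of the unit vector at y. It bounds the entries
  normalised by the norm, as exponents above 1 / m demand.\<close>

lemma kernel_le_op_norm_count_space:
  assumes M: "M = count_space R" and E: "has_nonneg_kernel M E e" "bounded_operator M E"
    and x: "x \<in> space M" and y: "y \<in> space M"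
  shows "e x y \<le> op_norm M E"
proof -
  define d where "d t = (if t = y then 1 else 0 :: complex)" for t
  have d2: "(cmod (d t))\<^sup>2 = indicator {y} t" for t
    by (simp add: d_def indicator_def)
  have "integrable M (\<lambda>t. (cmod (d t))\<^sup>2)" "(LINT t|M. (cmod (d t))\<^sup>2) = 1"
    unfolding d2 using y by (auto simp: M emeasure_count_space measure_def intro!: integrable_real_indicator)
  then have d: "d \<in> L2 M" "L2_norm M d = 1"
    by (auto simp: L2_def L2_norm_def M)
  note L = linear_operator_L2[OF has_nonneg_kernelD(1)[OF E(1)] d(1)]
  have "E d x = (LINT t|M. complex_of_real (e x t) * d t)"
    using has_nonneg_kernelD(5)[OF E(1) d(1)] x unfolding M by (simp add: AE_count_space)
  also have "\<dots> = (LINT t|M. indicator {y} t *\<^sub>R complex_of_real (e x y))"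
    by (intro Bochner_Integration.integral_cong) (auto simp: d_def indicator_def)
  also have "\<dots> = complex_of_real (e x y)"
    using y unfolding M by simp
  finally have Ex: "E d x = complex_of_real (e x y)" .
  have "(cmod (E d x))\<^sup>2 \<le> (LINT t|M. (cmod (E d t))\<^sup>2)"
    using L2_integrable[OF L] x unfolding M by (intro integral_count_space_ge_point) auto
  then have "(cmod (E d x))\<^sup>2 \<le> (L2_norm M (E d))\<^sup>2"
    by (simp add: L2_norm_square)
  then have "cmod (E d x) \<le> L2_norm M (E d)"
    by (rule power2_le_imp_le) simp
  also have "\<dots> \<le> op_norm M E"
    using op_norm_bound[OF E(2) d(1)] d(2) by simp
  finally show ?thesis
    using Ex by simp
qed

text \<open>AM-GM for entries divided by the norms of their operators gives a linear combination of
  kernels whose norm bound matches the product of powers of norms.\<close>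

lemma hadamard_kernel_bound:
  assumes \<alpha>: "hadamard_exponent M m \<alpha>"
    and E: "\<And>j. j \<in> {1..m} \<Longrightarrow> has_nonneg_kernel M (E j) (e j)"
    and bE: "\<And>j. j \<in> {1..m} \<Longrightarrow> bounded_operator M (E j)"
  defines "c \<equiv> \<lambda>x y. \<Prod>j\<in>{1..m}. e j x y powr \<alpha>"
  shows "has_nonneg_kernel M (kernel_oper M c) c"
    and "has_nonneg_kernel M C c \<Longrightarrow> bounded_operator M C"
    and "has_nonneg_kernel M C c \<Longrightarrow> op_norm M C \<le> (\<Prod>j\<in>{1..m}. op_norm M (E j) powr \<alpha>)"
proof -
  note D = has_nonneg_kernelD[OF E]
  have m: "real m > 0" "{1..m} \<noteq> {}" "card {1..m} = m"
    using \<alpha> by (auto simp: hadamard_exponent_def)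
  have cm: "case_prod c \<in> borel_measurable (M \<Otimes>\<^sub>M M)"
    unfolding c_def using D(3) by (rule hadamard_kernel_measurable)
  have c0: "0 \<le> c x y" for x y
    unfolding c_def by (intro prod_nonneg) auto
  \<comment> \<open>The shift t > 0 avoids division by a vanishing norm and is sent to 0 at the end.
    The weights \<open>w t j\<close> make the sum of \<open>w t j * N t j\<close> equal to the
    product of the \<open>N t j powr \<alpha>\<close>.\<close>
  define N where "N t j = op_norm M (E j) + t" for t j
  define w where "w t j = (\<Prod>j\<in>{1..m}. N t j powr \<alpha>) / (N t j * m)" for t j
  have N: "0 < N t j" "op_norm M (E j) \<le> N t j" if "j \<in> {1..m}" "0 < t" for t j
    using op_norm_nonneg[OF bE] that by (auto simp: N_def add_nonneg_pos)
  have w0: "0 \<le> w t j" if "j \<in> {1..m}" "0 < t" for t j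
    using N[OF that] by (auto simp: w_def intro!: divide_nonneg_nonneg prod_nonneg)
  have cw: "c x y \<le> (\<Sum>j\<in>{1..m}. w t j * e j x y)" if t: "0 < t" and x: "x \<in> space M" and y: "y \<in> space M" for t x y
  proof -
    define P where "P = (\<Prod>j\<in>{1..m}. N t j powr \<alpha>)"
    have P: "0 < P"
      unfolding P_def using N(1)[OF _ t] by (intro prod_pos) (metis powr_gt_zero less_irrefl)
    have "(\<Prod>j\<in>{1..m}. (e j x y / N t j) powr \<alpha>) \<le> (\<Sum>j\<in>{1..m}. e j x y / N t j / card {1..m})"
    proof (rule prod_powr_le_mean)
      show "0 \<le> e j x y / N t j" if "j \<in> {1..m}" for j
        using D(2)[OF that x y] N[OF that t] by simp
      show "\<alpha> = 1 / card {1..m} \<or> 1 / card {1..m} \<le> \<alpha> \<and> (\<forall>j\<in>{1..m}. e j x y / N t j \<le> 1)"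
      proof (cases "\<alpha> = 1 / m")
        case False
        then obtain R where R: "M = count_space R" "1 / m \<le> \<alpha>"
          using \<alpha> by (auto simp: hadamard_exponent_def)
        \<comment> \<open>Matrix entries are at most the operator norm, so the ratios in the mean
          inequality stay below 1.\<close>
        have "e j x y \<le> N t j" if "j \<in> {1..m}" for j
          using kernel_le_op_norm_count_space[OF R(1) E[OF that] bE[OF that] x y] N(2)[OF that t] by simp
        then show ?thesis
          using R m N(1)[OF _ t] by (auto simp: divide_le_eq)
      qed simp
    qed (use m in auto)
    moreover have "(\<Prod>j\<in>{1..m}. (e j x y / N t j) powr \<alpha>) = c x y / P"
      unfolding P_def c_def prod_dividef[symmetric] using D(2)[OF _ x y] N(1)[OF _ t]
      by (intro prod.cong) (auto simp: powr_divide less_imp_le)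
    ultimately have "c x y \<le> P * (\<Sum>j\<in>{1..m}. e j x y / N t j / m)"
      using P m by (simp add: divide_le_eq mult.commute)
    also have "\<dots> = (\<Sum>j\<in>{1..m}. w t j * e j x y)"
      unfolding sum_distrib_left by (intro sum.cong) (auto simp: w_def P_def)
    finally show ?thesis .
  qed
  show "has_nonneg_kernel M (kernel_oper M c) c"
    by (rule kernel_dominated(1)[OF _ E w0[where t = 1] cm c0 cw[where t = 1]]) auto
  assume C: "has_nonneg_kernel M C c"
  have bC: "bounded_operator M C \<and> op_norm M C \<le> (\<Sum>j\<in>{1..m}. w t j * op_norm M (E j))" if t: "0 < t" for t
    by (rule kernel_dominated(2)[OF _ E w0[OF _ t] cm c0 cw[OF t] C bE]) auto
  then show "bounded_operator M C"
    using zero_less_one by blast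
  have "op_norm M C \<le> (\<Prod>j\<in>{1..m}. N t j powr \<alpha>)" if t: "0 < t" for t
  proof -
    have "op_norm M C \<le> (\<Sum>j\<in>{1..m}. w t j * op_norm M (E j))"
      using bC[OF t] by simp
    also have "\<dots> \<le> (\<Sum>j\<in>{1..m}. w t j * N t j)"
      using N(2) w0 t by (intro sum_mono mult_left_mono) auto
    also have "\<dots> = (\<Sum>j\<in>{1..m}. (\<Prod>j\<in>{1..m}. N t j powr \<alpha>) / m)"
    proof (intro sum.cong refl)
      fix j assume "j \<in> {1..m}"
      then show "w t j * N t j = (\<Prod>j\<in>{1..m}. N t j powr \<alpha>) / m"
        using N(1)[of j t] t by (simp add: w_def)
    qed
    also have "\<dots> = (\<Prod>j\<in>{1..m}. N t j powr \<alpha>)"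
      using m by simp
    finally show ?thesis .
  qed
  then have "op_norm M C \<le> (\<Prod>j\<in>{1..m}. N (1 / real (Suc n)) j powr \<alpha>)" for n
    by simp
  moreover have "(\<lambda>n. \<Prod>j\<in>{1..m}. N (1 / real (Suc n)) j powr \<alpha>) \<longlonglongrightarrow> (\<Prod>j\<in>{1..m}. (op_norm M (E j) + 0) powr \<alpha>)"
    unfolding N_def using hadamard_exponent_pos[OF \<alpha>] op_norm_nonneg[OF bE]
    by (intro tendsto_prod tendsto_powr' tendsto_add tendsto_const LIMSEQ_Suc[OF lim_1_over_n]) auto
  ultimately show "op_norm M C \<le> (\<Prod>j\<in>{1..m}. op_norm M (E j) powr \<alpha>)"
    using LIMSEQ_le_const by fastforce
qed

text \<open>Hoelder in the inner variable z, for fixed x and y. The integrability it asks for is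
  known where \<open>f y\<close> is nonzero; elsewhere both integrands vanish.\<close>

lemma hadamard_comp_dominated:
  assumes \<alpha>: "hadamard_exponent M m \<alpha>"
    and A: "\<And>j. j \<in> {1..m} \<Longrightarrow> has_nonneg_kernel M (A j) (a j)"
    and B: "\<And>j. j \<in> {1..m} \<Longrightarrow> has_nonneg_kernel M (B j) (b j)"
    and H: "has_nonneg_kernel M H (\<lambda>x y. \<Prod>j\<in>{1..m}. a j x y powr \<alpha>)"
    and K: "has_nonneg_kernel M K (\<lambda>x y. \<Prod>j\<in>{1..m}. b j x y powr \<alpha>)"
    and E: "has_nonneg_kernel M E (\<lambda>x y. \<Prod>j\<in>{1..m}. (LINT z|M. a j x z * b j z y) powr \<alpha>)"
  shows "dominated M (H \<circ> K) E"
  unfolding dominated_def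
proof (intro ballI impI)
  fix f assume f: "f \<in> L2 M" "AE x in M. 0 \<le> f x"
  have ae: "AE x in M. \<forall>j\<in>{1..m}. AE y in M. f y \<noteq> 0 \<longrightarrow> integrable M (\<lambda>z. a j x z * b j z y)"
  proof (intro AE_finite_allI finite_atLeastAtMost)
    fix j assume j: "j \<in> {1..m}"
    show "AE x in M. AE y in M. f y \<noteq> 0 \<longrightarrow> integrable M (\<lambda>z. a j x z * b j z y)"
      using kernel_comp_aux[OF A[OF j] B[OF j] f(1)] by eventually_elim blast
  qed
  show "AE x in M. (H \<circ> K) f x \<le> E f x"
    using kernel_comp_aux[OF H K f(1)] has_nonneg_kernelD(4)[OF E f(1)] has_nonneg_kernelD(5)[OF E f(1)] ae AE_space
  proof eventually_elim
    case (elim x)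
    have "AE y in M. \<forall>j\<in>{1..m}. f y \<noteq> 0 \<longrightarrow> integrable M (\<lambda>z. a j x z * b j z y)"
      using elim(4) by (intro AE_finite_allI) auto
    then have "AE y in M. complex_of_real (LINT z|M. (\<Prod>j\<in>{1..m}. a j x z powr \<alpha>) * (\<Prod>j\<in>{1..m}. b j z y powr \<alpha>)) * f y
        \<le> complex_of_real (\<Prod>j\<in>{1..m}. (LINT z|M. a j x z * b j z y) powr \<alpha>) * f y"
      using f(2) AE_space
    proof eventually_elim
      case (elim y)
      show ?case
      proof (cases "f y = 0")
        case False
        have nn: "0 \<le> a j x z" "0 \<le> b j z y" if "j \<in> {1..m}" "z \<in> space M" for j z
          using has_nonneg_kernelD(2)[OF A[OF that(1)]] has_nonneg_kernelD(2)[OF B[OF that(1)]] \<open>x \<in> space M\<close> elim that by auto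
        have "(LINT z|M. (\<Prod>j\<in>{1..m}. a j x z powr \<alpha>) * (\<Prod>j\<in>{1..m}. b j z y powr \<alpha>))
            = (LINT z|M. (\<Prod>j\<in>{1..m}. (a j x z * b j z y) powr \<alpha>))"
          unfolding prod.distrib[symmetric] using nn
          by (intro Bochner_Integration.integral_cong prod.cong refl) (simp add: powr_mult)
        also have "\<dots> \<le> (\<Prod>j\<in>{1..m}. (LINT z|M. a j x z * b j z y) powr \<alpha>)"
          using elim(1) False nn by (intro Hoelder_integral_prod_powr[OF \<alpha>]) auto
        finally show ?thesis
          using elim(2) by (intro mult_right_mono complex_of_real_mono)
      qed simp
    qed
    then show ?case
      unfolding o_def elim(3) conjunct1[OF conjunct2[OF elim(1)]]
      by (intro complex_integral_mono conjunct1[OF elim(1)] elim(2))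
  qed
qed

section \<open>A converse to Cauchy-Schwarz, and adjoints by transposing kernels\<close>

lemma L2_duality:
  assumes h[measurable]: "h \<in> borel_measurable M" and C: "0 \<le> C"
    and le: "\<And>g. g \<in> L2 M \<Longrightarrow> (\<integral>\<^sup>+x. h x * ennreal (cmod (g x)) \<partial>M) \<le> ennreal (C * L2_norm M g)"
  shows "(\<integral>\<^sup>+x. h x * h x \<partial>M) \<le> ennreal (C\<^sup>2)"
proof -
  obtain F :: "nat \<Rightarrow> 'a set" where F: "range F \<subseteq> sets M" "(\<Union>i. F i) = space M" "\<And>i. emeasure M (F i) \<noteq> \<infinity>" "incseq F"
    using sigma_finite_incseq by blast
  have [measurable]: "F n \<in> sets M" for n
    using F(1) by auto
  \<comment> \<open>\<open>h\<close> may be infinite or fail to be square-integrable, so it is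
    truncated in height and to a set of finite measure. Testing against \<open>k n\<close> bounds
    its squared norm by C times its norm.\<close>
  define k where "k n x = inf (h x) (of_nat n) * indicator (F n) x" for n x
  have [measurable]: "k n \<in> borel_measurable M" for n
    unfolding k_def by measurable
  have kn: "k n x \<le> of_nat n * indicator (F n) x" for n x
    by (auto simp: k_def indicator_def)
  have kt: "k n x < top" for n x
    using kn[of n x] by (auto simp: indicator_def of_nat_less_top order.strict_trans1 split: if_splits)
  have kh: "k n x \<le> h x" for n x
    by (auto simp: k_def indicator_def)
  define g where "g n x = complex_of_real (enn2real (k n x))" for n x
  have gk: "ennreal (cmod (g n x)) = k n x" for n x
    using kt by (simp add: g_def)
  have [measurable]: "g n \<in> borel_measurable M" for n
    unfolding g_def by measurable
  have gL: "g n \<in> L2 M" for n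
  proof -
    have "(\<integral>\<^sup>+x. ennreal ((cmod (g n x))\<^sup>2) \<partial>M) = (\<integral>\<^sup>+x. k n x * k n x \<partial>M)"
      unfolding gk[symmetric] by (simp add: power2_eq_square ennreal_mult)
    also have "\<dots> \<le> (\<integral>\<^sup>+x. (of_nat n * of_nat n) * indicator (F n) x \<partial>M)"
    proof (rule nn_integral_mono)
      fix x
      show "k n x * k n x \<le> (of_nat n * of_nat n) * indicator (F n) x"
        using mult_mono[OF kn[of n x] kn[of n x]] by (auto simp: indicator_def)
    qed
    also have "\<dots> = (of_nat n * of_nat n) * emeasure M (F n)"
      by (simp add: nn_integral_cmult_indicator)
    also have "\<dots> < \<infinity>"
      using F(3)[of n] by (simp add: ennreal_mult_less_top of_nat_less_top less_top)
    finally have "integrable M (\<lambda>x. (cmod (g n x))\<^sup>2)"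
      unfolding g_def by (intro integrableI_bounded) auto
    then show ?thesis
      by (simp add: L2_def)
  qed
  have kk: "(\<integral>\<^sup>+x. k n x * k n x \<partial>M) \<le> ennreal (C\<^sup>2)" for n
  proof -
    have eq: "(\<integral>\<^sup>+x. k n x * k n x \<partial>M) = ennreal ((L2_norm M (g n))\<^sup>2)"
      unfolding L2_norm_square gk[symmetric] using L2_integrable[OF gL[of n]]
      by (simp add: nn_integral_eq_integral[symmetric] power2_eq_square ennreal_mult)
    also have "\<dots> \<le> ennreal (C * L2_norm M (g n))"
    proof -
      have "(\<integral>\<^sup>+x. k n x * k n x \<partial>M) \<le> (\<integral>\<^sup>+x. h x * ennreal (cmod (g n x)) \<partial>M)"
        unfolding gk by (intro nn_integral_mono mult_right_mono kh) auto
      then show ?thesis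
        using le[OF gL[of n]] unfolding eq by (rule order_trans)
    qed
    finally have "(L2_norm M (g n))\<^sup>2 \<le> C * L2_norm M (g n)"
      using C eq by simp
    then have "L2_norm M (g n) \<le> C"
      using C L2_norm_nonneg[of M "g n"] by (cases "L2_norm M (g n) = 0") (auto simp: power2_eq_square order_less_le)
    then show ?thesis
      unfolding eq by (intro ennreal_leI power_mono) auto
  qed
  have hk: "h x * h x \<le> (SUP n. k n x * k n x)" if x: "x \<in> space M" for x
  proof -
    obtain i where i: "x \<in> F i"
      using F(2) x by blast
    have k: "k n x = inf (h x) (of_nat n)" if "i \<le> n" for n
    proof -
      have "x \<in> F n"
        using i F(4) that unfolding incseq_def by blast
      then show ?thesis
        by (simp add: k_def)
    qed
    show ?thesis
    proof (cases "h x = top")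
      \<comment> \<open>Where \<open>h\<close> is infinite the truncation at level n is eventually n
        itself, and the squares are unbounded.\<close>
      case True
      have "(SUP n. of_nat n :: ennreal) \<le> (SUP n. k n x * k n x)"
      proof (rule SUP_mono)
        fix n :: nat
        define l where "l = Suc (max n i)"
        have "of_nat n \<le> (of_nat (l * l) :: ennreal)"
          unfolding of_nat_le_iff by (simp add: l_def)
        moreover have "k l x = of_nat l"
          using k[of l] True by (simp add: l_def)
        ultimately have "of_nat n \<le> k l x * k l x"
          by (simp only: of_nat_mult)
        then show "\<exists>l\<in>UNIV. of_nat n \<le> k l x * k l x"
          by blast
      qed
      then have "(SUP n. k n x * k n x) = top"
        by (simp only: ennreal_SUP_of_nat_eq_top top_unique)
      then show ?thesis
        by (simp only: top_greatest)
    next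
      case False
      then obtain n where n: "h x < of_nat n"
        using ennreal_Ex_less_of_nat[of "h x"] by (auto simp: less_top)
      also have "(of_nat n :: ennreal) \<le> of_nat (max n i)"
        by (intro of_nat_mono) simp
      finally have "k (max n i) x = h x"
        using k[of "max n i"] by (simp add: inf_absorb1)
      then show ?thesis
        using SUP_upper[of "max n i" UNIV "\<lambda>n. k n x * k n x"] by simp
    qed
  qed
  have inc: "k n x \<le> k n' x" if "n \<le> n'" for n n' x
  proof -
    have "F n \<subseteq> F n'"
      using F(4) that by (auto simp: incseq_def)
    moreover have "inf (h x) (of_nat n) \<le> inf (h x) (of_nat n')"
      using that by (intro inf_mono of_nat_mono) auto
    ultimately show ?thesis
      by (auto simp: k_def indicator_def)
  qed
  have "(\<integral>\<^sup>+x. h x * h x \<partial>M) \<le> (\<integral>\<^sup>+x. (SUP n. k n x * k n x) \<partial>M)"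
    by (intro nn_integral_mono hk)
  also have "\<dots> = (SUP n. \<integral>\<^sup>+x. k n x * k n x \<partial>M)"
    by (intro nn_integral_monotone_convergence_SUP) (auto simp: incseq_def le_fun_def intro!: mult_mono inc)
  also have "\<dots> \<le> ennreal (C\<^sup>2)"
    by (intro SUP_least kk)
  finally show ?thesis .
qed

text \<open>Testing the transposed integral against g and exchanging integrals leaves
  \<open>A\<close> acting on the modulus of g, so \<open>L2_duality\<close> transfers the bound. No
  conjugation appears because the kernel is real.\<close>

lemma kernel_transpose:
  assumes A: "has_nonneg_kernel M A a" and bA: "bounded_operator M A"
  defines "c \<equiv> \<lambda>x y. a y x"
  shows "has_nonneg_kernel M (kernel_oper M c) c" and "is_adjoint M A (kernel_oper M c)"
proof -
  interpret pair: pair_sigma_finite M M ..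
  note DA = has_nonneg_kernelD[OF A]
  note AL = linear_operator_L2[OF DA(1)]
  note [measurable] = DA(3)
  let ?F = "\<lambda>f y. complex_of_real (cmod (f y))"
  have cm[measurable]: "case_prod c \<in> borel_measurable (M \<Otimes>\<^sub>M M)"
    unfolding c_def by measurable
  have c0: "0 \<le> c x y" if "x \<in> space M" "y \<in> space M" for x y
    unfolding c_def by (rule DA(2)[OF that(2,1)])
  have AF: "AE y in M. integrable M (\<lambda>x. a y x * cmod (g x)) \<and> A (?F g) y = complex_of_real (LINT x|M. a y x * cmod (g x))"
    if g: "g \<in> L2 M" for g
    using DA(4)[OF L2_cmod(1)[OF g]] DA(5)[OF L2_cmod(1)[OF g]]
    by eventually_elim (simp only: of_real_mult[symmetric] complex_of_real_integrable_eq integral_complex_of_real simp_thms)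
  have dual: "(\<integral>\<^sup>+x. h x * h x \<partial>M) \<le> ennreal ((op_norm M A * L2_norm M f)\<^sup>2)"
    if f: "f \<in> L2 M" and h: "h = (\<lambda>x. \<integral>\<^sup>+y. ennreal (c x y * cmod (f y)) \<partial>M)" for f h
  proof (rule L2_duality[where h = h and C = "op_norm M A * L2_norm M f"])
    note [measurable] = L2_measurable[OF f]
    show hm: "h \<in> borel_measurable M"
      unfolding h by measurable
    show "0 \<le> op_norm M A * L2_norm M f"
      by (intro mult_nonneg_nonneg op_norm_nonneg bA L2_norm_nonneg)
    fix g assume g: "g \<in> L2 M"
    note [measurable] = L2_measurable[OF g]
    have "(\<integral>\<^sup>+x. h x * ennreal (cmod (g x)) \<partial>M)
        = (\<integral>\<^sup>+x. \<integral>\<^sup>+y. ennreal (c x y * cmod (f y)) * ennreal (cmod (g x)) \<partial>M \<partial>M)"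
      unfolding h by (intro nn_integral_cong nn_integral_multc[symmetric]) measurable
    also have "\<dots> = (\<integral>\<^sup>+y. \<integral>\<^sup>+x. ennreal (c x y * cmod (f y)) * ennreal (cmod (g x)) \<partial>M \<partial>M)"
      by (rule pair.Fubini') measurable
    also have "\<dots> = (\<integral>\<^sup>+y. ennreal (cmod (f y) * cmod (A (?F g) y)) \<partial>M)"
    proof (rule nn_integral_cong_AE)
      show "AE y in M. (\<integral>\<^sup>+x. ennreal (c x y * cmod (f y)) * ennreal (cmod (g x)) \<partial>M) = ennreal (cmod (f y) * cmod (A (?F g) y))"
        using AF[OF g] AE_space
      proof eventually_elim
        case (elim y)
        have "(\<integral>\<^sup>+x. ennreal (c x y * cmod (f y)) * ennreal (cmod (g x)) \<partial>M)
            = (\<integral>\<^sup>+x. ennreal (cmod (f y) * (a y x * cmod (g x))) \<partial>M)"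
          using elim c0 by (intro nn_integral_cong) (simp add: ennreal_mult[symmetric] c_def mult_ac)
        also have "\<dots> = ennreal (LINT x|M. cmod (f y) * (a y x * cmod (g x)))"
          using elim DA(2) by (intro nn_integral_eq_integral integrable_mult_right) auto
        also have "(LINT x|M. cmod (f y) * (a y x * cmod (g x))) = cmod (f y) * (LINT x|M. a y x * cmod (g x))"
          by (rule integral_mult_right_zero)
        also have "(LINT x|M. a y x * cmod (g x)) = cmod (A (?F g) y)"
        proof -
          have "0 \<le> (LINT x|M. a y x * cmod (g x))"
            using elim DA(2) by (intro integral_nonneg_AE) auto
          then show ?thesis
            using elim by simp
        qed
        finally show ?case .
      qed
    qed
    also have "\<dots> = ennreal (LINT y|M. cmod (f y) * cmod (A (?F g) y))"
      using L2_mult_integrable[OF f AL[OF L2_cmod(1)[OF g]]] by (intro nn_integral_eq_integral) auto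
    also have "\<dots> \<le> ennreal (L2_norm M f * (op_norm M A * L2_norm M (?F g)))"
      using L2_Cauchy_Schwarz[OF f AL[OF L2_cmod(1)[OF g]]]
        mult_left_mono[OF op_norm_bound[OF bA L2_cmod(1)[OF g]] L2_norm_nonneg[of M f]]
      by (intro ennreal_leI) linarith
    finally show "(\<integral>\<^sup>+x. h x * ennreal (cmod (g x)) \<partial>M) \<le> ennreal (op_norm M A * L2_norm M f * L2_norm M g)"
      by (simp add: L2_cmod(2)[OF g] mult_ac)
  qed
  have key: "(AE x in M. integrable M (\<lambda>y. complex_of_real (c x y) * f y)) \<and> kernel_oper M c f \<in> L2 M
      \<and> L2_norm M (kernel_oper M c f) \<le> op_norm M A * L2_norm M f" if f: "f \<in> L2 M" for f
  proof -
    note [measurable] = L2_measurable[OF f] kernel_oper_measurable[OF cm L2_measurable[OF f]]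
    define h where "h x = (\<integral>\<^sup>+y. ennreal (c x y * cmod (f y)) \<partial>M)" for x
    have hm[measurable]: "h \<in> borel_measurable M"
      unfolding h_def by measurable
    note d = dual[OF f, of h, unfolded h_def, OF refl, folded h_def]
    have "(\<integral>\<^sup>+x. h x * h x \<partial>M) \<noteq> \<infinity>"
      using d by (auto simp: top_unique)
    then have "AE x in M. h x * h x \<noteq> \<infinity>"
      by (intro nn_integral_PInf_AE) auto
    \<comment> \<open>A square-integrable \<open>h\<close> is finite almost everywhere, and this is
      absolute convergence of the transposed integral.\<close>
    then have 1: "AE x in M. integrable M (\<lambda>y. complex_of_real (c x y) * f y)"
      using AE_space
    proof eventually_elim
      case (elim x)
      have hx: "h x < \<infinity>"
        using elim by (auto simp: ennreal_mult_eq_top_iff less_top)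
      show ?case
      proof (rule integrableI_bounded)
        show "(\<lambda>y. complex_of_real (c x y) * f y) \<in> borel_measurable M"
          using elim by measurable
        have "(\<integral>\<^sup>+y. ennreal (cmod (complex_of_real (c x y) * f y)) \<partial>M) = h x"
          unfolding h_def using c0 elim by (intro nn_integral_cong) (simp add: norm_mult)
        then show "(\<integral>\<^sup>+y. ennreal (cmod (complex_of_real (c x y) * f y)) \<partial>M) < \<infinity>"
          using hx by simp
      qed
    qed
    have le: "AE x in M. ennreal (cmod (kernel_oper M c f x)) \<le> h x"
      using 1 AE_space
    proof eventually_elim
      case (elim x)
      have "ennreal (cmod (kernel_oper M c f x)) \<le> ennreal (LINT y|M. cmod (complex_of_real (c x y) * f y))"
        unfolding kernel_oper_def by (intro ennreal_leI integral_norm_bound)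
      also have "\<dots> = (\<integral>\<^sup>+y. ennreal (cmod (complex_of_real (c x y) * f y)) \<partial>M)"
        using elim by (intro nn_integral_eq_integral[symmetric]) auto
      also have "\<dots> = h x"
        unfolding h_def using c0 elim by (intro nn_integral_cong) (simp add: norm_mult)
      finally show ?case .
    qed
    have nn: "(\<integral>\<^sup>+x. ennreal ((cmod (kernel_oper M c f x))\<^sup>2) \<partial>M) \<le> ennreal ((op_norm M A * L2_norm M f)\<^sup>2)"
    proof -
      have "(\<integral>\<^sup>+x. ennreal ((cmod (kernel_oper M c f x))\<^sup>2) \<partial>M) \<le> (\<integral>\<^sup>+x. h x * h x \<partial>M)"
        using le by (intro nn_integral_mono_AE, eventually_elim) (simp add: power2_eq_square ennreal_mult mult_mono)
      then show ?thesis
        using d by (rule order_trans)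
    qed
    have int: "integrable M (\<lambda>x. (cmod (kernel_oper M c f x))\<^sup>2)"
    proof (rule integrableI_bounded)
      show "(\<integral>\<^sup>+x. ennreal (norm ((cmod (kernel_oper M c f x))\<^sup>2)) \<partial>M) < \<infinity>"
        using le_less_trans[OF nn] by simp
    qed measurable
    then have 2: "kernel_oper M c f \<in> L2 M"
      by (simp add: L2_def)
    have "ennreal ((L2_norm M (kernel_oper M c f))\<^sup>2) \<le> ennreal ((op_norm M A * L2_norm M f)\<^sup>2)"
      using nn int by (simp add: L2_norm_square nn_integral_eq_integral)
    then have "(L2_norm M (kernel_oper M c f))\<^sup>2 \<le> (op_norm M A * L2_norm M f)\<^sup>2"
      by simp
    then have "L2_norm M (kernel_oper M c f) \<le> op_norm M A * L2_norm M f"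
      by (rule power2_le_imp_le) (intro mult_nonneg_nonneg op_norm_nonneg bA L2_norm_nonneg)
    with 1 2 show ?thesis
      by blast
  qed
  show K: "has_nonneg_kernel M (kernel_oper M c) c"
    using key by (intro kernel_oper_has_nonneg_kernel cm c0) auto
  show "is_adjoint M A (kernel_oper M c)"
    unfolding is_adjoint_def
  proof (intro conjI ballI)
    show "bounded_operator M (kernel_oper M c)"
      using key by (intro bounded_operatorI[OF has_nonneg_kernelD(1)[OF K]]) auto
    fix f g assume f: "f \<in> L2 M" and g: "g \<in> L2 M"
    note [measurable] = L2_measurable[OF f] L2_measurable[OF g]
    define J where "J x y = complex_of_real (a x y) * f y * cnj (g x)" for x y
    have Jm: "case_prod J \<in> borel_measurable (M \<Otimes>\<^sub>M M)"
      unfolding J_def by measurable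
    \<comment> \<open>Integrating the modulus over y gives a product of two L2 functions of x, which
      is integrable.\<close>
    have Jint: "integrable (M \<Otimes>\<^sub>M M) (case_prod J)"
    proof (rule pair.Fubini_integrable[OF Jm])
      have "AE x in M. (LINT y|M. cmod (case_prod J (x, y))) = cmod (A (?F f) x) * cmod (g x)"
        using AF[OF f] AE_space
      proof eventually_elim
        case (elim x)
        have "(LINT y|M. cmod (case_prod J (x, y))) = (LINT y|M. a x y * cmod (f y) * cmod (g x))"
          using DA(2) elim by (intro Bochner_Integration.integral_cong) (auto simp: J_def norm_mult)
        also have "\<dots> = (LINT y|M. a x y * cmod (f y)) * cmod (g x)"
          by (rule integral_mult_left_zero)
        also have "(LINT y|M. a x y * cmod (f y)) = cmod (A (?F f) x)"
        proof -
          have "0 \<le> (LINT y|M. a x y * cmod (f y))"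
            using elim DA(2) by (intro integral_nonneg_AE) auto
          then show ?thesis
            using elim by simp
        qed
        finally show ?case .
      qed
      moreover have "integrable M (\<lambda>x. cmod (A (?F f) x) * cmod (g x))"
        by (intro L2_mult_integrable AL L2_cmod(1) f g)
      moreover have "(\<lambda>x. LINT y|M. cmod (case_prod J (x, y))) \<in> borel_measurable M"
        using Jm by measurable
      ultimately show "integrable M (\<lambda>x. LINT y|M. cmod (case_prod J (x, y)))"
        by (subst integrable_cong_AE) (auto intro: borel_measurable_integrable)
      show "AE x in M. integrable M (\<lambda>y. case_prod J (x, y))"
        using DA(4)[OF f] by eventually_elim (simp add: J_def)
    qed
    have "L2_inner M (A f) g = (LINT x|M. LINT y|M. J x y)"
      unfolding L2_inner_def
    proof (rule integral_cong_AE)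
      show "(\<lambda>x. A f x * cnj (g x)) \<in> borel_measurable M"
        using L2_measurable[OF AL[OF f]] by measurable
      show "(\<lambda>x. LINT y|M. J x y) \<in> borel_measurable M"
        using Jm by measurable
      show "AE x in M. A f x * cnj (g x) = (LINT y|M. J x y)"
        using DA(5)[OF f] by eventually_elim (simp add: J_def)
    qed
    also have "\<dots> = (LINT y|M. LINT x|M. J x y)"
      by (rule pair.Fubini_integral[OF Jint, symmetric])
    also have "\<dots> = L2_inner M f (kernel_oper M c g)"
      unfolding L2_inner_def
    proof (intro Bochner_Integration.integral_cong refl)
      fix y
      have "(LINT x|M. J x y) = (LINT x|M. f y * cnj (complex_of_real (c y x) * g x))"
        by (simp add: J_def c_def mult_ac)
      also have "\<dots> = f y * (LINT x|M. cnj (complex_of_real (c y x) * g x))"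
        by (rule integral_mult_right_zero)
      also have "(LINT x|M. cnj (complex_of_real (c y x) * g x)) = cnj (kernel_oper M c g y)"
        unfolding kernel_oper_def by (rule Bochner_Integration.integral_cnj)
      finally show "(LINT x|M. J x y) = f y * cnj (kernel_oper M c g y)" .
    qed
    finally show "L2_inner M (A f) g = L2_inner M f (kernel_oper M c g)" .
  qed
qed

end

section \<open>Adjoints of positive operators\<close>

lemma adjoint_op_norm:
  assumes A: "bounded_operator M A" and adj: "is_adjoint M A B"
  shows "op_norm M B \<le> op_norm M A"
proof (rule op_norm_least[OF op_norm_nonneg[OF A]])
  fix g assume g: "g \<in> L2 M"
  have B: "bounded_operator M B"
    using adj by (simp add: is_adjoint_def)
  have Bg: "B g \<in> L2 M"
    by (rule linear_operator_L2[OF bounded_operatorD[OF B] g])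
  \<comment> \<open>The adjoint identity at \<open>B g\<close> turns its squared norm into an inner
    product, from which one factor of that norm cancels unless it is 0.\<close>
  have "complex_of_real ((L2_norm M (B g))\<^sup>2) = L2_inner M (A (B g)) g"
    unfolding L2_inner_self[symmetric] using adj Bg g by (simp add: is_adjoint_def)
  then have "(L2_norm M (B g))\<^sup>2 = cmod (L2_inner M (A (B g)) g)"
    by (metis norm_of_real abs_of_nonneg zero_le_power2)
  also have "\<dots> \<le> L2_norm M (A (B g)) * L2_norm M g"
    by (intro L2_inner_bound linear_operator_L2[OF bounded_operatorD[OF A]] Bg g)
  also have "\<dots> \<le> op_norm M A * L2_norm M (B g) * L2_norm M g"
    by (intro mult_right_mono op_norm_bound A Bg) simp
  finally have "L2_norm M (B g) * L2_norm M (B g) \<le> (op_norm M A * L2_norm M g) * L2_norm M (B g)"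
    by (simp add: power2_eq_square mult_ac)
  then show "L2_norm M (B g) \<le> op_norm M A * L2_norm M g"
    using op_norm_nonneg[OF A] L2_norm_nonneg[of M "B g"]
    by (cases "L2_norm M (B g) = 0") (auto simp: order_less_le)
qed

text \<open>Since \<open>B\<close> is known only through the adjoint identity, signs are detected by
  pairing: for nonnegative h the inner product of h with \<open>B f\<close> equals that of
  \<open>A h\<close> with f, hence is nonnegative.\<close>

lemma adjoint_positive:
  assumes A: "positive_operator M A" and adj: "is_adjoint M A B"
  shows "positive_operator M B"
  unfolding positive_operator_def nonneg_Reals_complex_iff
proof (intro conjI ballI impI)
  have B: "bounded_operator M B"
    using adj by (simp add: is_adjoint_def)
  show "linear_operator M B"
    by (rule bounded_operatorD[OF B])
  fix f assume f: "f \<in> L2 M" "AE x in M. 0 \<le> f x"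
  have Bf: "B f \<in> L2 M"
    by (rule linear_operator_L2[OF bounded_operatorD[OF B] f(1)])
  note [measurable] = L2_measurable[OF Bf]
  have pos: "0 \<le> L2_inner M h (B f)" if h: "h \<in> L2 M" "\<And>x. 0 \<le> h x" for h
  proof -
    have "AE x in M. 0 \<le> A h x"
      using h by (intro positive_operator_nonneg[OF A]) auto
    then have "AE x in M. 0 \<le> A h x * cnj (f x)"
      using f(2) by eventually_elim (auto simp: less_eq_complex_def)
    then have "0 \<le> L2_inner M (A h) f"
      unfolding L2_inner_def by (rule complex_integral_nonneg)
    then show ?thesis
      using adj h f by (simp add: is_adjoint_def)
  qed
  \<comment> \<open>The positive part h of p lies below the modulus of \<open>B f\<close>, hence in
    L2, and the integral of h p is its squared norm; a nonpositive integral therefore forces p <= 0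
    almost everywhere.\<close>
  have test: "AE x in M. p x \<le> 0"
    if p: "p \<in> borel_measurable M" "\<And>x. \<bar>p x\<bar> \<le> cmod (B f x)"
      and r: "\<And>h. h \<in> borel_measurable M \<Longrightarrow> integrable M (\<lambda>x. complex_of_real (h x) * cnj (B f x)) \<Longrightarrow>
        integrable M (\<lambda>x. h x * p x) \<Longrightarrow> 0 \<le> L2_inner M (\<lambda>x. complex_of_real (h x)) (B f) \<Longrightarrow> (LINT x|M. h x * p x) \<le> 0"
    for p :: "'a \<Rightarrow> real"
  proof -
    note [measurable] = p(1)
    define h where "h x = max 0 (p x)" for x
    have [measurable]: "h \<in> borel_measurable M"
      unfolding h_def by measurable
    have hL: "(\<lambda>x. complex_of_real (h x)) \<in> L2 M"
    proof (rule L2_bound(1)[OF Bf])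
      show "(\<lambda>x. complex_of_real (h x)) \<in> borel_measurable M"
        unfolding h_def by measurable
      show "AE x in M. cmod (complex_of_real (h x)) \<le> cmod (B f x)"
        using p(2) by (intro AE_I2) (auto simp: h_def max_def intro: order_trans[OF abs_ge_self])
    qed
    have hh: "h x * p x = (cmod (complex_of_real (h x)))\<^sup>2" for x
      by (simp add: h_def max_def power2_eq_square)
    have int: "integrable M (\<lambda>x. h x * p x)"
      unfolding hh by (rule L2_integrable[OF hL])
    have "(\<lambda>x. complex_of_real (h x) * cnj (B f x)) \<in> borel_measurable M"
      by measurable
    then have "integrable M (\<lambda>x. complex_of_real (h x) * cnj (B f x))"
      by (rule Bochner_Integration.integrable_bound[OF L2_mult_integrable[OF hL Bf]]) (auto simp: norm_mult)
    then have "(LINT x|M. h x * p x) \<le> 0"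
      using int by (intro r pos hL) (auto simp: h_def less_eq_complex_def)
    then have "L2_norm M (\<lambda>x. complex_of_real (h x)) = 0"
      unfolding L2_norm_def hh by (simp add: antisym)
    then have "AE x in M. complex_of_real (h x) = 0"
      using L2_norm_zero_iff[OF hL] by simp
    then show ?thesis
      by eventually_elim (auto simp: h_def max_def split: if_splits)
  qed
  have "AE x in M. - Re (B f x) \<le> 0"
  proof (rule test)
    fix h assume h: "integrable M (\<lambda>x. complex_of_real (h x) * cnj (B f x))" "0 \<le> L2_inner M (\<lambda>x. complex_of_real (h x)) (B f)"
    have "0 \<le> Re (LINT x|M. complex_of_real (h x) * cnj (B f x))"
      using h(2) by (simp add: L2_inner_def less_eq_complex_def)
    also have "\<dots> = (LINT x|M. h x * Re (B f x))"
      using h(1) by (subst integral_Re[symmetric]) auto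
    finally show "(LINT x|M. h x * - Re (B f x)) \<le> 0"
      by simp
  qed (auto simp: abs_Re_le_cmod)
  \<comment> \<open>\<open>0 \<le> z\<close> includes Im z = 0, so the integral vanishes and serves
    both Im and - Im.\<close>
  moreover have imag: "(LINT x|M. h x * Im (B f x)) = 0"
    if h: "integrable M (\<lambda>x. complex_of_real (h x) * cnj (B f x))" "0 \<le> L2_inner M (\<lambda>x. complex_of_real (h x)) (B f)" for h
  proof -
    have "0 = Im (LINT x|M. complex_of_real (h x) * cnj (B f x))"
      using h(2) by (simp add: L2_inner_def less_eq_complex_def)
    also have "\<dots> = (LINT x|M. - (h x * Im (B f x)))"
      using h(1) by (subst integral_Im[symmetric]) auto
    finally show ?thesis
      by simp
  qed
  have "AE x in M. Im (B f x) \<le> 0"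
    by (rule test) (auto simp: abs_Im_le_cmod imag)
  moreover have "AE x in M. - Im (B f x) \<le> 0"
    by (rule test) (auto simp: abs_Im_le_cmod imag)
  ultimately show "AE x in M. 0 \<le> B f x"
    by eventually_elim (simp add: less_eq_complex_def)
qed

subsection \<open>The inequalities for sets of operators\<close>

text \<open>The half of the C*-identity that follows from Cauchy-Schwarz.\<close>

lemma adjoint_norm_square_le:
  assumes A: "bounded_operator M A" and adj: "is_adjoint M A B"
  shows "(op_norm M A)\<^sup>2 \<le> op_norm M (B \<circ> A)"
proof -
  have B: "bounded_operator M B"
    using adj by (simp add: is_adjoint_def)
  note BA = bounded_operator_comp(1)[OF B A]
  have "op_norm M A \<le> sqrt (op_norm M (B \<circ> A))"
  proof (rule op_norm_least)
    fix f assume f: "f \<in> L2 M"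
    note Af = linear_operator_L2[OF bounded_operatorD[OF A] f]
    have "complex_of_real ((L2_norm M (A f))\<^sup>2) = L2_inner M f ((B \<circ> A) f)"
      unfolding L2_inner_self[symmetric] using adj f Af by (simp add: is_adjoint_def)
    then have "(L2_norm M (A f))\<^sup>2 = cmod (L2_inner M f ((B \<circ> A) f))"
      by (metis norm_of_real abs_of_nonneg zero_le_power2)
    also have "\<dots> \<le> L2_norm M f * L2_norm M ((B \<circ> A) f)"
      by (intro L2_inner_bound f linear_operator_L2[OF bounded_operatorD[OF BA]])
    also have "\<dots> \<le> L2_norm M f * (op_norm M (B \<circ> A) * L2_norm M f)"
      by (intro mult_left_mono op_norm_bound BA f) simp
    finally have "(L2_norm M (A f))\<^sup>2 \<le> op_norm M (B \<circ> A) * (L2_norm M f)\<^sup>2"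
      by (simp add: power2_eq_square mult_ac)
    then have "sqrt ((L2_norm M (A f))\<^sup>2) \<le> sqrt (op_norm M (B \<circ> A) * (L2_norm M f)\<^sup>2)"
      by (rule real_sqrt_le_mono)
    then show "L2_norm M (A f) \<le> sqrt (op_norm M (B \<circ> A)) * L2_norm M f"
      by (simp add: real_sqrt_mult)
  qed (simp add: op_norm_nonneg BA)
  then have "(op_norm M A)\<^sup>2 \<le> (sqrt (op_norm M (B \<circ> A)))\<^sup>2"
    by (intro power_mono op_norm_nonneg A)
  then show ?thesis
    by (simp add: op_norm_nonneg BA)
qed

lemma L2_inner_cnj: "L2_inner M g f = cnj (L2_inner M f g)"
  unfolding L2_inner_def Bochner_Integration.integral_cnj[symmetric] by (simp add: mult.commute)

lemma is_adjoint_comp_self: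
  assumes A: "bounded_operator M A" and adj: "is_adjoint M A B"
  shows "is_adjoint M (B \<circ> A) (B \<circ> A)"
  unfolding is_adjoint_def
proof (intro conjI ballI)
  have B: "bounded_operator M B"
    using adj by (simp add: is_adjoint_def)
  show "bounded_operator M (B \<circ> A)"
    by (rule bounded_operator_comp(1)[OF B A])
  note L = linear_operator_L2[OF bounded_operatorD[OF A]]
  have adj': "L2_inner M (A f) g = L2_inner M f (B g)" if "f \<in> L2 M" "g \<in> L2 M" for f g
    using adj that by (simp add: is_adjoint_def)
  fix f g assume f: "f \<in> L2 M" and g: "g \<in> L2 M"
  have "L2_inner M (B (A f)) g = cnj (L2_inner M g (B (A f)))"
    by (rule L2_inner_cnj)
  also have "\<dots> = cnj (L2_inner M (A g) (A f))"
    using f g L by (simp add: adj')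
  also have "\<dots> = L2_inner M (A f) (A g)"
    by (rule L2_inner_cnj[symmetric])
  also have "\<dots> = L2_inner M f (B (A g))"
    using f g L by (simp add: adj')
  finally show "L2_inner M ((B \<circ> A) f) g = L2_inner M f ((B \<circ> A) g)"
    by simp
qed

text \<open>The C*-inequality controls squaring, which is why the exponents are powers of two;
  self-adjointness of the powers is carried along to let the induction continue.\<close>

lemma self_adjoint_power_norm:
  assumes P: "is_adjoint M P P"
  shows "is_adjoint M (P ^^ 2 ^ k) (P ^^ 2 ^ k) \<and> op_norm M P ^ 2 ^ k \<le> op_norm M (P ^^ 2 ^ k)"
proof (induction k)
  case (Suc k)
  have bP: "bounded_operator M P"
    using P by (simp add: is_adjoint_def)
  note b = bounded_operator_funpow[OF bP, of "2 ^ k"]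
  have eq: "P ^^ 2 ^ k \<circ> P ^^ 2 ^ k = P ^^ 2 ^ Suc k"
    by (simp add: funpow_add[symmetric] mult_2)
  have "op_norm M P ^ 2 ^ Suc k = (op_norm M P ^ 2 ^ k)\<^sup>2"
    by (simp add: power_mult[symmetric] mult.commute)
  also have "\<dots> \<le> (op_norm M (P ^^ 2 ^ k))\<^sup>2"
    using Suc by (intro power_mono zero_le_power op_norm_nonneg bP) auto
  also have "\<dots> \<le> op_norm M (P ^^ 2 ^ Suc k)"
    using adjoint_norm_square_le[OF b conjunct1[OF Suc]] unfolding eq .
  finally show ?case
    using is_adjoint_comp_self[OF b conjunct1[OF Suc]] unfolding eq by blast
qed (use P in simp)

text \<open>\<open>D\<close> need not be self-adjoint, so norms of its powers are compared with
  those of \<open>B \<circ> A\<close>; as the full limit for \<open>D\<close> exists, it may be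
  taken along powers of two.\<close>

lemma adjoint_norm_square_le_spectral_radius:
  assumes A: "bounded_operator M A" "positive_operator M A" and adj: "is_adjoint M A B"
    and D: "bounded_operator M D" "positive_operator M D" and dom: "dominated M (B \<circ> A) D"
  shows "(op_norm M A)\<^sup>2 \<le> op_spectral_radius M D"
proof -
  define P where "P = B \<circ> A"
  have B: "bounded_operator M B" "positive_operator M B"
    using adj adjoint_positive[OF A(2) adj] by (auto simp: is_adjoint_def)
  have bP: "bounded_operator M P" "positive_operator M P"
    unfolding P_def by (intro bounded_operator_comp positive_operator_comp A B)+
  have saP: "is_adjoint M P P"
    unfolding P_def by (rule is_adjoint_comp_self[OF A(1) adj])
  have "(\<lambda>n. 4 powr (1 / real n) * op_norm M (D ^^ n) powr (1 / real n)) \<longlonglongrightarrow> 4 powr 0 * op_spectral_radius M D"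
    by (intro tendsto_intros lim_1_over_n op_spectral_radius_limit[OF D]) auto
  moreover have "strict_mono (\<lambda>k. 2 ^ k :: nat)"
    by (auto simp: strict_mono_def)
  ultimately have lim: "(\<lambda>k. 4 powr (1 / real (2 ^ k)) * op_norm M (D ^^ 2 ^ k) powr (1 / real (2 ^ k))) \<longlonglongrightarrow> 4 powr 0 * op_spectral_radius M D"
    by (rule LIMSEQ_subseq_LIMSEQ[unfolded o_def])
  have "op_norm M P \<le> 4 powr (1 / real (2 ^ k)) * op_norm M (D ^^ 2 ^ k) powr (1 / real (2 ^ k))" for k
  proof -
    let ?n = "2 ^ k :: nat"
    have "op_norm M P = (op_norm M P ^ ?n) powr (1 / real ?n)"
      using op_norm_nonneg[OF bP(1)] by (cases "op_norm M P = 0") (simp_all add: powr_realpow[symmetric] powr_powr power_0_left)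
    also have "\<dots> \<le> (4 * op_norm M (D ^^ ?n)) powr (1 / real ?n)"
    proof (intro powr_mono2)
      have "op_norm M (P ^^ ?n) \<le> 4 * op_norm M (D ^^ ?n)"
        by (intro dominated_op_norm positive_operator_funpow bounded_operator_funpow dominated_funpow bP D dom[folded P_def])
      then show "op_norm M P ^ ?n \<le> 4 * op_norm M (D ^^ ?n)"
        using self_adjoint_power_norm[OF saP, of k] by linarith
    qed (use op_norm_nonneg[OF bP(1)] in auto)
    also have "\<dots> = 4 powr (1 / real ?n) * op_norm M (D ^^ ?n) powr (1 / real ?n)"
      by (rule powr_mult)
    finally show ?thesis .
  qed
  then have "op_norm M P \<le> 4 powr 0 * op_spectral_radius M D"
    using lim by (intro LIMSEQ_le_const) auto
  then show ?thesis
    using adjoint_norm_square_le[OF A(1) adj] by (simp add: P_def)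
qed

lemma positive_op_set_adjoint:
  assumes "positive_op_set M \<Psi>"
  shows "positive_op_set M (adjoint_set M \<Psi>)"
proof -
  note D = positive_op_setD[OF assms]
  have "bounded_op_set M (adjoint_set M \<Psi>)"
  proof (rule bounded_op_setI)
    fix B assume "B \<in> adjoint_set M \<Psi>"
    then obtain A where A: "A \<in> \<Psi>" "is_adjoint M A B"
      by (auto simp: adjoint_set_def)
    then show "bounded_operator M B"
      by (simp add: is_adjoint_def)
    show "op_norm M B \<le> set_norm M \<Psi>"
      using adjoint_op_norm[OF D(2)[OF A(1)] A(2)] op_norm_le_set_norm[OF D(1) A(1)] by simp
  qed
  then show ?thesis
    using D by (auto simp: positive_op_set_def adjoint_set_def intro: adjoint_positive)
qed

lemma positive_op_set_star_pair:
  assumes "\<And>j. j \<in> {1..m} \<Longrightarrow> positive_op_set M (\<Psi> j)" "\<tau> permutes {1..m}" "\<nu> permutes {1..m}" "j \<in> {1..m}"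
  shows "positive_op_set M (star_pair M \<tau> \<nu> \<Psi> j)"
  unfolding star_pair_def using assms
  by (intro positive_op_set_mult positive_op_set_adjoint) (auto simp only: permutes_in_image)

lemma positive_op_set_Omega:
  assumes "\<And>j. j \<in> {1..m} \<Longrightarrow> positive_op_set M (star_pair M \<tau> \<nu> \<Psi> j)" "j \<in> {1..m}"
  shows "positive_op_set M (Omega_set M m \<tau> \<nu> \<Psi> j)"
  unfolding Omega_set_def using assms by (intro positive_op_set_prod) auto

section \<open>Hadamard means of sets and permutations of their factors\<close>

lemma kernel_hadamard_iff:
  "C \<in> kernel_hadamard M m (\<lambda>_. \<alpha>) \<Phi> \<longleftrightarrow>
    (\<exists>A a. (\<forall>j\<in>{1..m}. A j \<in> \<Phi> j \<and> has_nonneg_kernel M (A j) (a j)) \<and>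
      has_nonneg_kernel M C (\<lambda>x y. \<Prod>j\<in>{1..m}. a j x y powr \<alpha>))"
  by (simp add: kernel_hadamard_def hadamard_power_set_def)

lemma kernel_hadamard_cong:
  assumes "\<And>j. j \<in> {1..m} \<Longrightarrow> \<Phi> j = \<Phi>' j"
  shows "kernel_hadamard M m \<alpha> \<Phi> = kernel_hadamard M m \<alpha> \<Phi>'"
  unfolding kernel_hadamard_def hadamard_power_set_def using assms by (metis (no_types, lifting))

text \<open>Equal exponents make the product of kernels symmetric. Applied to the inverse
  permutation as well, the inclusion becomes an equality.\<close>

lemma kernel_hadamard_permute_subset:
  assumes \<pi>: "\<pi> permutes {1..m}"
  shows "kernel_hadamard M m (\<lambda>_. \<alpha>) \<Phi> \<subseteq> kernel_hadamard M m (\<lambda>_. \<alpha>) (\<Phi> \<circ> \<pi>)"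
proof
  fix C assume "C \<in> kernel_hadamard M m (\<lambda>_. \<alpha>) \<Phi>"
  then obtain A a where A: "\<And>j. j \<in> {1..m} \<Longrightarrow> A j \<in> \<Phi> j \<and> has_nonneg_kernel M (A j) (a j)"
    and C: "has_nonneg_kernel M C (\<lambda>x y. \<Prod>j\<in>{1..m}. a j x y powr \<alpha>)"
    unfolding kernel_hadamard_iff by blast
  have "(\<Prod>j\<in>{1..m}. a j x y powr \<alpha>) = (\<Prod>j\<in>{1..m}. (a \<circ> \<pi>) j x y powr \<alpha>)" for x y
    using prod.permute[OF \<pi>, of "\<lambda>j. a j x y powr \<alpha>"] by (simp add: o_def)
  then have "has_nonneg_kernel M C (\<lambda>x y. \<Prod>j\<in>{1..m}. (a \<circ> \<pi>) j x y powr \<alpha>)"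
    using C by simp
  moreover have "(A \<circ> \<pi>) j \<in> (\<Phi> \<circ> \<pi>) j \<and> has_nonneg_kernel M ((A \<circ> \<pi>) j) ((a \<circ> \<pi>) j)" if "j \<in> {1..m}" for j
    using A[of "\<pi> j"] that permutes_in_image[OF \<pi>, of j] by simp
  ultimately show "C \<in> kernel_hadamard M m (\<lambda>_. \<alpha>) (\<Phi> \<circ> \<pi>)"
    unfolding kernel_hadamard_iff by blast
qed

lemma kernel_hadamard_permute:
  assumes \<pi>: "\<pi> permutes {1..m}"
  shows "kernel_hadamard M m (\<lambda>_. \<alpha>) (\<Phi> \<circ> \<pi>) = kernel_hadamard M m (\<lambda>_. \<alpha>) \<Phi>"
  using kernel_hadamard_permute_subset[OF \<pi>, of M \<alpha> \<Phi>]
    kernel_hadamard_permute_subset[OF permutes_inv[OF \<pi>], of M \<alpha> "\<Phi> \<circ> \<pi>"]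
  by (simp add: comp_assoc permutes_inv_o[OF \<pi>])

lemma spectral_radius_nonneg:
  assumes "positive_op_set M \<Sigma>" "r \<in> {generalized_spectral_radius M, joint_spectral_radius M}"
  shows "0 \<le> r \<Sigma>"
  using assms generalized_spectral_radius_limsup(2) joint_spectral_radius_limit(2) by auto

text \<open>Addition of i modulo m on {1..m}, and the identity elsewhere because
  \<open>permutes\<close> demands it.\<close>

lemma cyclic_shift_permutes:
  fixes i m :: nat
  assumes "i < m"
  shows "(\<lambda>j. if j \<in> {1..m} then if i + j \<le> m then i + j else i + j - m else j) permutes {1..m}"
    (is "?\<sigma> permutes _")
proof (rule bij_imp_permutes)
  have "inj_on ?\<sigma> {1..m}"
    using assms by (auto simp: inj_on_def split: if_splits)
  moreover have "?\<sigma> ` {1..m} \<subseteq> {1..m}"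
    using assms by auto
  ultimately show "bij_betw ?\<sigma> {1..m} {1..m}"
    unfolding bij_betw_def using endo_inj_surj[of "{1..m}" ?\<sigma>] by blast
qed auto

text \<open>Following j through the shifts by 0, ..., m - 1 gives the order of the factors in
  \<open>Omega_set\<close>.\<close>

lemma map_cyclic_shift:
  fixes m j :: nat
  assumes "j \<in> {1..m}"
  shows "map (\<lambda>i. if j \<in> {1..m} then if i + j \<le> m then i + j else i + j - m else j) [0..<m] = [j..<Suc m] @ [1..<j]"
proof (rule nth_equalityI)
  show "length (map (\<lambda>i. if j \<in> {1..m} then if i + j \<le> m then i + j else i + j - m else j) [0..<m]) = length ([j..<Suc m] @ [1..<j])"
    using assms by auto
qed (use assms in \<open>auto simp: nth_append simp del: upt_Suc\<close>)

section \<open>The three inequalities for Hadamard means of sets\<close>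

context sigma_finite_measure
begin

context
  fixes m :: nat and \<alpha> :: real
  assumes \<alpha>: "hadamard_exponent M m \<alpha>"
begin

abbreviation "hadamard \<equiv> kernel_hadamard M m (\<lambda>_. \<alpha>)"

lemma kernel_hadamard_bounds:
  assumes C: "C \<in> hadamard \<Phi>" and \<Phi>: "\<And>j. j \<in> {1..m} \<Longrightarrow> bounded_op_set M (\<Phi> j)"
  shows "positive_operator M C" "bounded_operator M C"
    "op_norm M C \<le> (\<Prod>j\<in>{1..m}. set_norm M (\<Phi> j) powr \<alpha>)"
proof -
  obtain A a where A: "\<And>j. j \<in> {1..m} \<Longrightarrow> A j \<in> \<Phi> j" "\<And>j. j \<in> {1..m} \<Longrightarrow> has_nonneg_kernel M (A j) (a j)"
    and kC: "has_nonneg_kernel M C (\<lambda>x y. \<Prod>j\<in>{1..m}. a j x y powr \<alpha>)"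
    using C unfolding kernel_hadamard_iff by blast
  have bA: "bounded_operator M (A j)" if "j \<in> {1..m}" for j
    using bounded_op_setD[OF \<Phi>[OF that] A(1)[OF that]] .
  show "positive_operator M C"
    by (rule has_nonneg_kernel_positive[OF kC])
  show "bounded_operator M C"
    by (rule hadamard_kernel_bound(2)[OF \<alpha> A(2) bA kC])
  have "op_norm M C \<le> (\<Prod>j\<in>{1..m}. op_norm M (A j) powr \<alpha>)"
    by (rule hadamard_kernel_bound(3)[OF \<alpha> A(2) bA kC])
  also have "\<dots> \<le> (\<Prod>j\<in>{1..m}. set_norm M (\<Phi> j) powr \<alpha>)"
    using bA A \<Phi> hadamard_exponent_pos[OF \<alpha>]
    by (intro prod_mono conjI powr_mono2 op_norm_le_set_norm op_norm_nonneg) auto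
  finally show "op_norm M C \<le> (\<Prod>j\<in>{1..m}. set_norm M (\<Phi> j) powr \<alpha>)" .
qed

lemma kernel_hadamard_positive_op_set:
  assumes "\<And>j. j \<in> {1..m} \<Longrightarrow> bounded_op_set M (\<Phi> j)"
  shows "positive_op_set M (hadamard \<Phi>)"
  unfolding positive_op_set_def
  using kernel_hadamard_bounds[OF _ assms] by (auto intro!: bounded_op_setI)

lemma kernel_hadamard_mult_dominated:
  assumes A: "A \<in> hadamard \<Phi>" and B: "B \<in> hadamard \<Phi>'"
    and \<Phi>: "\<And>j. j \<in> {1..m} \<Longrightarrow> bounded_op_set M (\<Phi> j)" "\<And>j. j \<in> {1..m} \<Longrightarrow> bounded_op_set M (\<Phi>' j)"
  shows "\<exists>E\<in>hadamard (\<lambda>j. op_set_mult (\<Phi> j) (\<Phi>' j)). dominated M (A \<circ> B) E"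
proof -
  obtain F a where F: "\<And>j. j \<in> {1..m} \<Longrightarrow> F j \<in> \<Phi> j" "\<And>j. j \<in> {1..m} \<Longrightarrow> has_nonneg_kernel M (F j) (a j)"
    and kA: "has_nonneg_kernel M A (\<lambda>x y. \<Prod>j\<in>{1..m}. a j x y powr \<alpha>)"
    using A unfolding kernel_hadamard_iff by blast
  obtain G b where G: "\<And>j. j \<in> {1..m} \<Longrightarrow> G j \<in> \<Phi>' j" "\<And>j. j \<in> {1..m} \<Longrightarrow> has_nonneg_kernel M (G j) (b j)"
    and kB: "has_nonneg_kernel M B (\<lambda>x y. \<Prod>j\<in>{1..m}. b j x y powr \<alpha>)"
    using B unfolding kernel_hadamard_iff by blast
  let ?e = "\<lambda>j x y. LINT z|M. a j x z * b j z y"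
  have k: "has_nonneg_kernel M (F j \<circ> G j) (?e j)" if "j \<in> {1..m}" for j
    by (rule has_nonneg_kernel_comp[OF F(2)[OF that] G(2)[OF that]])
  have bd: "bounded_operator M (F j \<circ> G j)" if "j \<in> {1..m}" for j
    by (rule bounded_operator_comp(1)[OF bounded_op_setD[OF \<Phi>(1)[OF that] F(1)[OF that]] bounded_op_setD[OF \<Phi>(2)[OF that] G(1)[OF that]]])
  let ?E = "kernel_oper M (\<lambda>x y. \<Prod>j\<in>{1..m}. ?e j x y powr \<alpha>)"
  have kE: "has_nonneg_kernel M ?E (\<lambda>x y. \<Prod>j\<in>{1..m}. ?e j x y powr \<alpha>)"
    by (rule hadamard_kernel_bound(1)[OF \<alpha> k bd])
  have "?E \<in> hadamard (\<lambda>j. op_set_mult (\<Phi> j) (\<Phi>' j))"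
    unfolding kernel_hadamard_iff
    by (intro exI[of _ "\<lambda>j. F j \<circ> G j"] exI[of _ ?e] conjI ballI kE k op_set_multI F G)
  moreover have "dominated M (A \<circ> B) ?E"
    by (rule hadamard_comp_dominated[OF \<alpha> F(2) G(2) kA kB kE])
  ultimately show ?thesis
    by blast
qed

text \<open>Each \<open>\<Phi>\<close> is a row of operator sets, one per Hadamard factor: a product
  of row means is dominated by a mean of column products. The list is nonempty because the identity
  need not have a kernel.\<close>

lemma kernel_hadamard_prod_dominated:
  assumes "\<Phi>s \<noteq> []" "A \<in> op_set_prod (map hadamard \<Phi>s)"
    and "\<And>\<Phi> j. \<Phi> \<in> set \<Phi>s \<Longrightarrow> j \<in> {1..m} \<Longrightarrow> positive_op_set M (\<Phi> j)"
  shows "\<exists>E\<in>hadamard (\<lambda>j. op_set_prod (map (\<lambda>\<Phi>. \<Phi> j) \<Phi>s)). dominated M A E"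
  using assms
proof (induction \<Phi>s arbitrary: A rule: list_nonempty_induct)
  case (single \<Phi>)
  then show ?case
    by (auto intro!: bexI[of _ A])
next
  case (cons \<Phi> \<Phi>s)
  then obtain B C where A: "B \<in> hadamard \<Phi>" "C \<in> op_set_prod (map hadamard \<Phi>s)" "A = B \<circ> C"
    by (auto simp: op_set_mult_iff)
  obtain E where E: "E \<in> hadamard (\<lambda>j. op_set_prod (map (\<lambda>\<Phi>. \<Phi> j) \<Phi>s))" "dominated M C E"
    using cons.IH[OF A(2)] cons.prems(2) by auto
  have b1: "bounded_op_set M (\<Phi> j)" if "j \<in> {1..m}" for j
    using cons.prems(2) that by (auto dest: positive_op_setD(1))
  have b2: "bounded_op_set M (op_set_prod (map (\<lambda>\<Phi>. \<Phi> j) \<Phi>s))" if "j \<in> {1..m}" for j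
    using cons.prems(2) that by (intro positive_op_setD(1) positive_op_set_prod) auto
  obtain F where F: "F \<in> hadamard (\<lambda>j. op_set_mult (\<Phi> j) (op_set_prod (map (\<lambda>\<Phi>. \<Phi> j) \<Phi>s)))" "dominated M (B \<circ> E) F"
    using kernel_hadamard_mult_dominated[OF A(1) E(1) b1 b2] by blast
  have pC: "positive_operator M C"
  proof (rule positive_op_setD(3)[OF positive_op_set_prod A(2)])
    fix \<Theta> assume "\<Theta> \<in> set (map hadamard \<Phi>s)"
    then obtain \<Phi>' where \<Phi>': "\<Phi>' \<in> set \<Phi>s" "\<Theta> = hadamard \<Phi>'"
      by auto
    show "positive_op_set M \<Theta>"
      unfolding \<Phi>'(2)
      by (intro kernel_hadamard_positive_op_set positive_op_setD(1)[OF cons.prems(2)]) (use \<Phi>'(1) in auto)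
  qed
  have "dominated M (B \<circ> C) (B \<circ> E)"
    by (intro dominated_comp kernel_hadamard_bounds(1)[OF A(1) b1] kernel_hadamard_bounds(1)[OF E(1) b2] pC E(2) dominated_refl)
  then have "dominated M A F"
    unfolding A(3) using F(2) by (rule dominated_trans)
  then show ?case
    using F(1) by auto
qed

lemma set_norm_hadamard_le_spectral_radius:
  assumes \<Psi>: "\<And>j. j \<in> {1..m} \<Longrightarrow> positive_op_set M (\<Psi> j)"
    and \<tau>: "\<tau> permutes {1..m}" and \<nu>: "\<nu> permutes {1..m}"
    and r: "r \<in> {generalized_spectral_radius M, joint_spectral_radius M}"
  shows "set_norm M (hadamard \<Psi>) \<le> r (hadamard (star_pair M \<tau> \<nu> \<Psi>)) powr (1 / 2)"
proof (rule set_norm_least)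
  let ?S = "star_pair M \<tau> \<nu> \<Psi>"
  have pH: "positive_op_set M (hadamard ?S)"
    by (intro kernel_hadamard_positive_op_set positive_op_setD(1) positive_op_set_star_pair[OF \<Psi> \<tau> \<nu>])
  fix C assume C: "C \<in> hadamard \<Psi>"
  then obtain A a where A: "\<And>j. j \<in> {1..m} \<Longrightarrow> A j \<in> \<Psi> j" "\<And>j. j \<in> {1..m} \<Longrightarrow> has_nonneg_kernel M (A j) (a j)"
    and kC: "has_nonneg_kernel M C (\<lambda>x y. \<Prod>j\<in>{1..m}. a j x y powr \<alpha>)"
    unfolding kernel_hadamard_iff by blast
  have bC: "bounded_operator M C" "positive_operator M C"
    using kernel_hadamard_bounds(1,2)[OF C positive_op_setD(1)[OF \<Psi>]] by blast+
  have bA: "bounded_operator M (A j)" if "j \<in> {1..m}" for j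
    by (rule positive_op_setD(2)[OF \<Psi>[OF that] A(1)[OF that]])
  define B where "B j = kernel_oper M (\<lambda>x y. a j y x)" for j
  have B: "has_nonneg_kernel M (B j) (\<lambda>x y. a j y x)" "is_adjoint M (A j) (B j)" if "j \<in> {1..m}" for j
    unfolding B_def using kernel_transpose[OF A(2)[OF that] bA[OF that]] by auto
  define C' where "C' = kernel_oper M (\<lambda>x y. \<Prod>j\<in>{1..m}. a j y x powr \<alpha>)"
  have C': "has_nonneg_kernel M C' (\<lambda>x y. \<Prod>j\<in>{1..m}. a j y x powr \<alpha>)" "is_adjoint M C C'"
    unfolding C'_def using kernel_transpose[OF kC bC(1)] by auto
  have t: "\<tau> j \<in> {1..m}" "\<nu> j \<in> {1..m}" if "j \<in> {1..m}" for j
    using that permutes_in_image[OF \<tau>] permutes_in_image[OF \<nu>] by auto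
  \<comment> \<open>Relabelling the adjoint along \<tau> and C along \<nu> changes neither kernel,
    but aligns their factors with the pairs in \<open>star_pair\<close>.\<close>
  have kC't: "has_nonneg_kernel M C' (\<lambda>x y. \<Prod>j\<in>{1..m}. a (\<tau> j) y x powr \<alpha>)"
    using C'(1) prod.permute[OF \<tau>, of "\<lambda>j. a j _ _ powr \<alpha>"] by (simp add: o_def)
  have kCn: "has_nonneg_kernel M C (\<lambda>x y. \<Prod>j\<in>{1..m}. a (\<nu> j) x y powr \<alpha>)"
    using kC prod.permute[OF \<nu>, of "\<lambda>j. a j _ _ powr \<alpha>"] by (simp add: o_def)
  let ?e = "\<lambda>j x y. LINT z|M. a (\<tau> j) z x * a (\<nu> j) z y"
  have E: "B (\<tau> j) \<circ> A (\<nu> j) \<in> ?S j" "has_nonneg_kernel M (B (\<tau> j) \<circ> A (\<nu> j)) (?e j)" if "j \<in> {1..m}" for j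
  proof -
    have "B (\<tau> j) \<in> adjoint_set M (\<Psi> (\<tau> j))"
      using A(1)[OF t(1)[OF that]] B(2)[OF t(1)[OF that]] unfolding adjoint_set_def by blast
    then show "B (\<tau> j) \<circ> A (\<nu> j) \<in> ?S j"
      unfolding star_pair_def by (intro op_set_multI A(1) t(2) that)
    show "has_nonneg_kernel M (B (\<tau> j) \<circ> A (\<nu> j)) (?e j)"
      by (rule has_nonneg_kernel_comp[OF B(1)[OF t(1)[OF that]] A(2)[OF t(2)[OF that]]])
  qed
  have bE: "bounded_operator M (B (\<tau> j) \<circ> A (\<nu> j))" if "j \<in> {1..m}" for j
    by (rule positive_op_setD(2)[OF positive_op_set_star_pair[OF \<Psi> \<tau> \<nu> that] E(1)[OF that]])
  let ?D = "kernel_oper M (\<lambda>x y. \<Prod>j\<in>{1..m}. ?e j x y powr \<alpha>)"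
  have kD: "has_nonneg_kernel M ?D (\<lambda>x y. \<Prod>j\<in>{1..m}. ?e j x y powr \<alpha>)"
    by (rule hadamard_kernel_bound(1)[OF \<alpha> E(2) bE])
  have D: "?D \<in> hadamard ?S"
    unfolding kernel_hadamard_iff
    by (intro exI[of _ "\<lambda>j. B (\<tau> j) \<circ> A (\<nu> j)"] exI[of _ ?e] conjI ballI kD E)
  have "dominated M (C' \<circ> C) ?D"
    by (rule hadamard_comp_dominated[OF \<alpha> B(1)[OF t(1)] A(2)[OF t(2)] kC't kCn kD])
  then have "(op_norm M C)\<^sup>2 \<le> op_spectral_radius M ?D"
    by (intro adjoint_norm_square_le_spectral_radius[OF bC C'(2)] positive_op_setD(2,3)[OF pH D])
  also have "\<dots> \<le> r (hadamard ?S)"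
    by (rule op_spectral_radius_le_spectral_radius[OF pH D r])
  finally have "sqrt ((op_norm M C)\<^sup>2) \<le> sqrt (r (hadamard ?S))"
    by (rule real_sqrt_le_mono)
  then show "op_norm M C \<le> r (hadamard ?S) powr (1 / 2)"
    using op_norm_nonneg[OF bC(1)] spectral_radius_nonneg[OF pH r] by (simp add: powr_half_sqrt)
qed simp

lemma spectral_radius_hadamard_le_cyclic:
  assumes S: "\<And>j. j \<in> {1..m} \<Longrightarrow> positive_op_set M (S j)"
    and r: "r \<in> {generalized_spectral_radius M, joint_spectral_radius M}"
  shows "r (hadamard S) \<le> r (hadamard (\<lambda>j. op_set_prod (map S ([j..<Suc m] @ [1..<j])))) powr (1 / real m)"
proof (rule spectral_radius_le_root[OF _ _ _ _ r])
  let ?\<Omega> = "\<lambda>j. op_set_prod (map S ([j..<Suc m] @ [1..<j]))"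
  show m: "1 \<le> m"
    using \<alpha> by (simp add: hadamard_exponent_def)
  have p\<Omega>: "positive_op_set M (?\<Omega> j)" if "j \<in> {1..m}" for j
    using that by (intro positive_op_set_prod) (auto intro!: S)
  show "positive_op_set M (hadamard S)" "positive_op_set M (hadamard ?\<Omega>)"
    by (intro kernel_hadamard_positive_op_set positive_op_setD(1) S p\<Omega>; assumption)+
  define \<sigma> where "\<sigma> i j = (if j \<in> {1..m} then if i + j \<le> m then i + j else i + j - m else j)" for i j
  have \<sigma>: "\<sigma> i permutes {1..m}" if "i < m" for i
    unfolding \<sigma>_def[abs_def] by (rule cyclic_shift_permutes[OF that])
  \<comment> \<open>m copies of one set, written differently: row i has its factors shifted by i,
    and the shift by 0 comes first so that column j starts with \<open>S j\<close>.\<close>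
  let ?rows = "map (\<lambda>i. S \<circ> \<sigma> i) [0..<m]"
  fix A assume "A \<in> op_set_power (hadamard S) m"
  also have "op_set_power (hadamard S) m = op_set_prod (map hadamard ?rows)"
  proof -
    have "map hadamard ?rows = map (\<lambda>_. hadamard S) [0..<m]"
      by (auto simp: kernel_hadamard_permute[OF \<sigma>])
    then show ?thesis
      by (simp add: op_set_power_def map_replicate_const)
  qed
  finally have "\<exists>E\<in>hadamard (\<lambda>j. op_set_prod (map (\<lambda>\<Phi>. \<Phi> j) ?rows)). dominated M A E"
  proof (rule kernel_hadamard_prod_dominated[rotated])
    fix \<Phi> j assume "\<Phi> \<in> set ?rows" "j \<in> {1..m}"
    then show "positive_op_set M (\<Phi> j)"
      using permutes_in_image[OF \<sigma>] by (auto intro!: S)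
  qed (use m in auto)
  also have "hadamard (\<lambda>j. op_set_prod (map (\<lambda>\<Phi>. \<Phi> j) ?rows)) = hadamard ?\<Omega>"
  proof (rule kernel_hadamard_cong)
    fix j assume j: "j \<in> {1..m}"
    have "map (\<lambda>\<Phi>. \<Phi> j) ?rows = map S (map (\<lambda>i. \<sigma> i j) [0..<m])"
      by simp
    also have "map (\<lambda>i. \<sigma> i j) [0..<m] = [j..<Suc m] @ [1..<j]"
      unfolding \<sigma>_def by (rule map_cyclic_shift[OF j])
    finally show "op_set_prod (map (\<lambda>\<Phi>. \<Phi> j) ?rows) = ?\<Omega> j"
      by (rule arg_cong)
  qed
  finally show "\<exists>B\<in>hadamard ?\<Omega>. dominated M A B" .
qed

lemma kernel_hadamard_power_dominated:
  assumes \<Omega>: "\<And>j. j \<in> {1..m} \<Longrightarrow> positive_op_set M (\<Omega> j)" and k: "1 \<le> k"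
    and A: "A \<in> op_set_power (hadamard \<Omega>) k"
  shows "\<exists>E\<in>hadamard (\<lambda>j. op_set_power (\<Omega> j) k). dominated M A E"
proof -
  have "A \<in> op_set_prod (map hadamard (replicate k \<Omega>))"
    using A by (simp add: op_set_power_def)
  from kernel_hadamard_prod_dominated[OF _ this] show ?thesis
    using \<Omega> k by (auto simp: op_set_power_def)
qed

lemma op_set_power_singleton: "op_set_power {W} n = {W ^^ n}"
  by (induction n) (auto simp: op_set_mult_def)

text \<open>Powers of \<open>E\<close> are dominated by Hadamard means of powers of its factors, so
  the norm bound for means passes to the limit in Gelfand's formula.\<close>

lemma hadamard_op_spectral_radius_le:
  assumes E: "E \<in> hadamard \<Phi>" and \<Phi>: "\<And>j. j \<in> {1..m} \<Longrightarrow> positive_op_set M (\<Phi> j)"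
  shows "op_spectral_radius M E \<le> (\<Prod>j\<in>{1..m}. set_spectral_radius M (\<Phi> j) powr \<alpha>)"
proof -
  obtain W w where W: "\<And>j. j \<in> {1..m} \<Longrightarrow> W j \<in> \<Phi> j" "\<And>j. j \<in> {1..m} \<Longrightarrow> has_nonneg_kernel M (W j) (w j)"
    and kE: "has_nonneg_kernel M E (\<lambda>x y. \<Prod>j\<in>{1..m}. w j x y powr \<alpha>)"
    using E unfolding kernel_hadamard_iff by blast
  note a0 = hadamard_exponent_pos[OF \<alpha>]
  note bW = positive_op_setD(2,3)[OF \<Phi> W(1)]
  have bWn: "bounded_operator M (W j ^^ n)" if "j \<in> {1..m}" for j n
    by (rule bounded_operator_funpow[OF bW(1)[OF that that]])
  have bE: "bounded_operator M E" "positive_operator M E"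
    using kernel_hadamard_bounds(1,2)[OF E positive_op_setD(1)[OF \<Phi>]] by blast+
  have pW: "positive_op_set M {W j}" if "j \<in> {1..m}" for j
    using bW[OF that that] by (auto simp: positive_op_set_def bounded_op_set_def)
  \<comment> \<open>Shrinking every factor set to one operator forces the dominating means to be
    built from powers of the chosen \<open>W j\<close>.\<close>
  have EW: "E \<in> hadamard (\<lambda>j. {W j})"
    unfolding kernel_hadamard_iff using W(2) kE by blast
  have le: "op_norm M (E ^^ n) \<le> 4 * (\<Prod>j\<in>{1..m}. op_norm M (W j ^^ n) powr \<alpha>)" if n: "1 \<le> n" for n
  proof -
    obtain F where F: "F \<in> hadamard (\<lambda>j. op_set_power {W j} n)" "dominated M (E ^^ n) F"
      using kernel_hadamard_power_dominated[OF pW n funpow_in_op_set_power[OF EW]] by blast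
    have b: "bounded_op_set M (op_set_power {W j} n)" if "j \<in> {1..m}" for j
      by (intro positive_op_setD(1) positive_op_set_power pW that)
    have "op_norm M (E ^^ n) \<le> 4 * op_norm M F"
      by (intro dominated_op_norm positive_operator_funpow bE(2) kernel_hadamard_bounds(2)[OF F(1) b] F(2))
    also have "op_norm M F \<le> (\<Prod>j\<in>{1..m}. set_norm M (op_set_power {W j} n) powr \<alpha>)"
      by (rule kernel_hadamard_bounds(3)[OF F(1) b])
    also have "\<dots> = (\<Prod>j\<in>{1..m}. op_norm M (W j ^^ n) powr \<alpha>)"
      using op_norm_nonneg[OF bWn] by (intro prod.cong) (auto simp: op_set_power_singleton set_norm_def sup_max max_absorb2 cSup_insert)
    finally show ?thesis
      by simp
  qed
  have "(\<lambda>n. 4 powr (1 / real n) * (\<Prod>j\<in>{1..m}. (op_norm M (W j ^^ n) powr (1 / real n)) powr \<alpha>))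
      \<longlonglongrightarrow> 4 powr 0 * (\<Prod>j\<in>{1..m}. op_spectral_radius M (W j) powr \<alpha>)"
    using a0 op_spectral_radius_limit(1)[OF bW]
    by (intro tendsto_mult tendsto_powr' tendsto_prod tendsto_const lim_1_over_n) auto
  then have lim: "(\<lambda>n. 4 powr (1 / real n) * (\<Prod>j\<in>{1..m}. (op_norm M (W j ^^ n) powr (1 / real n)) powr \<alpha>))
      \<longlonglongrightarrow> (\<Prod>j\<in>{1..m}. op_spectral_radius M (W j) powr \<alpha>)"
    by simp
  have "op_spectral_radius M E \<le> (\<Prod>j\<in>{1..m}. op_spectral_radius M (W j) powr \<alpha>)"
  proof (rule LIMSEQ_le[OF op_spectral_radius_limit(1)[OF bE] lim], intro exI[of _ 1] allI impI)
    fix n :: nat assume n: "1 \<le> n"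
    have "op_norm M (E ^^ n) powr (1 / real n) \<le> (4 * (\<Prod>j\<in>{1..m}. op_norm M (W j ^^ n) powr \<alpha>)) powr (1 / real n)"
      by (intro powr_mono2 le[OF n] op_norm_nonneg bounded_operator_funpow bE) auto
    also have "\<dots> = 4 powr (1 / real n) * (\<Prod>j\<in>{1..m}. (op_norm M (W j ^^ n) powr (1 / real n)) powr \<alpha>)"
      by (simp add: powr_mult prod_nonneg prod_powr_distrib[symmetric] powr_powr mult.commute)
    finally show "op_norm M (E ^^ n) powr (1 / real n)
        \<le> 4 powr (1 / real n) * (\<Prod>j\<in>{1..m}. (op_norm M (W j ^^ n) powr (1 / real n)) powr \<alpha>)" .
  qed
  also have "\<dots> \<le> (\<Prod>j\<in>{1..m}. set_spectral_radius M (\<Phi> j) powr \<alpha>)"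
    using a0 W(1) \<Phi> op_spectral_radius_limit(2)[OF bW]
    by (intro prod_mono conjI powr_mono2 op_spectral_radius_le_set) auto
  finally show ?thesis .
qed

text \<open>Every \<open>?\<Omega> j\<close> is Q P where \<open>?\<Theta>\<close> is P Q, so the m
  factors of the Hadamard bound coincide and give the exponent \<alpha> m. The generalized radius
  uses this at each power k, whereas for the joint radius the factors become equal only in the
  limit.\<close>

lemma spectral_radius_hadamard_cyclic_le:
  assumes S: "\<And>j. j \<in> {1..m} \<Longrightarrow> positive_op_set M (S j)"
    and r: "r \<in> {generalized_spectral_radius M, joint_spectral_radius M}"
  shows "r (hadamard (\<lambda>j. op_set_prod (map S ([j..<Suc m] @ [1..<j]))))
    \<le> r (op_set_prod (map S [1..<Suc m])) powr (\<alpha> * real m)"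
proof -
  let ?\<Omega> = "\<lambda>j. op_set_prod (map S ([j..<Suc m] @ [1..<j]))"
  let ?\<Theta> = "op_set_prod (map S [1..<Suc m])"
  note a0 = hadamard_exponent_pos[OF \<alpha>]
  have m: "1 \<le> m"
    using \<alpha> by (simp add: hadamard_exponent_def)
  have p\<Omega>: "positive_op_set M (?\<Omega> j)" if "j \<in> {1..m}" for j
    using that by (intro positive_op_set_prod) (auto intro!: S)
  have p\<Theta>: "positive_op_set M ?\<Theta>"
    by (intro positive_op_set_prod) (auto intro!: S)
  have pH: "positive_op_set M (hadamard ?\<Omega>)"
    by (intro kernel_hadamard_positive_op_set positive_op_setD(1) p\<Omega>)
  have cyc: "\<exists>P Q. positive_op_set M P \<and> positive_op_set M Q \<and> ?\<Omega> j = op_set_mult Q P \<and> ?\<Theta> = op_set_mult P Q"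
    if j: "j \<in> {1..m}" for j
  proof (intro exI conjI)
    show "positive_op_set M (op_set_prod (map S [1..<j]))" "positive_op_set M (op_set_prod (map S [j..<Suc m]))"
      using j by (intro positive_op_set_prod; auto intro!: S)+
    show "?\<Omega> j = op_set_mult (op_set_prod (map S [j..<Suc m])) (op_set_prod (map S [1..<j]))"
      unfolding map_append op_set_prod_append ..
    have "[1..<Suc m] = [1..<j] @ [j..<Suc m]"
      using j upt_add_eq_append[of 1 j "Suc m - j"] by simp
    then show "?\<Theta> = op_set_mult (op_set_prod (map S [1..<j])) (op_set_prod (map S [j..<Suc m]))"
      by (simp only: map_append op_set_prod_append)
  qed
  have ssr: "set_spectral_radius M (op_set_power (?\<Omega> j) k) = set_spectral_radius M (op_set_power ?\<Theta> k)"
    if "j \<in> {1..m}" "1 \<le> k" for j k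
    using cyc[OF that(1)] set_spectral_radius_power_comm[OF _ _ that(2)] by metis
  have jsr: "joint_spectral_radius M (?\<Omega> j) = joint_spectral_radius M ?\<Theta>" if "j \<in> {1..m}" for j
    using cyc[OF that] joint_spectral_radius_comm by metis
  have const: "(\<Prod>j\<in>{1..m}. c powr \<alpha>) = c powr (\<alpha> * real m)" for c :: real
    using m by (simp add: powr_realpow'[symmetric] powr_powr)
  note pk = positive_op_set_power[OF p\<Omega>]
  note bk = positive_op_setD(1)[OF pk]
  have gen: "generalized_spectral_radius M (hadamard ?\<Omega>) \<le> generalized_spectral_radius M ?\<Theta> powr (\<alpha> * real m)"
  proof (rule generalized_spectral_radius_le_powr[OF pH p\<Theta>])
    show "0 < \<alpha> * real m"
      using a0 m by simp
    fix k :: nat assume k: "1 \<le> k"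
    show "set_spectral_radius M (op_set_power (hadamard ?\<Omega>) k) \<le> set_spectral_radius M (op_set_power ?\<Theta> k) powr (\<alpha> * real m)"
    proof (rule set_spectral_radius_least)
      fix A assume A: "A \<in> op_set_power (hadamard ?\<Omega>) k"
      then obtain E where E: "E \<in> hadamard (\<lambda>j. op_set_power (?\<Omega> j) k)" "dominated M A E"
        using kernel_hadamard_power_dominated[where \<Omega> = ?\<Omega>, OF p\<Omega> k A] by blast
      have "op_spectral_radius M A \<le> op_spectral_radius M E"
        by (intro op_spectral_radius_mono positive_op_setD(2,3)[OF positive_op_set_power[OF pH] A]
            kernel_hadamard_bounds(1,2)[OF E(1) bk] E(2))
      also have "\<dots> \<le> (\<Prod>j\<in>{1..m}. set_spectral_radius M (op_set_power (?\<Omega> j) k) powr \<alpha>)"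
        by (rule hadamard_op_spectral_radius_le[OF E(1) pk])
      also have "\<dots> = (\<Prod>j\<in>{1..m}. set_spectral_radius M (op_set_power ?\<Theta> k) powr \<alpha>)"
        using ssr[OF _ k] by (intro prod.cong refl) simp
      finally show "op_spectral_radius M A \<le> set_spectral_radius M (op_set_power ?\<Theta> k) powr (\<alpha> * real m)"
        unfolding const .
    qed simp
  qed
  have joint: "joint_spectral_radius M (hadamard ?\<Omega>) \<le> joint_spectral_radius M ?\<Theta> powr (\<alpha> * real m)"
  proof -
    have le: "set_norm M (op_set_power (hadamard ?\<Omega>) k) \<le> 4 * (\<Prod>j\<in>{1..m}. set_norm M (op_set_power (?\<Omega> j) k) powr \<alpha>)"
      if k: "1 \<le> k" for k
    proof (rule set_norm_least)
      fix A assume A: "A \<in> op_set_power (hadamard ?\<Omega>) k"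
      then obtain E where E: "E \<in> hadamard (\<lambda>j. op_set_power (?\<Omega> j) k)" "dominated M A E"
        using kernel_hadamard_power_dominated[where \<Omega> = ?\<Omega>, OF p\<Omega> k A] by blast
      have "op_norm M A \<le> 4 * op_norm M E"
        by (intro dominated_op_norm positive_op_setD(3)[OF positive_op_set_power[OF pH] A] kernel_hadamard_bounds(2)[OF E(1) bk] E(2))
      also have "op_norm M E \<le> (\<Prod>j\<in>{1..m}. set_norm M (op_set_power (?\<Omega> j) k) powr \<alpha>)"
        by (rule kernel_hadamard_bounds(3)[OF E(1) bk])
      finally show "op_norm M A \<le> 4 * (\<Prod>j\<in>{1..m}. set_norm M (op_set_power (?\<Omega> j) k) powr \<alpha>)"
        by simp
    qed (simp add: prod_nonneg)
    have "(\<lambda>k. 4 powr (1 / real k) * (\<Prod>j\<in>{1..m}. (set_norm M (op_set_power (?\<Omega> j) k) powr (1 / real k)) powr \<alpha>))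
        \<longlonglongrightarrow> 4 powr 0 * (\<Prod>j\<in>{1..m}. joint_spectral_radius M (?\<Omega> j) powr \<alpha>)"
      using a0 joint_spectral_radius_limit(1)[OF p\<Omega>]
      by (intro tendsto_mult tendsto_powr' tendsto_prod tendsto_const lim_1_over_n) auto
    also have "4 powr 0 * (\<Prod>j\<in>{1..m}. joint_spectral_radius M (?\<Omega> j) powr \<alpha>) = (\<Prod>j\<in>{1..m}. joint_spectral_radius M ?\<Theta> powr \<alpha>)"
      using jsr by simp
    also have "\<dots> = joint_spectral_radius M ?\<Theta> powr (\<alpha> * real m)"
      by (rule const)
    finally have lim: "(\<lambda>k. 4 powr (1 / real k) * (\<Prod>j\<in>{1..m}. (set_norm M (op_set_power (?\<Omega> j) k) powr (1 / real k)) powr \<alpha>))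
        \<longlonglongrightarrow> joint_spectral_radius M ?\<Theta> powr (\<alpha> * real m)" .
    show ?thesis
    proof (rule LIMSEQ_le[OF joint_spectral_radius_limit(1)[OF pH] lim], intro exI[of _ 1] allI impI)
      fix k :: nat assume k: "1 \<le> k"
      have "set_norm M (op_set_power (hadamard ?\<Omega>) k) powr (1 / real k)
          \<le> (4 * (\<Prod>j\<in>{1..m}. set_norm M (op_set_power (?\<Omega> j) k) powr \<alpha>)) powr (1 / real k)"
        by (intro powr_mono2 le[OF k] set_norm_nonneg positive_op_setD(1) positive_op_set_power pH) auto
      also have "\<dots> = 4 powr (1 / real k) * (\<Prod>j\<in>{1..m}. (set_norm M (op_set_power (?\<Omega> j) k) powr (1 / real k)) powr \<alpha>)"
        by (simp add: powr_mult prod_nonneg prod_powr_distrib[symmetric] powr_powr mult.commute)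
      finally show "set_norm M (op_set_power (hadamard ?\<Omega>) k) powr (1 / real k)
          \<le> 4 powr (1 / real k) * (\<Prod>j\<in>{1..m}. (set_norm M (op_set_power (?\<Omega> j) k) powr (1 / real k)) powr \<alpha>)" .
    qed
  qed
  show ?thesis
    using r gen joint by auto
qed

text \<open>Square roots of the preceding bounds: (1 / m) / 2 and \<alpha> m / (2 m) are the
  exponents that result.\<close>

lemma hadamard_spectral_radius_inequalities:
  assumes \<Psi>: "\<And>j. j \<in> {1..m} \<Longrightarrow> positive_op_set M (\<Psi> j)"
    and \<tau>: "\<tau> permutes {1..m}" and \<nu>: "\<nu> permutes {1..m}"
    and r: "r \<in> {generalized_spectral_radius M, joint_spectral_radius M}"
  shows "set_norm M (hadamard \<Psi>) \<le> r (hadamard (star_pair M \<tau> \<nu> \<Psi>)) powr (1 / 2)"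
    and "r (hadamard (star_pair M \<tau> \<nu> \<Psi>)) powr (1 / 2)
      \<le> r (hadamard (Omega_set M m \<tau> \<nu> \<Psi>)) powr (1 / (2 * real m))"
    and "r (hadamard (Omega_set M m \<tau> \<nu> \<Psi>)) powr (1 / (2 * real m))
      \<le> r (op_set_prod (map (star_pair M \<tau> \<nu> \<Psi>) [1..<Suc m])) powr (\<alpha> / 2)"
proof -
  let ?S = "star_pair M \<tau> \<nu> \<Psi>" and ?\<Omega> = "Omega_set M m \<tau> \<nu> \<Psi>"
  have m: "1 \<le> m"
    using \<alpha> by (simp add: hadamard_exponent_def)
  note S = positive_op_set_star_pair[OF \<Psi> \<tau> \<nu>]
  have \<Omega>_eq: "?\<Omega> = (\<lambda>j. op_set_prod (map ?S ([j..<Suc m] @ [1..<j])))"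
    by (simp add: fun_eq_iff Omega_set_def)
  have nn: "0 \<le> r (hadamard ?S)" "0 \<le> r (hadamard ?\<Omega>)"
    by (intro spectral_radius_nonneg[OF _ r] kernel_hadamard_positive_op_set positive_op_setD(1)
        positive_op_set_Omega S; assumption)+
  show "set_norm M (hadamard \<Psi>) \<le> r (hadamard ?S) powr (1 / 2)"
    by (rule set_norm_hadamard_le_spectral_radius[OF \<Psi> \<tau> \<nu> r])
  have "r (hadamard ?S) powr (1 / 2) \<le> (r (hadamard ?\<Omega>) powr (1 / real m)) powr (1 / 2)"
    using spectral_radius_hadamard_le_cyclic[OF S r] nn unfolding \<Omega>_eq by (intro powr_mono2) auto
  then show "r (hadamard ?S) powr (1 / 2) \<le> r (hadamard ?\<Omega>) powr (1 / (2 * real m))"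
    by (simp add: powr_powr mult.commute)
  have "r (hadamard ?\<Omega>) powr (1 / (2 * real m)) \<le> (r (op_set_prod (map ?S [1..<Suc m])) powr (\<alpha> * real m)) powr (1 / (2 * real m))"
    using spectral_radius_hadamard_cyclic_le[OF S r] nn unfolding \<Omega>_eq by (intro powr_mono2) auto
  then show "r (hadamard ?\<Omega>) powr (1 / (2 * real m)) \<le> r (op_set_prod (map ?S [1..<Suc m])) powr (\<alpha> / 2)"
    using m by (simp add: powr_powr)
qed

end

end

section \<open>Matrices as kernels for counting measure\<close>

lemma has_nonneg_matrix_eq_kernel:
  assumes R: "countable R"
  shows "has_nonneg_matrix R = has_nonneg_kernel (count_space R)"
proof (intro ext)
  fix A :: "'a oper" and a
  \<comment> \<open>For countable R the product measure is again a counting measure, so every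
    function on R x R is measurable.\<close>
  have meas: "k \<in> borel_measurable (count_space R \<Otimes>\<^sub>M count_space R)" for k :: "'a \<times> 'a \<Rightarrow> complex"
    by (simp add: pair_measure_countable R)
  \<comment> \<open>Unconditional summability of complex numbers is absolute summability, that is,
    integrability for counting measure.\<close>
  have *: "((\<lambda>j. complex_of_real (a i j) * x j) summable_on R \<and> A x i = (\<Sum>\<^sub>\<infinity>j\<in>R. complex_of_real (a i j) * x j)) \<longleftrightarrow>
      (integrable (count_space R) (\<lambda>j. complex_of_real (a i j) * x j) \<and>
       A x i = (LINT j|count_space R. complex_of_real (a i j) * x j))" for x i
    using infsetsum_infsum[of "\<lambda>j. complex_of_real (a i j) * x j" R]
    by (auto simp: summable_on_iff_abs_summable_on_complex abs_summable_equivalent abs_summable_on_def infsetsum_def)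
  show "has_nonneg_matrix R A a = has_nonneg_kernel (count_space R) A a"
    unfolding has_nonneg_matrix_def has_nonneg_kernel_def has_kernel_def
    using meas * by (auto simp: AE_count_space)
qed

theorem theorem3p13:
  fixes m :: nat and \<tau> \<nu> :: "nat \<Rightarrow> nat"
  assumes "1 \<le> m" and "\<tau> permutes {1..m}" and "\<nu> permutes {1..m}"
  shows
    "(\<forall>(M :: 'a measure) (\<Psi> :: nat \<Rightarrow> 'a oper set).
        \<forall>r \<in> {generalized_spectral_radius M, joint_spectral_radius M}.
        sigma_finite_measure M \<and> space M \<noteq> {} \<and>
        (\<forall>j\<in>{1..m}. bounded_op_set M (\<Psi> j) \<and> (\<forall>A\<in>\<Psi> j. positive_kernel_operator M A)) \<longrightarrow>
        set_norm M (kernel_hadamard M m (\<lambda>_. 1 / real m) \<Psi>)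
          \<le> r (kernel_hadamard M m (\<lambda>_. 1 / real m) (star_pair M \<tau> \<nu> \<Psi>)) powr (1 / 2) \<and>
        r (kernel_hadamard M m (\<lambda>_. 1 / real m) (star_pair M \<tau> \<nu> \<Psi>)) powr (1 / 2)
          \<le> r (kernel_hadamard M m (\<lambda>_. 1 / real m) (Omega_set M m \<tau> \<nu> \<Psi>)) powr (1 / (2 * real m)) \<and>
        r (kernel_hadamard M m (\<lambda>_. 1 / real m) (Omega_set M m \<tau> \<nu> \<Psi>)) powr (1 / (2 * real m))
          \<le> r (op_set_prod (map (star_pair M \<tau> \<nu> \<Psi>) [1..<Suc m])) powr (1 / (2 * real m)))
   \<and>
     (\<forall>(R :: nat set) (\<Psi> :: nat \<Rightarrow> nat oper set) (\<alpha> :: real).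
        \<forall>r \<in> {generalized_spectral_radius (count_space R), joint_spectral_radius (count_space R)}.
        (R = {1..} \<or> (\<exists>N\<ge>1. R = {1..N})) \<and> 1 / real m \<le> \<alpha> \<and>
        (\<forall>j\<in>{1..m}. bounded_op_set (count_space R) (\<Psi> j) \<and>
                     (\<forall>A\<in>\<Psi> j. nonneg_matrix_operator R A)) \<longrightarrow>
        set_norm (count_space R) (matrix_hadamard R m (\<lambda>_. \<alpha>) \<Psi>)
          \<le> r (matrix_hadamard R m (\<lambda>_. \<alpha>) (star_pair (count_space R) \<tau> \<nu> \<Psi>)) powr (1 / 2) \<and>
        r (matrix_hadamard R m (\<lambda>_. \<alpha>) (star_pair (count_space R) \<tau> \<nu> \<Psi>)) powr (1 / 2)
          \<le> r (matrix_hadamard R m (\<lambda>_. \<alpha>) (Omega_set (count_space R) m \<tau> \<nu> \<Psi>))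
               powr (1 / (2 * real m)) \<and>
        r (matrix_hadamard R m (\<lambda>_. \<alpha>) (Omega_set (count_space R) m \<tau> \<nu> \<Psi>)) powr (1 / (2 * real m))
          \<le> r (op_set_prod (map (star_pair (count_space R) \<tau> \<nu> \<Psi>) [1..<Suc m])) powr (\<alpha> / 2))"
proof (rule conjI; intro allI ballI impI; elim conjE)
  let "(\<forall>M \<Psi>. \<forall>r\<in>?D M. ?A M \<Psi> \<longrightarrow> ?P M \<Psi> r) \<and>
    (\<forall>R \<Psi> \<alpha>. \<forall>r\<in>?D' R. ?A' R \<Psi> \<alpha> \<longrightarrow> ?P' R \<Psi> \<alpha> r)" = ?thesis
  note ineqs = sigma_finite_measure.hadamard_spectral_radius_inequalities[OF _ _ _ assms(2,3)]
  {
    fix M :: "'a measure" and \<Psi> :: "nat \<Rightarrow> 'a oper set" and r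
    assume r: "r \<in> {generalized_spectral_radius M, joint_spectral_radius M}"
      and M: "sigma_finite_measure M"
      and \<Psi>: "\<forall>j\<in>{1..m}. bounded_op_set M (\<Psi> j) \<and> (\<forall>A\<in>\<Psi> j. positive_kernel_operator M A)"
    have e: "hadamard_exponent M m (1 / real m)"
      using assms(1) by (simp add: hadamard_exponent_def)
    have p: "positive_op_set M (\<Psi> j)" if "j \<in> {1..m}" for j
      using \<Psi> that by (auto simp: positive_op_set_def positive_kernel_operator_def)
    \<comment> \<open>At \<alpha> = 1 / m the last exponent \<alpha> / 2 is 1 / (2 m).\<close>
    show "?P M \<Psi> r"
      using ineqs[OF M e p r] by (simp add: mult.commute)
  }
  fix R :: "nat set" and \<Psi> :: "nat \<Rightarrow> nat oper set" and \<alpha> :: real and r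
  let ?M = "count_space R"
  assume r: "r \<in> {generalized_spectral_radius ?M, joint_spectral_radius ?M}" and a: "1 / real m \<le> \<alpha>"
    and \<Psi>: "\<forall>j\<in>{1..m}. bounded_op_set ?M (\<Psi> j) \<and> (\<forall>A\<in>\<Psi> j. nonneg_matrix_operator R A)"
  have eq: "has_nonneg_matrix R = has_nonneg_kernel ?M"
    by (rule has_nonneg_matrix_eq_kernel) simp
  then have h: "matrix_hadamard R = kernel_hadamard ?M"
    by (simp add: matrix_hadamard_def kernel_hadamard_def)
  have M: "sigma_finite_measure ?M"
    by (rule sigma_finite_measure_count_space_countable) simp
  have e: "hadamard_exponent ?M m \<alpha>"
    using assms(1) a by (auto simp: hadamard_exponent_def)
  have p: "positive_op_set ?M (\<Psi> j)" if "j \<in> {1..m}" for j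
    using \<Psi> that has_nonneg_kernel_positive
    unfolding positive_op_set_def nonneg_matrix_operator_def eq by blast
  show "?P' R \<Psi> \<alpha> r"
    unfolding h using ineqs[OF M e p r] by simp
qed

end
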